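(* Let $(N^{2k},\hat J)$ be an almost complex submanifold of an almost quaternionic skew-Hermitian manifold $(M^{4n},Q,\omega)$, $n>1$. For $X,Y\in\Gamma(TN)$ set $$V^\psi_{X,Y}:=\psi(X)Y-\psi(\hat JX)\hat JY-\psi(Y)X+\psi(\hat JY)\hat JX.$$ If $(M,Q,\omega)$ is torsion-free or of type $\mathcal X_{345}$ (i.e. $Q$ is quaternionic), then both $N_{\hat J}(X,Y)$ and $V^\psi_{X,Y}$ lie in the $Q$-invariant directions of $TN$: $N_{\hat J}(X,Y)\in\Gamma(T^QN)$ and $V^\psi_{X,Y}\in\Gamma(T^QN)$ for all $X,Y\in\Gamma(TN)$.
   Context: An almost quaternionic structure on $M^{4n}$ ($n>1$) is a rank-3 subbundle $Q\subset\mathrm{End}(TM)$ locally spanned by an admissible basis $J_1,J_2,J_3$, i.e. $J_a^2=-\mathrm{Id}$, $J_1J_2=J_3=-J_2J_1$. An almost quaternionic skew-Hermitian (qs-H) manifold $(M^{4n},Q,\omega)$ is such a manifold with a non-degenerate 2-form $\omega$ satisfying $\omega(J_aX,J_aY)=\omega(X,Y)$ for every admissible basis. Adapted connection. $N_J(X,Y)=[JX,JY]-J[JX,Y]-J[X,JY]-[X,Y]$. The Obata connection $\nabla^H$ of an admissible basis $H=\{J_a\}$ is the unique connection with $\nabla^HJ_a=0$ and torsion $T^H=\frac16\sum_aN_{J_a}$. With $\mathrm{vol}=\omega^{2n}$, the unimodular Oproiu connection $\nabla^{Q,\mathrm{vol}}$ is the unique connection preserving $Q$ and $\mathrm{vol}$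 whose torsion is, for any admissible basis, $T^Q=T^H+\sum_a\partial(\tau_a\otimes J_a)$, where $\tau_a(X)=\frac1{4n-2}\mathrm{tr}(J_aT^H_X)$ and $\partial(\tau\otimes J)(X,Y)=\tau(X)JY-\tau(Y)JX$. Then $\nabla^{Q,\omega}=\nabla^{Q,\mathrm{vol}}+A$ with $\omega(A(X,Y),Z)=\frac12(\nabla^{Q,\mathrm{vol}}_X\omega)(Y,Z)$; it preserves $Q$ and $\omega$, and $T^{Q,\omega}$ is its torsion. Torsion-free means $T^{Q,\omega}=0$; $Q$ is quaternionic iff $T^Q=0$. Given an admissible basis, local 1-forms $\gamma_a$ are defined by $\nabla^{Q,\omega}_XJ_a=\gamma_c(X)J_b-\gamma_b(X)J_c$ for every cyclic permutation $(a,b,c)$ of $(1,2,3)$. A submanifold $N^{2k}\subset M$ with an almost complex structure $\hat J$ on $N$ is an almost complex submanifold of $(M,Q,\omega)$ if $\hat J$ is the restriction to $TN$ of a section of $Q$ along $N$ (which preserves $TN$). An adapted basis is a (local) admissible basis $\{J_a\}$ of $Q$ with $J_1|_{TN}=\hat J$; such a basis is fixed, and $\psi=\gamma_3\circ J_1-\gamma_2$ is the associated local 1-form. $T^Q_xN$ is the maximal $Q_x$-invariant subspace of $T_xN$; it equals $J_2T_xN\cap T_xN$. $T^QN\subset TN$ is the union of these subspaces. *)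

theory Defs
  imports "HOL-Analysis.Analysis"
begin

section \<open>Smooth manifolds given by an atlas\<close>

text \<open>C-infinity maps on an open set \<open>S\<close>: all iterated directional derivatives exist and are
  continuous on \<open>S\<close>. Both notions are only used for open \<open>S\<close>.\<close>

primrec ck_on :: "nat \<Rightarrow> ('a::euclidean_space \<Rightarrow> 'b::euclidean_space) \<Rightarrow> 'a set \<Rightarrow> bool" where
  "ck_on 0 f S \<longleftrightarrow> continuous_on S f"
| "ck_on (Suc k) f S \<longleftrightarrow> (\<forall>x\<in>S. f differentiable at x) \<and>
     (\<forall>v. ck_on k (\<lambda>x. frechet_derivative f (at x) v) S)"

definition smooth_on :: "'a set \<Rightarrow> ('a::euclidean_space \<Rightarrow> 'b::euclidean_space) \<Rightarrow> bool" where
  "smooth_on S f \<longleftrightarrow> (\<forall>k. ck_on k f S)"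

type_synonym ('m, 'e) chart = "'m set \<times> ('m \<Rightarrow> 'e)"
type_synonym ('m, 'e) atlas = "('m, 'e) chart set"

definition smooth_atlas :: "('m::topological_space, 'e::euclidean_space) atlas \<Rightarrow> bool" where
  "smooth_atlas \<A> \<longleftrightarrow>
     (\<Union>c\<in>\<A>. fst c) = UNIV \<and>
     (\<forall>(U, \<phi>)\<in>\<A>. open U \<and> open (\<phi> ` U) \<and> homeomorphism U (\<phi> ` U) \<phi> (inv_into U \<phi>)) \<and>
     (\<forall>(U, \<phi>)\<in>\<A>. \<forall>(V, \<psi>)\<in>\<A>. smooth_on (\<phi> ` (U \<inter> V)) (\<psi> \<circ> inv_into U \<phi>))"

definition smooth_fun ::
  "('m::topological_space, 'e::euclidean_space) atlas \<Rightarrow> 'm set \<Rightarrow> ('m \<Rightarrow> 'b::euclidean_space) \<Rightarrow> bool" where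
  "smooth_fun \<A> W f \<longleftrightarrow> (\<forall>(U, \<phi>)\<in>\<A>. smooth_on (\<phi> ` (U \<inter> W)) (f \<circ> inv_into U \<phi>))"

definition smooth_fun_at ::
  "('m::topological_space, 'e::euclidean_space) atlas \<Rightarrow> 'm \<Rightarrow> ('m \<Rightarrow> 'b::euclidean_space) \<Rightarrow> bool" where
  "smooth_fun_at \<A> p f \<longleftrightarrow> (\<exists>W. open W \<and> p \<in> W \<and> smooth_fun \<A> W f)"

section \<open>Tangent vectors and tensor fields\<close>

text \<open>The tangent space at \<open>p\<close> is the model space \<open>'e\<close>, a vector being identified with its
  components in the chart \<open>chart_at \<A> p\<close> selected at \<open>p\<close>. As the selected chart may jump from point to
  point, smoothness of a vector field is not smoothness of the underlying function into \<open>'e\<close>: it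
  is tested on components with respect to a fixed chart of the atlas. The components of a vector
  \<open>v\<close> at \<open>p\<close> in a chart \<open>c\<close> are \<open>mderiv \<A> (snd c) p v\<close>, the differential of the chart map.\<close>

definition chart_at :: "('m, 'e) atlas \<Rightarrow> 'm \<Rightarrow> ('m, 'e) chart" where
  "chart_at \<A> p = (SOME c. c \<in> \<A> \<and> p \<in> fst c)"

definition mderiv ::
  "('m, 'e::euclidean_space) atlas \<Rightarrow> ('m \<Rightarrow> 'b::euclidean_space) \<Rightarrow> 'm \<Rightarrow> 'e \<Rightarrow> 'b" where
  "mderiv \<A> f p v =
     (case chart_at \<A> p of (U, \<phi>) \<Rightarrow> frechet_derivative (f \<circ> inv_into U \<phi>) (at (\<phi> p)) v)"

definition smooth_vf ::
  "('m::topological_space, 'e::euclidean_space) atlas \<Rightarrow> 'm set \<Rightarrow> ('m \<Rightarrow> 'e) \<Rightarrow> bool" where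
  "smooth_vf \<A> W X \<longleftrightarrow> (\<forall>c\<in>\<A>. smooth_fun \<A> (W \<inter> fst c) (\<lambda>p. mderiv \<A> (snd c) p (X p)))"

definition smooth_vf_at ::
  "('m::topological_space, 'e::euclidean_space) atlas \<Rightarrow> 'm \<Rightarrow> ('m \<Rightarrow> 'e) \<Rightarrow> bool" where
  "smooth_vf_at \<A> p X \<longleftrightarrow> (\<exists>W. open W \<and> p \<in> W \<and> smooth_vf \<A> W X)"

text \<open>In the coordinates of the selected chart at \<open>p\<close> this is \<open>DY(X) - DX(Y)\<close>.\<close>

definition lie_bracket ::
  "('m, 'e::euclidean_space) atlas \<Rightarrow> ('m \<Rightarrow> 'e) \<Rightarrow> ('m \<Rightarrow> 'e) \<Rightarrow> 'm \<Rightarrow> 'e" where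
  "lie_bracket \<A> X Y p = (let \<phi> = snd (chart_at \<A> p) in
     mderiv \<A> (\<lambda>q. mderiv \<A> \<phi> q (Y q)) p (X p) - mderiv \<A> (\<lambda>q. mderiv \<A> \<phi> q (X q)) p (Y p))"

text \<open>The local vector field with constant components in the selected chart at \<open>p\<close> and value \<open>v\<close>
  at \<open>p\<close>; used to evaluate tensorial expressions in vector fields on a single vector.\<close>

definition coord_vf :: "('m, 'e::euclidean_space) atlas \<Rightarrow> 'm \<Rightarrow> 'e \<Rightarrow> 'm \<Rightarrow> 'e" where
  "coord_vf \<A> p v q = inv (mderiv \<A> (snd (chart_at \<A> p)) q) v"

definition smooth_endo ::
  "('m::topological_space, 'e::euclidean_space) atlas \<Rightarrow> 'm set \<Rightarrow> ('m \<Rightarrow> 'e \<Rightarrow> 'e) \<Rightarrow> bool" where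
  "smooth_endo \<A> U J \<longleftrightarrow> (\<forall>p\<in>U. linear (J p)) \<and>
     (\<forall>W X. open W \<longrightarrow> W \<subseteq> U \<longrightarrow> smooth_vf \<A> W X \<longrightarrow> smooth_vf \<A> W (\<lambda>p. J p (X p)))"

definition smooth_1form ::
  "('m::topological_space, 'e::euclidean_space) atlas \<Rightarrow> 'm set \<Rightarrow> ('m \<Rightarrow> 'e \<Rightarrow> real) \<Rightarrow> bool" where
  "smooth_1form \<A> U \<alpha> \<longleftrightarrow> (\<forall>p\<in>U. linear (\<alpha> p)) \<and>
     (\<forall>W X. open W \<longrightarrow> W \<subseteq> U \<longrightarrow> smooth_vf \<A> W X \<longrightarrow> smooth_fun \<A> W (\<lambda>p. \<alpha> p (X p)))"

definition smooth_2form ::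
  "('m::topological_space, 'e::euclidean_space) atlas \<Rightarrow> ('m \<Rightarrow> 'e \<Rightarrow> 'e \<Rightarrow> real) \<Rightarrow> bool" where
  "smooth_2form \<A> \<omega> \<longleftrightarrow> (\<forall>p. bilinear (\<omega> p) \<and> (\<forall>v. \<omega> p v v = 0)) \<and>
     (\<forall>W X Y. open W \<longrightarrow> smooth_vf \<A> W X \<longrightarrow> smooth_vf \<A> W Y \<longrightarrow>
        smooth_fun \<A> W (\<lambda>p. \<omega> p (X p) (Y p)))"

definition endo_trace :: "('e::euclidean_space \<Rightarrow> 'e) \<Rightarrow> real" where
  "endo_trace f = (\<Sum>b\<in>Basis. f b \<bullet> b)"

definition nijenhuis ::
  "('m, 'e::euclidean_space) atlas \<Rightarrow> ('m \<Rightarrow> 'e \<Rightarrow> 'e) \<Rightarrow> ('m \<Rightarrow> 'e) \<Rightarrow> ('m \<Rightarrow> 'e) \<Rightarrow> 'm \<Rightarrow> 'e" where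
  "nijenhuis \<A> J X Y p = (let JX = (\<lambda>q. J q (X q)); JY = (\<lambda>q. J q (Y q)) in
     lie_bracket \<A> JX JY p - J p (lie_bracket \<A> JX Y p) - J p (lie_bracket \<A> X JY p)
       - lie_bracket \<A> X Y p)"

section \<open>Linear connections\<close>

text \<open>\<open>D p v Y\<close> is the covariant derivative at \<open>p\<close>, in direction \<open>v\<close>, of a vector field \<open>Y\<close> which is
  only required to be smooth near \<open>p\<close>; its value for other \<open>Y\<close> is irrelevant. That it depends only
  on the germ of \<open>Y\<close> at \<open>p\<close> follows from the Leibniz rule.\<close>

type_synonym ('m, 'e) conn = "'m \<Rightarrow> 'e \<Rightarrow> ('m \<Rightarrow> 'e) \<Rightarrow> 'e"

definition connection ::
  "('m::topological_space, 'e::euclidean_space) atlas \<Rightarrow> ('m, 'e) conn \<Rightarrow> bool" where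
  "connection \<A> D \<longleftrightarrow>
     (\<forall>p Y. smooth_vf_at \<A> p Y \<longrightarrow> linear (\<lambda>v. D p v Y)) \<and>
     (\<forall>p v Y Z. smooth_vf_at \<A> p Y \<longrightarrow> smooth_vf_at \<A> p Z \<longrightarrow>
        D p v (\<lambda>q. Y q + Z q) = D p v Y + D p v Z) \<and>
     (\<forall>p v (f::'m \<Rightarrow> real) Y. smooth_fun_at \<A> p f \<longrightarrow> smooth_vf_at \<A> p Y \<longrightarrow>
        D p v (\<lambda>q. f q *\<^sub>R Y q) = mderiv \<A> f p v *\<^sub>R Y p + f p *\<^sub>R D p v Y) \<and>
     (\<forall>W X Y. open W \<longrightarrow> smooth_vf \<A> W X \<longrightarrow> smooth_vf \<A> W Y \<longrightarrow>
        smooth_vf \<A> W (\<lambda>p. D p (X p) Y))"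

definition torsion ::
  "('m, 'e::euclidean_space) atlas \<Rightarrow> ('m, 'e) conn \<Rightarrow> ('m \<Rightarrow> 'e) \<Rightarrow> ('m \<Rightarrow> 'e) \<Rightarrow> 'm \<Rightarrow> 'e" where
  "torsion \<A> D X Y p = D p (X p) Y - D p (Y p) X - lie_bracket \<A> X Y p"

definition torsion_free ::
  "('m::topological_space, 'e::euclidean_space) atlas \<Rightarrow> ('m, 'e) conn \<Rightarrow> bool" where
  "torsion_free \<A> D \<longleftrightarrow>
     (\<forall>p X Y. smooth_vf_at \<A> p X \<longrightarrow> smooth_vf_at \<A> p Y \<longrightarrow> torsion \<A> D X Y p = 0)"

text \<open>The covariant derivatives \<open>(D\<^sub>v J) Y\<close> and \<open>(D\<^sub>v \<omega>)(Y, Z)\<close> at \<open>p\<close>.\<close>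

definition cov_endo ::
  "('m, 'e::euclidean_space) conn \<Rightarrow> ('m \<Rightarrow> 'e \<Rightarrow> 'e) \<Rightarrow> 'm \<Rightarrow> 'e \<Rightarrow> ('m \<Rightarrow> 'e) \<Rightarrow> 'e" where
  "cov_endo D J p v Y = D p v (\<lambda>q. J q (Y q)) - J p (D p v Y)"

definition cov_2form ::
  "('m, 'e::euclidean_space) atlas \<Rightarrow> ('m, 'e) conn \<Rightarrow> ('m \<Rightarrow> 'e \<Rightarrow> 'e \<Rightarrow> real) \<Rightarrow>
   'm \<Rightarrow> 'e \<Rightarrow> ('m \<Rightarrow> 'e) \<Rightarrow> ('m \<Rightarrow> 'e) \<Rightarrow> real" where
  "cov_2form \<A> D \<omega> p v Y Z =
     mderiv \<A> (\<lambda>q. \<omega> q (Y q) (Z q)) p v - \<omega> p (D p v Y) (Z p) - \<omega> p (Y p) (D p v Z)"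

section \<open>Almost quaternionic skew-Hermitian manifolds\<close>

text \<open>\<open>Q p\<close> is the fibre at \<open>p\<close> of a subbundle of the endomorphism bundle. A local admissible basis
  on an open set \<open>U\<close> is \<open>J 1, J 2, J 3\<close>; other values of the index are irrelevant.\<close>

definition admissible_basis ::
  "('m::topological_space, 'e::euclidean_space) atlas \<Rightarrow> ('m \<Rightarrow> ('e \<Rightarrow> 'e) set) \<Rightarrow>
   'm set \<Rightarrow> (nat \<Rightarrow> 'm \<Rightarrow> 'e \<Rightarrow> 'e) \<Rightarrow> bool" where
  "admissible_basis \<A> Q U J \<longleftrightarrow> open U \<and>
     (\<forall>a\<in>{1, 2, 3}. smooth_endo \<A> U (J a) \<and> (\<forall>p\<in>U. \<forall>v. J a p (J a p v) = - v)) \<and>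
     (\<forall>p\<in>U. \<forall>v. J 1 p (J 2 p v) = J 3 p v \<and> J 2 p (J 1 p v) = - J 3 p v) \<and>
     (\<forall>p\<in>U. Q p = {\<lambda>v. x *\<^sub>R J 1 p v + y *\<^sub>R J 2 p v + z *\<^sub>R J 3 p v | x y z. True})"

definition almost_quaternionic ::
  "('m::topological_space, 'e::euclidean_space) atlas \<Rightarrow> ('m \<Rightarrow> ('e \<Rightarrow> 'e) set) \<Rightarrow> bool" where
  "almost_quaternionic \<A> Q \<longleftrightarrow> (\<forall>p. \<exists>U J. p \<in> U \<and> admissible_basis \<A> Q U J)"

definition almost_qsH ::
  "('m::topological_space, 'e::euclidean_space) atlas \<Rightarrow> ('m \<Rightarrow> ('e \<Rightarrow> 'e) set) \<Rightarrow>
   ('m \<Rightarrow> 'e \<Rightarrow> 'e \<Rightarrow> real) \<Rightarrow> bool" where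
  "almost_qsH \<A> Q \<omega> \<longleftrightarrow> almost_quaternionic \<A> Q \<and> smooth_2form \<A> \<omega> \<and>
     (\<forall>p v. (\<forall>w. \<omega> p v w = 0) \<longrightarrow> v = 0) \<and>
     (\<forall>U J. admissible_basis \<A> Q U J \<longrightarrow>
        (\<forall>p\<in>U. \<forall>a\<in>{1, 2, 3}. \<forall>v w. \<omega> p (J a p v) (J a p w) = \<omega> p v w))"

text \<open>The top exterior power of \<open>\<omega>\<close>, evaluated on the vectors \<open>Y 0, ..., Y (DIM('e) - 1)\<close>
  (determinant convention for the wedge product).\<close>

definition omega_vol :: "('m \<Rightarrow> 'e::euclidean_space \<Rightarrow> 'e \<Rightarrow> real) \<Rightarrow> 'm \<Rightarrow> (nat \<Rightarrow> 'e) \<Rightarrow> real" where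
  "omega_vol \<omega> p Y = (1 / 2 ^ (DIM('e) div 2)) *
     (\<Sum>\<sigma> | \<sigma> permutes {..<DIM('e)}. of_int (sign \<sigma>) *
        (\<Prod>i<DIM('e) div 2. \<omega> p (Y (\<sigma> (2 * i))) (Y (\<sigma> (2 * i + 1)))))"

definition preserves_Q ::
  "('m::topological_space, 'e::euclidean_space) atlas \<Rightarrow> ('m \<Rightarrow> ('e \<Rightarrow> 'e) set) \<Rightarrow> ('m, 'e) conn \<Rightarrow> bool" where
  "preserves_Q \<A> Q D \<longleftrightarrow>
     (\<forall>U S. open U \<longrightarrow> smooth_endo \<A> U S \<longrightarrow> (\<forall>p\<in>U. S p \<in> Q p) \<longrightarrow>
        (\<forall>p\<in>U. \<forall>v. \<exists>B\<in>Q p. \<forall>Y. smooth_vf_at \<A> p Y \<longrightarrow> cov_endo D S p v Y = B (Y p)))"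

definition preserves_vol ::
  "('m::topological_space, 'e::euclidean_space) atlas \<Rightarrow> ('m \<Rightarrow> 'e \<Rightarrow> 'e \<Rightarrow> real) \<Rightarrow> ('m, 'e) conn \<Rightarrow> bool" where
  "preserves_vol \<A> \<omega> D \<longleftrightarrow>
     (\<forall>p v Y. (\<forall>i<DIM('e). smooth_vf_at \<A> p (Y i)) \<longrightarrow>
        mderiv \<A> (\<lambda>q. omega_vol \<omega> q (\<lambda>i. Y i q)) p v =
        (\<Sum>i<DIM('e). omega_vol \<omega> p ((\<lambda>j. Y j p)(i := D p v (Y i)))))"

text \<open>The torsion of the Obata connection of an admissible basis, and the 1-forms \<open>\<tau>\<^sub>a\<close>; here
  \<open>DIM('e) - 2 = 4n - 2\<close>.\<close>

definition obata_torsion ::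
  "('m, 'e::euclidean_space) atlas \<Rightarrow> (nat \<Rightarrow> 'm \<Rightarrow> 'e \<Rightarrow> 'e) \<Rightarrow> ('m \<Rightarrow> 'e) \<Rightarrow> ('m \<Rightarrow> 'e) \<Rightarrow> 'm \<Rightarrow> 'e" where
  "obata_torsion \<A> J X Y p = (1 / 6) *\<^sub>R (\<Sum>a\<in>{1, 2, 3}. nijenhuis \<A> (J a) X Y p)"

definition oproiu_tau ::
  "('m, 'e::euclidean_space) atlas \<Rightarrow> (nat \<Rightarrow> 'm \<Rightarrow> 'e \<Rightarrow> 'e) \<Rightarrow> nat \<Rightarrow> ('m \<Rightarrow> 'e) \<Rightarrow> 'm \<Rightarrow> real" where
  "oproiu_tau \<A> J a X p =
     endo_trace (\<lambda>w. J a p (obata_torsion \<A> J X (coord_vf \<A> p w) p)) / (real DIM('e) - 2)"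

text \<open>The characterising properties of the unimodular Oproiu connection for \<open>vol = \<omega>\<close> to the power
  \<open>2n\<close>; they determine it uniquely. \<open>Q\<close> is quaternionic, i.e. of type \<open>X\<^sub>3\<^sub>4\<^sub>5\<close>, iff this connection is
  torsion-free.\<close>

definition unimodular_oproiu ::
  "('m::topological_space, 'e::euclidean_space) atlas \<Rightarrow> ('m \<Rightarrow> ('e \<Rightarrow> 'e) set) \<Rightarrow>
   ('m \<Rightarrow> 'e \<Rightarrow> 'e \<Rightarrow> real) \<Rightarrow> ('m, 'e) conn \<Rightarrow> bool" where
  "unimodular_oproiu \<A> Q \<omega> D \<longleftrightarrow> connection \<A> D \<and> preserves_Q \<A> Q D \<and> preserves_vol \<A> \<omega> D \<and>
     (\<forall>U J. admissible_basis \<A> Q U J \<longrightarrow>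
        (\<forall>p\<in>U. \<forall>X Y. smooth_vf_at \<A> p X \<longrightarrow> smooth_vf_at \<A> p Y \<longrightarrow>
           torsion \<A> D X Y p = obata_torsion \<A> J X Y p +
             (\<Sum>a\<in>{1, 2, 3}. oproiu_tau \<A> J a X p *\<^sub>R J a p (Y p)
                            - oproiu_tau \<A> J a Y p *\<^sub>R J a p (X p))))"

text \<open>\<open>D\<close> is the connection \<open>Dvol + A\<close> with \<open>\<omega>(A(X,Y),Z) = (Dvol\<^sub>X \<omega>)(Y,Z) / 2\<close>.\<close>

definition qsH_connection ::
  "('m::topological_space, 'e::euclidean_space) atlas \<Rightarrow> ('m \<Rightarrow> 'e \<Rightarrow> 'e \<Rightarrow> real) \<Rightarrow>
   ('m, 'e) conn \<Rightarrow> ('m, 'e) conn \<Rightarrow> bool" where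
  "qsH_connection \<A> \<omega> Dvol D \<longleftrightarrow>
     (\<exists>A. (\<forall>p v Y. smooth_vf_at \<A> p Y \<longrightarrow> D p v Y = Dvol p v Y + A p v (Y p)) \<and>
          (\<forall>p v Y Z. smooth_vf_at \<A> p Y \<longrightarrow> smooth_vf_at \<A> p Z \<longrightarrow>
             \<omega> p (A p v (Y p)) (Z p) = cov_2form \<A> Dvol \<omega> p v Y Z / 2))"

definition connection_forms ::
  "('m::topological_space, 'e::euclidean_space) atlas \<Rightarrow> ('m, 'e) conn \<Rightarrow> 'm set \<Rightarrow>
   (nat \<Rightarrow> 'm \<Rightarrow> 'e \<Rightarrow> 'e) \<Rightarrow> (nat \<Rightarrow> 'm \<Rightarrow> 'e \<Rightarrow> real) \<Rightarrow> bool" where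
  "connection_forms \<A> D U J \<gamma> \<longleftrightarrow> (\<forall>a\<in>{1, 2, 3}. smooth_1form \<A> U (\<gamma> a)) \<and>
     (\<forall>(a, b, c)\<in>{(1, 2, 3), (2, 3, 1), (3, 1, 2)}. \<forall>p\<in>U. \<forall>v Y. smooth_vf_at \<A> p Y \<longrightarrow>
        cov_endo D (J a) p v Y = \<gamma> c p v *\<^sub>R J b p (Y p) - \<gamma> b p v *\<^sub>R J c p (Y p))"

definition psi_form ::
  "(nat \<Rightarrow> 'm \<Rightarrow> 'e \<Rightarrow> 'e) \<Rightarrow> (nat \<Rightarrow> 'm \<Rightarrow> 'e \<Rightarrow> real) \<Rightarrow> 'm \<Rightarrow> 'e \<Rightarrow> real" where
  "psi_form J \<gamma> p v = \<gamma> 3 p (J 1 p v) - \<gamma> 2 p v"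

section \<open>Almost complex submanifolds\<close>

text \<open>A submanifold is a manifold \<open>N\<close> (with atlas \<open>\<B>\<close>) together with an injective immersion \<open>\<iota>\<close>, the
  inclusion, into \<open>M\<close> (with atlas \<open>\<A>\<close>). The tangent space of \<open>N\<close> at \<open>x\<close> is regarded as the subspace
  \<open>range (tangent_map \<B> \<A> \<iota> x)\<close> of the tangent space of \<open>M\<close> at \<open>\<iota> x\<close>.\<close>

definition tangent_map ::
  "('n, 'f::euclidean_space) atlas \<Rightarrow> ('m, 'e::euclidean_space) atlas \<Rightarrow> ('n \<Rightarrow> 'm) \<Rightarrow> 'n \<Rightarrow> 'f \<Rightarrow> 'e" where
  "tangent_map \<B> \<A> \<iota> x v = mderiv \<B> (snd (chart_at \<A> (\<iota> x)) \<circ> \<iota>) x v"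

definition submanifold ::
  "('n::topological_space, 'f::euclidean_space) atlas \<Rightarrow>
   ('m::topological_space, 'e::euclidean_space) atlas \<Rightarrow> ('n \<Rightarrow> 'm) \<Rightarrow> bool" where
  "submanifold \<B> \<A> \<iota> \<longleftrightarrow> continuous_on UNIV \<iota> \<and>
     (\<forall>c\<in>\<A>. smooth_fun \<B> (\<iota> -` fst c) (snd c \<circ> \<iota>)) \<and>
     inj \<iota> \<and> (\<forall>x. inj (tangent_map \<B> \<A> \<iota> x))"

definition smooth_vf_along ::
  "('n::topological_space, 'f::euclidean_space) atlas \<Rightarrow>
   ('m::topological_space, 'e::euclidean_space) atlas \<Rightarrow> ('n \<Rightarrow> 'm) \<Rightarrow> 'n set \<Rightarrow> ('n \<Rightarrow> 'e) \<Rightarrow> bool" where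
  "smooth_vf_along \<B> \<A> \<iota> V Z \<longleftrightarrow>
     (\<forall>c\<in>\<A>. smooth_fun \<B> (V \<inter> \<iota> -` fst c) (\<lambda>x. mderiv \<A> (snd c) (\<iota> x) (Z x)))"

definition section_along ::
  "('n::topological_space, 'f::euclidean_space) atlas \<Rightarrow>
   ('m::topological_space, 'e::euclidean_space) atlas \<Rightarrow> ('m \<Rightarrow> ('e \<Rightarrow> 'e) set) \<Rightarrow>
   ('n \<Rightarrow> 'm) \<Rightarrow> ('n \<Rightarrow> 'e \<Rightarrow> 'e) \<Rightarrow> bool" where
  "section_along \<B> \<A> Q \<iota> S \<longleftrightarrow> (\<forall>x. S x \<in> Q (\<iota> x)) \<and>
     (\<forall>W X. open W \<longrightarrow> smooth_vf \<A> W X \<longrightarrow>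
        smooth_vf_along \<B> \<A> \<iota> (\<iota> -` W) (\<lambda>x. S x (X (\<iota> x))))"

definition almost_complex_structure ::
  "('n::topological_space, 'f::euclidean_space) atlas \<Rightarrow> ('n \<Rightarrow> 'f \<Rightarrow> 'f) \<Rightarrow> bool" where
  "almost_complex_structure \<B> J \<longleftrightarrow> smooth_endo \<B> UNIV J \<and> (\<forall>x v. J x (J x v) = - v)"

definition almost_complex_submanifold ::
  "('n::topological_space, 'f::euclidean_space) atlas \<Rightarrow> ('n \<Rightarrow> 'f \<Rightarrow> 'f) \<Rightarrow>
   ('m::topological_space, 'e::euclidean_space) atlas \<Rightarrow> ('m \<Rightarrow> ('e \<Rightarrow> 'e) set) \<Rightarrow> ('n \<Rightarrow> 'm) \<Rightarrow> bool" where
  "almost_complex_submanifold \<B> Jhat \<A> Q \<iota> \<longleftrightarrow>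
     submanifold \<B> \<A> \<iota> \<and> almost_complex_structure \<B> Jhat \<and>
     (\<exists>S. section_along \<B> \<A> Q \<iota> S \<and>
        (\<forall>x v. S x (tangent_map \<B> \<A> \<iota> x v) = tangent_map \<B> \<A> \<iota> x (Jhat x v)))"

text \<open>An admissible basis on \<open>U\<close> that is adapted on the open part \<open>W\<close> of \<open>N\<close>. For an embedded
  submanifold one may take \<open>W = \<iota> -` U\<close>; in general several sheets of \<open>N\<close> may meet \<open>U\<close>.\<close>

definition adapted_basis ::
  "('n::topological_space, 'f::euclidean_space) atlas \<Rightarrow> ('n \<Rightarrow> 'f \<Rightarrow> 'f) \<Rightarrow>
   ('m::topological_space, 'e::euclidean_space) atlas \<Rightarrow> ('m \<Rightarrow> ('e \<Rightarrow> 'e) set) \<Rightarrow> ('n \<Rightarrow> 'm) \<Rightarrow>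
   'n set \<Rightarrow> 'm set \<Rightarrow> (nat \<Rightarrow> 'm \<Rightarrow> 'e \<Rightarrow> 'e) \<Rightarrow> bool" where
  "adapted_basis \<B> Jhat \<A> Q \<iota> W U J \<longleftrightarrow> admissible_basis \<A> Q U J \<and> open W \<and> \<iota> ` W \<subseteq> U \<and>
     (\<forall>x\<in>W. \<forall>v. J 1 (\<iota> x) (tangent_map \<B> \<A> \<iota> x v) = tangent_map \<B> \<A> \<iota> x (Jhat x v))"

text \<open>The maximal \<open>Q\<close>-invariant subspace of the tangent space of \<open>N\<close> at \<open>x\<close>, obtained as the sum of
  all \<open>Q\<close>-invariant subspaces.\<close>

definition TQ ::
  "('n, 'f::euclidean_space) atlas \<Rightarrow> ('m, 'e::euclidean_space) atlas \<Rightarrow> ('m \<Rightarrow> ('e \<Rightarrow> 'e) set) \<Rightarrow>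
   ('n \<Rightarrow> 'm) \<Rightarrow> 'n \<Rightarrow> 'e set" where
  "TQ \<B> \<A> Q \<iota> x = span (\<Union>{L. subspace L \<and> L \<subseteq> range (tangent_map \<B> \<A> \<iota> x) \<and>
                              (\<forall>B\<in>Q (\<iota> x). B ` L \<subseteq> L)})"

text \<open>Since the dimension of \<open>TQ\<close> may vary with the point, its sections over \<open>V\<close> are the smooth
  vector fields on \<open>V\<close> with values in \<open>TQ\<close>.\<close>

definition section_TQ ::
  "('n::topological_space, 'f::euclidean_space) atlas \<Rightarrow>
   ('m::topological_space, 'e::euclidean_space) atlas \<Rightarrow> ('m \<Rightarrow> ('e \<Rightarrow> 'e) set) \<Rightarrow>
   ('n \<Rightarrow> 'm) \<Rightarrow> 'n set \<Rightarrow> ('n \<Rightarrow> 'f) \<Rightarrow> bool" where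
  "section_TQ \<B> \<A> Q \<iota> V Z \<longleftrightarrow> smooth_vf \<B> V Z \<and>
     (\<forall>x\<in>V. tangent_map \<B> \<A> \<iota> x (Z x) \<in> TQ \<B> \<A> Q \<iota> x)"

text \<open>\<open>V\<^sup>\<psi>\<close> for a family of linear forms \<open>\<psi>\<close> on the tangent spaces of \<open>N\<close>.\<close>

definition V_psi ::
  "('n \<Rightarrow> 'f \<Rightarrow> 'f::euclidean_space) \<Rightarrow> ('n \<Rightarrow> 'f \<Rightarrow> real) \<Rightarrow> ('n \<Rightarrow> 'f) \<Rightarrow> ('n \<Rightarrow> 'f) \<Rightarrow> 'n \<Rightarrow> 'f" where
  "V_psi Jhat \<psi> X Y x =
     \<psi> x (X x) *\<^sub>R Y x - \<psi> x (Jhat x (X x)) *\<^sub>R Jhat x (Y x)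
     - \<psi> x (Y x) *\<^sub>R X x + \<psi> x (Jhat x (Y x)) *\<^sub>R Jhat x (X x)"

end

theory Submission
  imports Defs
begin

text \<open>Both \<open>D\<close> and \<open>Dvol\<close> differentiate \<open>J 1\<close> in the same way: their difference \<open>A\<close> commutes with \<open>J 1\<close>,
  because \<open>\<omega>\<close> is \<open>J 1\<close>-invariant and the derivative of \<open>J 1\<close> lies in \<open>Q\<close> and anticommutes with \<open>J 1\<close>. So in
  both cases there is a torsion-free connection for which \<open>J 1\<close> has covariant derivative
  \<open>\<gamma> 3 J 2 - \<gamma> 2 J 3\<close>, and expressing the brackets by this connection gives
  \<open>N(X, Y) = J 2 V(X, Y)\<close> with \<open>N\<close> the Nijenhuis tensor of \<open>Jhat\<close> and \<open>V\<close> the vector field \<open>V\<^sup>\<psi>\<close>. Both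
  \<open>N\<close> and \<open>V\<close> are tangent to the submanifold, hence they lie in the \<open>Q\<close>-invariant subspace
  \<open>TN \<inter> J 2 TN\<close>. Vector fields on \<open>N\<close> are never extended to \<open>M\<close>: the Nijenhuis tensors of \<open>N\<close> and \<open>M\<close> are
  compared in charts by differentiating the relation \<open>dg(K v) = J dg(v)\<close> between the matrices of the
  two structures, the second derivatives of the inclusion cancelling by symmetry.\<close>

section \<open>Calculus of smooth maps on open sets\<close>

text \<open>The form \<open>\<psi>\<close> is what the bracket computation leaves over. With
  \<open>C u w = \<gamma> 3 u J 2 w - \<gamma> 2 u J 3 w\<close>, the combination
  \<open>C (J 1 u) w - J 1 (C u w)\<close> equals
  \<open>\<psi> u J 2 w + \<psi> (J 1 u) J 3 w\<close>, and \<open>J 3 = - J 2 J 1\<close> makes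
  this \<open>J 2\<close> of the first half of V; exchanging \<open>u\<close> and \<open>w\<close>
  gives the other half. The two claims have different domains. V is asserted where the adapted basis
  lives, the Nijenhuis tensor on all of N, where no adapted basis is given. Building one near an
  arbitrary point would mean extending the section of Q off N, and the inclusion is only an
  injective immersion. But membership in \<open>TQ\<close> is a pointwise condition that mentions no
  basis, so a basis agreeing with \<open>Jhat\<close> at a single point is enough. Its disagreement
  elsewhere enters only through first derivatives of coefficients, and these merely change the two
  forms multiplying \<open>J 2\<close> and \<open>J 3\<close>: the Nijenhuis vector is still
  \<open>J 2\<close> of some tangent vector.\<close>

lemma frechet_derivative_eq:
  "(f has_derivative f') (at x) \<Longrightarrow> frechet_derivative f (at x) = f'"
  using frechet_derivative_at by blast

lemma has_derivative_cong_open: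
  assumes "open S" "x \<in> S" "\<And>y. y \<in> S \<Longrightarrow> f y = g y"
  shows "(f has_derivative f') (at x) \<longleftrightarrow> (g has_derivative f') (at x)"
  using has_derivative_transform_within_open[OF _ assms(1,2), of f f' UNIV g]
    has_derivative_transform_within_open[OF _ assms(1,2), of g f' UNIV f] assms(3) by auto

lemma frechet_derivative_cong_open:
  assumes "open S" "x \<in> S" "\<And>y. y \<in> S \<Longrightarrow> f y = g y"
  shows "frechet_derivative f (at x) = frechet_derivative g (at x)"
  by (simp only: frechet_derivative_def has_derivative_cong_open[OF assms])

lemma differentiable_cong_open:
  assumes "open S" "x \<in> S" "\<And>y. y \<in> S \<Longrightarrow> f y = g y"
  shows "f differentiable at x \<longleftrightarrow> g differentiable at x"
  by (simp only: differentiable_def has_derivative_cong_open[OF assms])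

section \<open>Closure properties of the classes C^k and C-infinity\<close>

lemma ck_on_Suc_imp: "ck_on (Suc k) f S \<Longrightarrow> ck_on k f S"
proof (induction k arbitrary: f)
  case 0
  then show ?case
    by (simp add: differentiable_imp_continuous_on differentiable_at_imp_differentiable_on)
next
  case (Suc k)
  have "ck_on k (\<lambda>x. frechet_derivative f (at x) v) S" for v
    by (rule Suc.IH) (use Suc.prems in auto)
  then show ?case using Suc.prems by simp
qed

lemma ck_on_subset: "ck_on k f S \<Longrightarrow> T \<subseteq> S \<Longrightarrow> ck_on k f T"
  by (induction k arbitrary: f) (auto intro: continuous_on_subset)

lemma ck_on_cong:
  assumes "open S" "\<And>x. x \<in> S \<Longrightarrow> f x = g x"
  shows "ck_on k f S \<longleftrightarrow> ck_on k g S"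
  using assms(2)
proof (induction k arbitrary: f g)
  case 0
  then show ?case by (simp cong: continuous_on_cong)
next
  case (Suc k)
  have "ck_on k (\<lambda>x. frechet_derivative f (at x) v) S \<longleftrightarrow>
        ck_on k (\<lambda>x. frechet_derivative g (at x) v) S" for v
    by (rule Suc.IH) (use frechet_derivative_cong_open[OF assms(1) _ Suc.prems] in simp)
  moreover have "f differentiable at x \<longleftrightarrow> g differentiable at x" if "x \<in> S" for x
    using that Suc.prems assms(1) differentiable_cong_open by blast
  ultimately show ?case by simp
qed

lemma ck_on_local:
  assumes "\<And>x. x \<in> S \<Longrightarrow> \<exists>T. open T \<and> x \<in> T \<and> ck_on k f T"
  shows "ck_on k f S"
  using assms
proof (induction k arbitrary: f)
  case 0
  show ?case
    unfolding ck_on.simps continuous_on_eq_continuous_within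
  proof
    fix x assume "x \<in> S"
    with 0 obtain T where "open T" "x \<in> T" "continuous_on T f" by auto
    then have "continuous (at x) f"
      by (simp add: continuous_on_eq_continuous_at)
    then show "continuous (at x within S) f"
      by (rule continuous_at_imp_continuous_at_within)
  qed
next
  case (Suc k)
  have "ck_on k (\<lambda>x. frechet_derivative f (at x) v) S" for v
    by (rule Suc.IH) (use Suc.prems in fastforce)
  moreover have "f differentiable at x" if "x \<in> S" for x
    using Suc.prems[OF that] by auto
  ultimately show ?case by simp
qed

text \<open>Lets the inductions below supply an explicit derivative \<open>f'\<close> and apply the
  induction hypothesis to its formula, instead of to the term
  \<open>frechet_derivative f (at x) v\<close>.\<close>

lemma ck_on_SucI:
  assumes "open S" "\<And>x. x \<in> S \<Longrightarrow> (f has_derivative f' x) (at x)"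
    and "\<And>v. ck_on k (\<lambda>x. f' x v) S"
  shows "ck_on (Suc k) f S"
proof -
  have "ck_on k (\<lambda>x. frechet_derivative f (at x) v) S \<longleftrightarrow> ck_on k (\<lambda>x. f' x v) S" for v
    by (rule ck_on_cong) (use assms frechet_derivative_eq in fastforce)+
  then show ?thesis
    using assms by (auto simp: differentiable_def)
qed

lemma has_derivative_frechet:
  "f differentiable at x \<Longrightarrow> (f has_derivative frechet_derivative f (at x)) (at x)"
  by (simp add: frechet_derivative_works)

lemma ck_on_const: "ck_on k (\<lambda>x. c) S"
  by (induction k arbitrary: c) auto

lemma ck_on_add:
  assumes "open S" "ck_on k f S" "ck_on k g S"
  shows "ck_on k (\<lambda>x. f x + g x) S"
  using assms(2,3)
proof (induction k arbitrary: f g)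
  case 0
  then show ?case by (simp add: continuous_on_add)
next
  case (Suc k)
  show ?case
    by (rule ck_on_SucI[OF assms(1)])
      (rule has_derivative_add[OF has_derivative_frechet has_derivative_frechet],
       use Suc in auto)
qed

lemma ck_on_bilinear:
  fixes f :: "'x::euclidean_space \<Rightarrow> 'a::euclidean_space"
    and g :: "'x \<Rightarrow> 'b::euclidean_space" and h :: "'a \<Rightarrow> 'b \<Rightarrow> 'c::euclidean_space"
  assumes h: "bounded_bilinear h" and "open S" "ck_on k f S" "ck_on k g S"
  shows "ck_on k (\<lambda>x. h (f x) (g x)) S"
  using assms(3,4)
proof (induction k arbitrary: f g)
  case 0
  then show ?case by (simp add: bounded_bilinear.continuous_on[OF h])
next
  case (Suc k)
  show ?case
  proof (rule ck_on_SucI[OF assms(2)])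
    show "((\<lambda>x. h (f x) (g x)) has_derivative
       (\<lambda>v. h (f x) (frechet_derivative g (at x) v) + h (frechet_derivative f (at x) v) (g x))) (at x)"
      if "x \<in> S" for x
      by (rule bounded_bilinear.FDERIV[OF h has_derivative_frechet has_derivative_frechet])
        (use Suc that in auto)
    show "ck_on k (\<lambda>x. h (f x) (frechet_derivative g (at x) v)
        + h (frechet_derivative f (at x) v) (g x)) S" for v
      by (intro ck_on_add assms(2) Suc.IH) (use Suc.prems ck_on_Suc_imp in auto)
  qed
qed

lemma ck_on_linear:
  assumes "bounded_linear L" "open S" "ck_on k f S"
  shows "ck_on k (\<lambda>x. L (f x)) S"
  using assms(3)
proof (induction k arbitrary: f)
  case 0
  then show ?case by (simp add: bounded_linear.continuous_on[OF assms(1)])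
next
  case (Suc k)
  show ?case
    by (rule ck_on_SucI[OF assms(2)])
      (rule bounded_linear.has_derivative[OF assms(1) has_derivative_frechet], use Suc in auto)
qed

lemma ck_on_sum:
  assumes "open S" "finite I" "\<And>i. i \<in> I \<Longrightarrow> ck_on k (f i) S"
  shows "ck_on k (\<lambda>x. \<Sum>i\<in>I. f i x) S"
  using assms(2,3) by (induction I) (auto simp: ck_on_const intro!: ck_on_add assms(1))

lemma linear_Basis_expansion:
  assumes "linear L"
  shows "L v = (\<Sum>i\<in>Basis. (v \<bullet> i) *\<^sub>R L i)"
proof -
  have "L (\<Sum>i\<in>Basis. (v \<bullet> i) *\<^sub>R i) = (\<Sum>i\<in>Basis. (v \<bullet> i) *\<^sub>R L i)"
    using assms by (simp only: linear_sum linear_scale)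
  then show ?thesis by (simp only: euclidean_representation)
qed

text \<open>\<open>ck_on\<close> speaks of maps between Euclidean spaces, so a matrix field
  \<open>K\<close> is controlled only through its columns \<open>K x v\<close>. Expanding the
  argument in the basis turns the application into a finite sum of scalar times column.\<close>

lemma ck_on_apply:
  fixes K :: "'x::euclidean_space \<Rightarrow> 'a::euclidean_space \<Rightarrow> 'b::euclidean_space"
  assumes "open S" "\<And>x. x \<in> S \<Longrightarrow> linear (K x)" "\<And>v. ck_on k (\<lambda>x. K x v) S" "ck_on k h S"
  shows "ck_on k (\<lambda>x. K x (h x)) S"
proof -
  have "ck_on k (\<lambda>x. \<Sum>i\<in>Basis. (h x \<bullet> i) *\<^sub>R K x i) S"
    by (intro ck_on_sum assms(1) finite_Basis ck_on_bilinear[OF bounded_bilinear_scaleR]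
        ck_on_linear[OF bounded_linear_inner_left] assms(3,4))
  then show ?thesis
    by (subst ck_on_cong[OF assms(1) linear_Basis_expansion[OF assms(2)]])
qed

text \<open>In the chain rule both the outer derivative and the vector it acts on vary with
  \<open>x\<close>, which is the situation of \<open>ck_on_apply\<close>. The induction varies
  \<open>f\<close> and fixes \<open>g\<close>: its hypothesis is used for the directional
  derivatives of \<open>f\<close>.\<close>

lemma ck_on_compose:
  assumes "open S" "open T" "ck_on k f T" "ck_on k g S" "g ` S \<subseteq> T"
  shows "ck_on k (\<lambda>x. f (g x)) S"
  using assms(3,4)
proof (induction k arbitrary: f)
  case 0
  then show ?case
    using assms(5) by (auto intro: continuous_on_compose2)
next
  case (Suc k)
  have d: "f differentiable at (g x)" "g differentiable at x" if "x \<in> S" for x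
    using Suc.prems that assms(5) by auto
  show ?case
  proof (rule ck_on_SucI[OF assms(1)])
    show "((\<lambda>x. f (g x)) has_derivative
      (\<lambda>v. frechet_derivative f (at (g x)) (frechet_derivative g (at x) v))) (at x)"
      if "x \<in> S" for x
      using has_derivative_compose[OF has_derivative_frechet[OF d(2)] has_derivative_frechet[OF d(1)]]
        that by simp
    fix v
    show "ck_on k (\<lambda>x. frechet_derivative f (at (g x)) (frechet_derivative g (at x) v)) S"
    proof (rule ck_on_apply[OF assms(1), where K = "\<lambda>x. frechet_derivative f (at (g x))"])
      show "linear (frechet_derivative f (at (g x)))" if "x \<in> S" for x
        using d(1)[OF that] by (rule linear_frechet_derivative)
      show "ck_on k (\<lambda>x. frechet_derivative f (at (g x)) u) S" for u
        using Suc.prems ck_on_Suc_imp by (intro Suc.IH) auto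
    qed (use Suc.prems in simp)
  qed
qed

lemma smooth_on_subset: "smooth_on S f \<Longrightarrow> T \<subseteq> S \<Longrightarrow> smooth_on T f"
  by (auto simp: smooth_on_def intro: ck_on_subset)

lemma smooth_on_cong:
  "open S \<Longrightarrow> (\<And>x. x \<in> S \<Longrightarrow> f x = g x) \<Longrightarrow> smooth_on S f \<longleftrightarrow> smooth_on S g"
  unfolding smooth_on_def using ck_on_cong by blast

lemma smooth_on_transform:
  "open S \<Longrightarrow> smooth_on S f \<Longrightarrow> (\<And>x. x \<in> S \<Longrightarrow> f x = g x) \<Longrightarrow> smooth_on S g"
  using smooth_on_cong[of S f g] by simp

lemma smooth_on_local:
  "(\<And>x. x \<in> S \<Longrightarrow> \<exists>T. open T \<and> x \<in> T \<and> smooth_on T f) \<Longrightarrow> smooth_on S f"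
  unfolding smooth_on_def by (meson ck_on_local)

lemma smooth_on_differentiable: "smooth_on S f \<Longrightarrow> x \<in> S \<Longrightarrow> f differentiable at x"
  unfolding smooth_on_def by (meson ck_on.simps(2))

lemma smooth_on_deriv: "smooth_on S f \<Longrightarrow> smooth_on S (\<lambda>x. frechet_derivative f (at x) v)"
  using ck_on.simps(2) unfolding smooth_on_def by blast

lemma smooth_on_const: "smooth_on S (\<lambda>x. c)"
  by (simp add: smooth_on_def ck_on_const)

lemma smooth_on_add:
  "open S \<Longrightarrow> smooth_on S f \<Longrightarrow> smooth_on S g \<Longrightarrow> smooth_on S (\<lambda>x. f x + g x)"
  by (simp add: smooth_on_def ck_on_add)

lemma smooth_on_bilinear:
  "bounded_bilinear h \<Longrightarrow> open S \<Longrightarrow> smooth_on S f \<Longrightarrow> smooth_on S g \<Longrightarrow>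
   smooth_on S (\<lambda>x. h (f x) (g x))"
  by (simp add: smooth_on_def ck_on_bilinear)

lemmas smooth_on_scaleR = smooth_on_bilinear[OF bounded_bilinear_scaleR]

lemma smooth_on_linear:
  "bounded_linear L \<Longrightarrow> open S \<Longrightarrow> smooth_on S f \<Longrightarrow> smooth_on S (\<lambda>x. L (f x))"
  by (simp add: smooth_on_def ck_on_linear)

lemma smooth_on_diff:
  "open S \<Longrightarrow> smooth_on S f \<Longrightarrow> smooth_on S g \<Longrightarrow> smooth_on S (\<lambda>x. f x - g x)"
  using smooth_on_add[of S f "\<lambda>x. - g x"]
    smooth_on_linear[OF bounded_linear_minus[OF bounded_linear_ident], of S g] by simp

lemma smooth_on_sum:
  "open S \<Longrightarrow> finite I \<Longrightarrow> (\<And>i. i \<in> I \<Longrightarrow> smooth_on S (f i)) \<Longrightarrow> smooth_on S (\<lambda>x. \<Sum>i\<in>I. f i x)"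
  by (simp add: smooth_on_def ck_on_sum)

lemma smooth_on_apply:
  "open S \<Longrightarrow> (\<And>x. x \<in> S \<Longrightarrow> linear (K x)) \<Longrightarrow> (\<And>v. smooth_on S (\<lambda>x. K x v)) \<Longrightarrow> smooth_on S h \<Longrightarrow>
   smooth_on S (\<lambda>x. K x (h x))"
  by (simp add: smooth_on_def ck_on_apply)

lemma smooth_on_compose:
  "open S \<Longrightarrow> open T \<Longrightarrow> smooth_on T f \<Longrightarrow> smooth_on S g \<Longrightarrow> g ` S \<subseteq> T \<Longrightarrow>
   smooth_on S (\<lambda>x. f (g x))"
  unfolding smooth_on_def by (blast intro: ck_on_compose)

lemma smooth_on_deriv_apply:
  "open S \<Longrightarrow> smooth_on S f \<Longrightarrow> smooth_on S h \<Longrightarrow>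
   smooth_on S (\<lambda>x. frechet_derivative f (at x) (h x))"
  by (rule smooth_on_apply)
    (auto intro: linear_frechet_derivative smooth_on_differentiable smooth_on_deriv)

text \<open>Leibniz rule for a matrix field acting on a vector field, from differentiability of the
  columns alone. The first summand freezes the argument at \<open>h x\<close>, so it is a
  directional derivative of one fixed column combination.\<close>

lemma has_derivative_apply:
  fixes K :: "'x::euclidean_space \<Rightarrow> 'a::euclidean_space \<Rightarrow> 'b::euclidean_space"
  assumes "open S" "x \<in> S" "\<And>y. y \<in> S \<Longrightarrow> linear (K y)"
    and "\<And>v. (\<lambda>y. K y v) differentiable at x" and "h differentiable at x"
  shows "((\<lambda>y. K y (h y)) has_derivative
    (\<lambda>u. frechet_derivative (\<lambda>y. K y (h x)) (at x) u + K x (frechet_derivative h (at x) u))) (at x)"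
proof -
  note hd = has_derivative_frechet
  have 1: "((\<lambda>y. \<Sum>i\<in>Basis. (h y \<bullet> i) *\<^sub>R K y i) has_derivative
     (\<lambda>u. \<Sum>i\<in>Basis. (h x \<bullet> i) *\<^sub>R frechet_derivative (\<lambda>y. K y i) (at x) u
        + (frechet_derivative h (at x) u \<bullet> i) *\<^sub>R K x i)) (at x)"
    by (intro has_derivative_sum has_derivative_scaleR has_derivative_inner_left hd assms)
  have "((\<lambda>y. \<Sum>i\<in>Basis. (h x \<bullet> i) *\<^sub>R K y i) has_derivative
     (\<lambda>u. \<Sum>i\<in>Basis. (h x \<bullet> i) *\<^sub>R frechet_derivative (\<lambda>y. K y i) (at x) u)) (at x)"
    by (intro has_derivative_sum has_derivative_scaleR_right hd assms)
  then have "((\<lambda>y. K y (h x)) has_derivative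
     (\<lambda>u. \<Sum>i\<in>Basis. (h x \<bullet> i) *\<^sub>R frechet_derivative (\<lambda>y. K y i) (at x) u)) (at x)"
    by (rule has_derivative_transform_within_open[OF _ assms(1,2)])
      (simp add: linear_Basis_expansion[OF assms(3), symmetric])
  from frechet_derivative_eq[OF this]
  have "(\<lambda>u. frechet_derivative (\<lambda>y. K y (h x)) (at x) u + K x (frechet_derivative h (at x) u))
     = (\<lambda>u. \<Sum>i\<in>Basis. (h x \<bullet> i) *\<^sub>R frechet_derivative (\<lambda>y. K y i) (at x) u
        + (frechet_derivative h (at x) u \<bullet> i) *\<^sub>R K x i)"
    by (simp add: sum.distrib linear_Basis_expansion[OF assms(3)[OF assms(2)], symmetric])
  then show ?thesis
    using has_derivative_transform_within_open[OF 1 assms(1,2), of "\<lambda>y. K y (h y)"]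
    by (simp only: linear_Basis_expansion[OF assms(3), symmetric])
qed

section \<open>Symmetry of second derivatives\<close>

lemma second_difference_estimate:
  fixes f :: "'a::euclidean_space \<Rightarrow> real"
  assumes "open S" "x \<in> S" "ck_on 2 f S" "e > 0"
  shows "\<forall>\<^sub>F h in at_right 0.
     \<bar>f (x + h *\<^sub>R u + h *\<^sub>R v) - f (x + h *\<^sub>R u) - f (x + h *\<^sub>R v) + f x
        - h\<^sup>2 * frechet_derivative (\<lambda>y. frechet_derivative f (at y) u) (at x) v\<bar> \<le> e * h\<^sup>2"
proof -
  \<comment> \<open>Mean value theorem twice: along \<open>u\<close> for the increment in
    \<open>v\<close>, then along \<open>v\<close> for \<open>F\<close>. The second difference
    becomes \<open>h\<^sup>2\<close> times \<open>G\<close> at an intermediate point, and continuity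
    of \<open>G\<close> at \<open>x\<close> bounds the error. The difference itself is symmetric in
    \<open>u\<close> and \<open>v\<close>, which is what the estimate is for.\<close>
  define F where "F = (\<lambda>y. frechet_derivative f (at y) u)"
  define G where "G = (\<lambda>y. frechet_derivative F (at y) v)"
  have df: "(f has_derivative frechet_derivative f (at y)) (at y)"
    and dF: "(F has_derivative frechet_derivative F (at y)) (at y)" if "y \<in> S" for y
    using assms(3) that by (auto simp: numeral_2_eq_2 F_def intro!: has_derivative_frechet)
  have "continuous_on S G"
    using assms(3) by (auto simp: numeral_2_eq_2 F_def G_def)
  then have "isCont G x"
    using assms(1,2) by (simp add: continuous_on_eq_continuous_at)
  then obtain d1 where d1: "d1 > 0" "\<And>y. dist y x < d1 \<Longrightarrow> \<bar>G y - G x\<bar> < e"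
    unfolding continuous_at_eps_delta using assms(4) by (auto simp: dist_real_def)
  obtain d2 where d2: "d2 > 0" "ball x d2 \<subseteq> S"
    using assms(1,2) openE by blast
  \<comment> \<open>For steps \<open>s\<close>, \<open>t\<close> below \<open>d\<close> the
    displacement along \<open>u\<close> and \<open>v\<close> stays shorter than
    \<open>min d1 d2\<close>; the summand 1 keeps the denominator positive when both directions
    vanish.\<close>
  define d where "d = min d1 d2 / (norm u + norm v + 1)"
  have pos: "norm u + norm v + 1 > 0"
    by (meson add_nonneg_pos add_nonneg_nonneg norm_ge_zero zero_less_one)
  have "d > 0"
    using d1(1) d2(1) pos by (simp add: d_def)
  have near: "dist (x + s *\<^sub>R u + t *\<^sub>R v) x < min d1 d2"
    if "0 \<le> s" "s \<le> h" "0 \<le> t" "t \<le> h" "h < d" for s t h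
  proof -
    have "dist (x + s *\<^sub>R u + t *\<^sub>R v) x = norm (s *\<^sub>R u + t *\<^sub>R v)"
      by (simp add: dist_norm)
    also have "\<dots> \<le> s * norm u + t * norm v"
      using norm_triangle_ineq[of "s *\<^sub>R u" "t *\<^sub>R v"] that by simp
    also have "\<dots> \<le> h * norm u + h * norm v"
      using that by (intro add_mono mult_right_mono) auto
    also have "\<dots> \<le> h * (norm u + norm v + 1)"
      using that by (simp add: algebra_simps)
    also have "\<dots> < d * (norm u + norm v + 1)"
      using that pos by (intro mult_strict_right_mono)
    also have "\<dots> = min d1 d2"
      using pos by (simp add: d_def)
    finally show ?thesis .
  qed
  then have inS: "x + s *\<^sub>R u + t *\<^sub>R v \<in> S"
    if "0 \<le> s" "s \<le> h" "0 \<le> t" "t \<le> h" "h < d" for s t h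
    using d2(2) that by (fastforce simp: dist_commute)
  have "\<bar>f (x + h *\<^sub>R u + h *\<^sub>R v) - f (x + h *\<^sub>R u) - f (x + h *\<^sub>R v) + f x - h\<^sup>2 * G x\<bar> \<le> e * h\<^sup>2"
    if h: "0 < h" "h < d" for h
  proof -
    \<comment> \<open>The idle term \<open>0 *\<^sub>R v\<close> gives both values of
      \<open>f\<close> the same shape, so one derivative computation, at \<open>t = h\<close> and at
      \<open>t = 0\<close>, serves both.\<close>
    define p where "p s = f (x + s *\<^sub>R u + h *\<^sub>R v) - f (x + s *\<^sub>R u + 0 *\<^sub>R v)" for s
    have dp: "(p has_derivative (\<lambda>r. r * (F (x + s *\<^sub>R u + h *\<^sub>R v) - F (x + s *\<^sub>R u + 0 *\<^sub>R v)))) (at s)"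
      if "0 \<le> s" "s \<le> h" for s
    proof -
      have "((\<lambda>s. f (x + s *\<^sub>R u + t *\<^sub>R v)) has_derivative (\<lambda>r. r * F (x + s *\<^sub>R u + t *\<^sub>R v))) (at s)"
        if "0 \<le> t" "t \<le> h" for t
      proof -
        have S: "x + s *\<^sub>R u + t *\<^sub>R v \<in> S"
          using inS h \<open>0 \<le> s\<close> \<open>s \<le> h\<close> that by blast
        have "((\<lambda>s. x + s *\<^sub>R u + t *\<^sub>R v) has_derivative (\<lambda>r. r *\<^sub>R u)) (at s)"
          by (auto intro!: derivative_eq_intros)
        from has_derivative_compose[OF this df[OF S]] show ?thesis
          using linear_scale[OF has_derivative_linear[OF df[OF S]]] by (simp add: F_def)
      qed
      from has_derivative_diff[OF this[of h] this[of 0]] show ?thesis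
        using h unfolding p_def by (simp add: algebra_simps)
    qed
    obtain s where s: "0 < s" "s < h"
      "p h - p 0 = h * (F (x + s *\<^sub>R u + h *\<^sub>R v) - F (x + s *\<^sub>R u + 0 *\<^sub>R v))"
      using mvt_simple[OF h(1), of p, OF has_derivative_at_withinI[OF dp]] by auto
    define q where "q t = F (x + s *\<^sub>R u + t *\<^sub>R v)" for t
    have dq: "(q has_derivative (\<lambda>r. r * G (x + s *\<^sub>R u + t *\<^sub>R v))) (at t)" if "0 \<le> t" "t \<le> h" for t
    proof -
      have S: "x + s *\<^sub>R u + t *\<^sub>R v \<in> S"
        by (rule inS[of _ h]) (use h s that in auto)
      have "((\<lambda>t. x + s *\<^sub>R u + t *\<^sub>R v) has_derivative (\<lambda>r. r *\<^sub>R v)) (at t)"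
        by (auto intro!: derivative_eq_intros)
      from has_derivative_compose[OF this dF[OF S]] show ?thesis
        using linear_scale[OF has_derivative_linear[OF dF[OF S]]] unfolding q_def by (simp add: G_def)
    qed
    obtain t where t: "0 < t" "t < h" "q h - q 0 = h * G (x + s *\<^sub>R u + t *\<^sub>R v)"
      using mvt_simple[OF h(1), of q, OF has_derivative_at_withinI[OF dq]] by auto
    have "p h - p 0 = h\<^sup>2 * G (x + s *\<^sub>R u + t *\<^sub>R v)"
      using s(3) t(3) by (simp add: q_def power2_eq_square)
    then have "\<bar>p h - p 0 - h\<^sup>2 * G x\<bar> = h\<^sup>2 * \<bar>G (x + s *\<^sub>R u + t *\<^sub>R v) - G x\<bar>"
      by (simp add: abs_mult flip: right_diff_distrib)
    also have "\<dots> \<le> h\<^sup>2 * e"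
      using near[of s h t] s t h by (intro mult_left_mono less_imp_le[OF d1(2)]) auto
    finally show ?thesis
      by (simp add: p_def algebra_simps)
  qed
  then show ?thesis
    unfolding eventually_at_right_field G_def F_def using \<open>d > 0\<close> by blast
qed

lemma second_derivative_symmetric_real:
  fixes f :: "'a::euclidean_space \<Rightarrow> real"
  assumes "open S" "x \<in> S" "ck_on 2 f S"
  shows "frechet_derivative (\<lambda>y. frechet_derivative f (at y) u) (at x) v =
         frechet_derivative (\<lambda>y. frechet_derivative f (at y) v) (at x) u" (is "?A = ?B")
proof (rule ccontr)
  assume "?A \<noteq> ?B"
  \<comment> \<open>The gap is \<open>3 * e\<close>, while the two estimates together allow at most
    \<open>2 * e\<close>.\<close>
  define e where "e = \<bar>?A - ?B\<bar> / 3"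
  have "e > 0" using \<open>?A \<noteq> ?B\<close> by (simp add: e_def)
  have "\<forall>\<^sub>F h::real in at_right 0. 0 < h"
    by (simp add: eventually_at_right_less)
  with second_difference_estimate[OF assms \<open>e > 0\<close>, of u v]
    second_difference_estimate[OF assms \<open>e > 0\<close>, of v u]
  have "\<forall>\<^sub>F h in at_right (0::real). False"
  proof eventually_elim
    case (elim h)
    have "x + h *\<^sub>R v + h *\<^sub>R u = x + h *\<^sub>R u + h *\<^sub>R v" by simp
    with elim have "\<bar>h\<^sup>2 * ?A - h\<^sup>2 * ?B\<bar> \<le> 2 * (e * h\<^sup>2)" by simp
    moreover have "\<bar>h\<^sup>2 * ?A - h\<^sup>2 * ?B\<bar> = h\<^sup>2 * \<bar>?A - ?B\<bar>"
      by (simp add: abs_mult flip: right_diff_distrib)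
    ultimately have "h\<^sup>2 * \<bar>?A - ?B\<bar> \<le> h\<^sup>2 * (2 * e)"
      by (simp add: mult.commute mult.left_commute)
    then show False
      using elim(3) \<open>e > 0\<close> by (simp add: e_def)
  qed
  then show False by simp
qed

lemma second_derivative_symmetric:
  assumes "open S" "x \<in> S" "smooth_on S f"
  shows "frechet_derivative (\<lambda>y. frechet_derivative f (at y) u) (at x) v =
         frechet_derivative (\<lambda>y. frechet_derivative f (at y) v) (at x) u"
proof (rule euclidean_eqI)
  fix b :: 'b
  have *: "frechet_derivative (\<lambda>y. frechet_derivative f (at y) u) (at x) v \<bullet> b =
     frechet_derivative (\<lambda>y. frechet_derivative (\<lambda>z. f z \<bullet> b) (at y) u) (at x) v" for u v
  proof -
    have "frechet_derivative (\<lambda>z. f z \<bullet> b) (at y) u = frechet_derivative f (at y) u \<bullet> b" if "y \<in> S" for y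
      by (simp add: frechet_derivative_eq[OF has_derivative_inner_left[OF has_derivative_frechet[OF
              smooth_on_differentiable[OF assms(3) that]]]])
    then have "frechet_derivative (\<lambda>y. frechet_derivative (\<lambda>z. f z \<bullet> b) (at y) u) (at x)
      = frechet_derivative (\<lambda>y. frechet_derivative f (at y) u \<bullet> b) (at x)"
      by (rule frechet_derivative_cong_open[OF assms(1,2)])
    also have "\<dots> = (\<lambda>v. frechet_derivative (\<lambda>y. frechet_derivative f (at y) u) (at x) v \<bullet> b)"
      by (rule frechet_derivative_eq, rule has_derivative_inner_left, rule has_derivative_frechet)
        (rule smooth_on_differentiable[OF smooth_on_deriv[OF assms(3)] assms(2)])
    finally show ?thesis by simp
  qed
  show "frechet_derivative (\<lambda>y. frechet_derivative f (at y) u) (at x) v \<bullet> b =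
         frechet_derivative (\<lambda>y. frechet_derivative f (at y) v) (at x) u \<bullet> b"
    unfolding *
    by (rule second_derivative_symmetric_real[OF assms(1,2)])
      (use smooth_on_linear[OF bounded_linear_inner_left assms(1,3)] in \<open>auto simp: smooth_on_def\<close>)
qed

section \<open>Brackets and Nijenhuis tensors in a vector space\<close>

lemma bracket_related:
  fixes g :: "'a::euclidean_space \<Rightarrow> 'b::euclidean_space"
  assumes "open S" "x \<in> S" and g: "smooth_on S g"
    and X: "X differentiable at x" and Y: "Y differentiable at x"
    and X': "X' differentiable at (g x)" and Y': "Y' differentiable at (g x)"
    and relX: "\<And>y. y \<in> S \<Longrightarrow> X' (g y) = frechet_derivative g (at y) (X y)"
    and relY: "\<And>y. y \<in> S \<Longrightarrow> Y' (g y) = frechet_derivative g (at y) (Y y)"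
  shows "frechet_derivative g (at x)
      (frechet_derivative Y (at x) (X x) - frechet_derivative X (at x) (Y x)) =
    frechet_derivative Y' (at (g x)) (X' (g x)) - frechet_derivative X' (at (g x)) (Y' (g x))"
proof -
  have dg: "g differentiable at y" if "y \<in> S" for y
    using smooth_on_differentiable[OF g that] .
  \<comment> \<open>The relation between \<open>Z\<close> and \<open>Z'\<close>, differentiated
    along \<open>g\<close>. In the bracket the terms with the second derivative of \<open>g\<close>
    occur as a difference of \<open>(X, Y)\<close> and \<open>(Y, X)\<close> and cancel by
    symmetry.\<close>
  have *: "frechet_derivative Z' (at (g x)) (frechet_derivative g (at x) u)
      = frechet_derivative (\<lambda>y. frechet_derivative g (at y) (Z x)) (at x) u
        + frechet_derivative g (at x) (frechet_derivative Z (at x) u)"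
    if "Z differentiable at x" "Z' differentiable at (g x)"
      "\<And>y. y \<in> S \<Longrightarrow> Z' (g y) = frechet_derivative g (at y) (Z y)" for Z Z' u
  proof -
    have 1: "((\<lambda>y. frechet_derivative g (at y) (Z y)) has_derivative
      (\<lambda>u. frechet_derivative (\<lambda>y. frechet_derivative g (at y) (Z x)) (at x) u
        + frechet_derivative g (at x) (frechet_derivative Z (at x) u))) (at x)"
      using assms(2) by (intro has_derivative_apply[OF assms(1,2)] linear_frechet_derivative dg that(1)
          smooth_on_differentiable[OF smooth_on_deriv[OF g]])
    have "((\<lambda>y. Z' (g y)) has_derivative
      (\<lambda>u. frechet_derivative Z' (at (g x)) (frechet_derivative g (at x) u))) (at x)"
      by (rule has_derivative_compose[OF has_derivative_frechet[OF dg[OF assms(2)]]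
            has_derivative_frechet[OF that(2)]])
    then have "((\<lambda>y. frechet_derivative g (at y) (Z y)) has_derivative
      (\<lambda>u. frechet_derivative Z' (at (g x)) (frechet_derivative g (at x) u))) (at x)"
      by (simp only: has_derivative_cong_open[OF assms(1,2) that(3)])
    from fun_cong[OF has_derivative_unique[OF this 1]] show ?thesis .
  qed
  show ?thesis
    using *[OF X X' relX, of "Y x"] *[OF Y Y' relY, of "X x"] relX[OF assms(2)] relY[OF assms(2)]
      second_derivative_symmetric[OF assms(1,2) g, of "X x" "Y x"]
      linear_diff[OF linear_frechet_derivative[OF dg[OF assms(2)]]]
    by simp
qed

text \<open>The Nijenhuis tensor written with derivatives of the matrix \<open>K\<close> alone. It
  takes vectors rather than fields, so it can be evaluated without extending anything.\<close>

definition flat_nijenhuis :: "('a::euclidean_space \<Rightarrow> 'a \<Rightarrow> 'a) \<Rightarrow> 'a \<Rightarrow> 'a \<Rightarrow> 'a \<Rightarrow> 'a" where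
  "flat_nijenhuis K x u v =
     frechet_derivative (\<lambda>y. K y v) (at x) (K x u) - frechet_derivative (\<lambda>y. K y u) (at x) (K x v)
     - K x (frechet_derivative (\<lambda>y. K y v) (at x) u) + K x (frechet_derivative (\<lambda>y. K y u) (at x) v)"

text \<open>Tensoriality: by the Leibniz rule every derivative of \<open>X\<close> or
  \<open>Y\<close> appears once inside and once outside a factor \<open>K\<close>, and these pairs
  cancel by \<open>K (K v) = - v\<close>.\<close>

lemma flat_nijenhuis_bracket:
  fixes K :: "'a::euclidean_space \<Rightarrow> 'a \<Rightarrow> 'a"
  defines "br X Y x \<equiv> frechet_derivative Y (at x) (X x) - frechet_derivative X (at x) (Y x)"
  assumes "open S" "x \<in> S" and lin: "\<And>y. y \<in> S \<Longrightarrow> linear (K y)"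
    and dK: "\<And>v. (\<lambda>y. K y v) differentiable at x"
    and sq: "\<And>v. K x (K x v) = - v"
    and X: "X differentiable at x" and Y: "Y differentiable at x"
  shows "br (\<lambda>y. K y (X y)) (\<lambda>y. K y (Y y)) x - K x (br (\<lambda>y. K y (X y)) Y x)
      - K x (br X (\<lambda>y. K y (Y y)) x) - br X Y x = flat_nijenhuis K x (X x) (Y x)"
proof -
  have *: "frechet_derivative (\<lambda>y. K y (Z y)) (at x) u
     = frechet_derivative (\<lambda>y. K y (Z x)) (at x) u + K x (frechet_derivative Z (at x) u)"
    if "Z differentiable at x" for Z u
    using frechet_derivative_eq[OF has_derivative_apply[OF assms(2,3) lin dK that]] by simp
  show ?thesis
    unfolding br_def flat_nijenhuis_def *[OF X] *[OF Y]
    by (simp add: linear_add[OF lin[OF assms(3)]] linear_diff[OF lin[OF assms(3)]] sq)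
qed

text \<open>Pulls the Nijenhuis tensor back along \<open>g\<close> when \<open>dg\<close>
  intertwines \<open>K\<close> with \<open>J 1\<close> only up to the error
  \<open>\<Sum>a. s a J a\<close>, which vanishes at \<open>x\<close>. The error contributes to
  first order only; \<open>E\<close> is its derivative. No field on the source is extended to the
  target.\<close>

lemma flat_nijenhuis_immersion:
  fixes g :: "'a::euclidean_space \<Rightarrow> 'b::euclidean_space"
    and J :: "nat \<Rightarrow> 'b \<Rightarrow> 'b \<Rightarrow> 'b" and A :: "nat set"
  defines "E \<equiv> \<lambda>s x u w. \<Sum>a\<in>A. frechet_derivative (s a) (at x) u *\<^sub>R J a (g x) w"
  assumes "open S" "x \<in> S" "open T" "g ` S \<subseteq> T" and g: "smooth_on S g"
    and linK: "\<And>y. y \<in> S \<Longrightarrow> linear (K y)"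
    and dK: "\<And>v. (\<lambda>y. K y v) differentiable at x"
    and A: "finite A" "1 \<in> A"
    and linJ: "\<And>a z. a \<in> A \<Longrightarrow> z \<in> T \<Longrightarrow> linear (J a z)"
    and dJ: "\<And>a v. a \<in> A \<Longrightarrow> (\<lambda>z. J a z v) differentiable at (g x)"
    and ds: "\<And>a. a \<in> A \<Longrightarrow> s a differentiable at x"
    and s0: "\<And>a. a \<in> A \<Longrightarrow> s a x = (0::real)"
    and rel: "\<And>y v. y \<in> S \<Longrightarrow> frechet_derivative g (at y) (K y v) =
       J 1 (g y) (frechet_derivative g (at y) v)
         + (\<Sum>a\<in>A. s a y *\<^sub>R J a (g y) (frechet_derivative g (at y) v))"
    and sq: "\<And>w. J 1 (g x) (J 1 (g x) w) = - w"
  shows "frechet_derivative g (at x) (flat_nijenhuis K x u v) =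
      flat_nijenhuis (J 1) (g x) (frechet_derivative g (at x) u) (frechet_derivative g (at x) v)
      + E s x (K x u) (frechet_derivative g (at x) v) - E s x (K x v) (frechet_derivative g (at x) u)
      - J 1 (g x) (E s x u (frechet_derivative g (at x) v))
      + J 1 (g x) (E s x v (frechet_derivative g (at x) u))"
proof -
  let ?dg = "\<lambda>y. frechet_derivative g (at y)"
  define H where "H u v = frechet_derivative (\<lambda>y. ?dg y v) (at x) u" for u v
  have lin_dg: "linear (?dg y)" if "y \<in> S" for y
    using smooth_on_differentiable[OF g that] by (rule linear_frechet_derivative)
  have ddg: "(\<lambda>y. ?dg y v) differentiable at x" for v
    by (rule smooth_on_differentiable[OF smooth_on_deriv[OF g] assms(3)])
  have H_sym: "H u v = H v u" for u v
    unfolding H_def by (rule second_derivative_symmetric[OF assms(2,3) g])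
  have dJg: "((\<lambda>y. J a (g y) w) has_derivative
      (\<lambda>u. frechet_derivative (\<lambda>z. J a z w) (at (g x)) (?dg x u))) (at x)" if "a \<in> A" for a w
    by (rule has_derivative_compose[OF has_derivative_frechet[OF smooth_on_differentiable[OF g assms(3)]]
          has_derivative_frechet[OF dJ[OF that]]])
  then have dJg': "(\<lambda>y. J a (g y) w) differentiable at x" if "a \<in> A" for a w
    using that unfolding differentiable_def by blast
  have dJdg: "((\<lambda>y. J a (g y) (?dg y v)) has_derivative
      (\<lambda>u. frechet_derivative (\<lambda>z. J a z (?dg x v)) (at (g x)) (?dg x u) + J a (g x) (H u v))) (at x)"
    if a: "a \<in> A" for a v
  proof -
    have "((\<lambda>y. J a (g y) (?dg y v)) has_derivative
      (\<lambda>u. frechet_derivative (\<lambda>y. J a (g y) (?dg x v)) (at x) u + J a (g x) (H u v))) (at x)"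
      unfolding H_def
      by (rule has_derivative_apply[OF assms(2,3)])
        (use linJ[OF a] assms(5) dJg'[OF a] ddg in auto)
    then show ?thesis
      by (simp add: frechet_derivative_eq[OF dJg[OF a]])
  qed
  \<comment> \<open>The derivative of \<open>rel\<close> at \<open>x\<close> along \<open>u\<close>.
    Since \<open>s a x = 0\<close>, the sum contributes only where \<open>s a\<close> itself is
    differentiated, and the derivatives of the other \<open>J a\<close> drop out.\<close>
  have key: "?dg x (frechet_derivative (\<lambda>y. K y v) (at x) u) =
      frechet_derivative (\<lambda>z. J 1 z (?dg x v)) (at (g x)) (?dg x u) + J 1 (g x) (H u v)
      + E s x u (?dg x v) - H u (K x v)" for u v
  proof -
    have 1: "((\<lambda>y. ?dg y (K y v)) has_derivative
       (\<lambda>u. H u (K x v) + ?dg x (frechet_derivative (\<lambda>y. K y v) (at x) u))) (at x)"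
      unfolding H_def by (rule has_derivative_apply[OF assms(2,3) lin_dg ddg dK])
    have "((\<lambda>y. \<Sum>a\<in>A. s a y *\<^sub>R J a (g y) (?dg y v)) has_derivative
       (\<lambda>u. \<Sum>a\<in>A. s a x *\<^sub>R (frechet_derivative (\<lambda>z. J a z (?dg x v)) (at (g x)) (?dg x u)
            + J a (g x) (H u v)) + frechet_derivative (s a) (at x) u *\<^sub>R J a (g x) (?dg x v))) (at x)"
      by (intro has_derivative_sum has_derivative_scaleR dJdg has_derivative_frechet ds)
    then have "((\<lambda>y. \<Sum>a\<in>A. s a y *\<^sub>R J a (g y) (?dg y v)) has_derivative (\<lambda>u. E s x u (?dg x v))) (at x)"
      by (simp add: s0 E_def)
    from has_derivative_add[OF dJdg[OF A(2)] this]
    have "((\<lambda>y. ?dg y (K y v)) has_derivative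
       (\<lambda>u. frechet_derivative (\<lambda>z. J 1 z (?dg x v)) (at (g x)) (?dg x u) + J 1 (g x) (H u v)
         + E s x u (?dg x v))) (at x)"
      by (simp only: has_derivative_cong_open[OF assms(2,3) rel])
    from fun_cong[OF has_derivative_unique[OF 1 this], of u] show ?thesis
      by (simp add: algebra_simps)
  qed
  have lJ: "linear (J 1 (g x))"
    using linJ A(2) assms(3,5) by blast
  have K1: "?dg x (K x v) = J 1 (g x) (?dg x v)" for v
    using rel[OF assms(3), of v] s0 by simp
  show ?thesis
    unfolding flat_nijenhuis_def linear_add[OF lin_dg[OF assms(3)]] linear_diff[OF lin_dg[OF assms(3)]] K1 key
    \<comment> \<open>Second derivatives of \<open>g\<close> occur for exactly these four pairs of
      vectors, each pair in both orders with opposite signs.\<close>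
    using H_sym[of u v] H_sym[of u "K x v"] H_sym[of v "K x u"] H_sym[of "K x v" "K x u"]
    by (simp add: linear_add[OF lJ] linear_diff[OF lJ] sq K1 del: One_nat_def)
qed

section \<open>Charts and coordinates\<close>

abbreviation chart_inv :: "('m, 'e) chart \<Rightarrow> 'e \<Rightarrow> 'm" where
  "chart_inv c \<equiv> inv_into (fst c) (snd c)"

abbreviation coords :: "('m, 'e::euclidean_space) atlas \<Rightarrow> ('m, 'e) chart \<Rightarrow> 'm \<Rightarrow> 'e \<Rightarrow> 'e" where
  "coords \<A> c q \<equiv> mderiv \<A> (snd c) q"

definition vf_rep ::
  "('m, 'e::euclidean_space) atlas \<Rightarrow> ('m, 'e) chart \<Rightarrow> ('m \<Rightarrow> 'e) \<Rightarrow> 'e \<Rightarrow> 'e" where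
  "vf_rep \<A> c X y = coords \<A> c (chart_inv c y) (X (chart_inv c y))"

definition endo_rep ::
  "('m, 'e::euclidean_space) atlas \<Rightarrow> ('m, 'e) chart \<Rightarrow> ('m \<Rightarrow> 'e \<Rightarrow> 'e) \<Rightarrow> 'e \<Rightarrow> 'e \<Rightarrow> 'e" where
  "endo_rep \<A> c J y v =
     coords \<A> c (chart_inv c y) (J (chart_inv c y) (inv (coords \<A> c (chart_inv c y)) v))"

lemma mderiv_chart_at:
  "mderiv \<A> f p v =
     frechet_derivative (f \<circ> chart_inv (chart_at \<A> p)) (at (snd (chart_at \<A> p) p)) v"
  by (simp add: mderiv_def split: prod.split)

context
  fixes \<A> :: "('m::topological_space, 'e::euclidean_space) atlas"
  assumes A: "smooth_atlas \<A>"
begin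

lemma chart_at_in: "chart_at \<A> p \<in> \<A>" "p \<in> fst (chart_at \<A> p)"
proof -
  have "\<exists>c. c \<in> \<A> \<and> p \<in> fst c"
    using A UNIV_I[of p] unfolding smooth_atlas_def by blast
  then have "chart_at \<A> p \<in> \<A> \<and> p \<in> fst (chart_at \<A> p)"
    unfolding chart_at_def by (rule someI_ex)
  then show "chart_at \<A> p \<in> \<A>" "p \<in> fst (chart_at \<A> p)" by auto
qed

lemma chart_open: "c \<in> \<A> \<Longrightarrow> open (fst c)"
  using A by (auto simp: smooth_atlas_def)

lemma chart_homeo:
  "c \<in> \<A> \<Longrightarrow> homeomorphism (fst c) (snd c ` fst c) (snd c) (chart_inv c)"
  using A by (fastforce simp: smooth_atlas_def)

lemma chart_inv_chart: "c \<in> \<A> \<Longrightarrow> q \<in> fst c \<Longrightarrow> chart_inv c (snd c q) = q"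
  using chart_homeo by (auto simp: homeomorphism_def)

lemma chart_image_open:
  assumes "c \<in> \<A>" "open W"
  shows "open (snd c ` (fst c \<inter> W))"
proof -
  have "openin (top_of_set (snd c ` fst c)) (snd c ` (fst c \<inter> W))"
    using homeomorphism_imp_open_map[OF chart_homeo[OF assms(1)], of "fst c \<inter> W"] assms(2)
    by (simp add: openin_open_Int)
  moreover have "open (snd c ` fst c)"
    using A assms(1) by (fastforce simp: smooth_atlas_def)
  ultimately show ?thesis
    by (rule openin_open_trans)
qed

lemma transition_smooth:
  "c \<in> \<A> \<Longrightarrow> d \<in> \<A> \<Longrightarrow> smooth_on (snd c ` (fst c \<inter> fst d)) (snd d \<circ> chart_inv c)"
  using A by (fastforce simp: smooth_atlas_def)

lemma transition_inv:
  assumes "c \<in> \<A>" "y \<in> snd c ` (fst c \<inter> fst d)" "d \<in> \<A>"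
  shows "chart_inv d ((snd d \<circ> chart_inv c) y) = chart_inv c y"
  using assms by (auto simp: chart_inv_chart)

text \<open>\<open>mderiv\<close> is tied to the chart selected at \<open>q\<close>. The chain rule
  through the transition map allows any chart \<open>c\<close> around \<open>q\<close> instead, once
  the vector is converted by \<open>coords\<close>.\<close>

lemma mderiv_chain:
  assumes c: "c \<in> \<A>" "q \<in> fst c" and f: "(f \<circ> chart_inv c) differentiable at (snd c q)"
  shows "mderiv \<A> f q v = frechet_derivative (f \<circ> chart_inv c) (at (snd c q)) (coords \<A> c q v)"
proof -
  let ?d = "chart_at \<A> q"
  let ?S = "snd ?d ` (fst ?d \<inter> fst c)"
  have q: "snd ?d q \<in> ?S" using chart_at_in c by auto
  have S: "open ?S" using chart_image_open chart_at_in chart_open c by blast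
  have 1: "(snd c \<circ> chart_inv ?d) differentiable at (snd ?d q)"
    by (rule smooth_on_differentiable[OF transition_smooth q]) (use chart_at_in c in auto)
  have 2: "(snd c \<circ> chart_inv ?d) (snd ?d q) = snd c q"
    by (simp add: chart_inv_chart chart_at_in)
  have "((\<lambda>y. (f \<circ> chart_inv c) ((snd c \<circ> chart_inv ?d) y)) has_derivative
     (\<lambda>v. frechet_derivative (f \<circ> chart_inv c) (at (snd c q))
        (frechet_derivative (snd c \<circ> chart_inv ?d) (at (snd ?d q)) v))) (at (snd ?d q))"
    by (rule has_derivative_compose[OF has_derivative_frechet[OF 1]])
      (simp only: 2 has_derivative_frechet[OF f])
  moreover have "frechet_derivative (f \<circ> chart_inv ?d) (at (snd ?d q)) =
      frechet_derivative (\<lambda>y. (f \<circ> chart_inv c) ((snd c \<circ> chart_inv ?d) y)) (at (snd ?d q))"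
    by (rule frechet_derivative_cong_open[OF S q])
      (use transition_inv[OF chart_at_in(1) _ c(1)] in simp)
  ultimately show ?thesis
    unfolding mderiv_chart_at by (simp only: frechet_derivative_eq)
qed

lemma mderiv_cong:
  assumes "open W" "q \<in> W" "\<And>p. p \<in> W \<Longrightarrow> f p = g p"
  shows "mderiv \<A> f q = mderiv \<A> g q"
proof -
  let ?d = "chart_at \<A> q"
  have "frechet_derivative (f \<circ> chart_inv ?d) (at (snd ?d q)) =
      frechet_derivative (g \<circ> chart_inv ?d) (at (snd ?d q))"
    by (rule frechet_derivative_cong_open[of "snd ?d ` (fst ?d \<inter> W)"])
      (use chart_image_open chart_at_in assms in \<open>auto simp: chart_inv_chart\<close>)
  then show ?thesis
    by (simp add: mderiv_chart_at fun_eq_iff)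
qed

lemma transition_differentiable:
  "c \<in> \<A> \<Longrightarrow> d \<in> \<A> \<Longrightarrow> q \<in> fst c \<Longrightarrow> q \<in> fst d \<Longrightarrow>
   (snd d \<circ> chart_inv c) differentiable at (snd c q)"
  using smooth_on_differentiable[OF transition_smooth] by blast

lemma coords_transition:
  assumes "c \<in> \<A>" "d \<in> \<A>" "q \<in> fst c" "q \<in> fst d"
  shows "coords \<A> d q v = frechet_derivative (snd d \<circ> chart_inv c) (at (snd c q)) (coords \<A> c q v)"
  by (rule mderiv_chain) (use assms transition_differentiable in auto)

lemma frechet_chart_id:
  assumes "c \<in> \<A>" "q \<in> fst c"
  shows "frechet_derivative (snd c \<circ> chart_inv c) (at (snd c q)) = (\<lambda>v. v)"
proof -
  have "frechet_derivative (snd c \<circ> chart_inv c) (at (snd c q)) =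
    frechet_derivative (\<lambda>y. y) (at (snd c q))"
    by (rule frechet_derivative_cong_open[of "snd c ` (fst c \<inter> UNIV)"])
      (use chart_image_open[OF assms(1), of UNIV] assms in \<open>auto simp: chart_inv_chart\<close>)
  then show ?thesis by simp
qed

lemma coords_chart_at: "coords \<A> (chart_at \<A> p) p = (\<lambda>v. v)"
  using frechet_chart_id[OF chart_at_in] by (simp add: mderiv_chart_at fun_eq_iff)

lemma coords_linear:
  assumes "c \<in> \<A>" "q \<in> fst c"
  shows "linear (coords \<A> c q)"
proof -
  have "coords \<A> c q = frechet_derivative (snd c \<circ> chart_inv (chart_at \<A> q)) (at (snd (chart_at \<A> q) q))"
    by (simp add: mderiv_chart_at fun_eq_iff)
  then show ?thesis
    using linear_frechet_derivative transition_differentiable chart_at_in assms by metis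
qed

text \<open>The differential of the reverse transition map is a left inverse of
  \<open>coords \<A> c q\<close>; an injective endomorphism of a finite-dimensional space is
  bijective.\<close>

lemma coords_inv:
  assumes "c \<in> \<A>" "q \<in> fst c"
  shows "inv (coords \<A> c q) (coords \<A> c q v) = v" "coords \<A> c q (inv (coords \<A> c q) v) = v"
    and "linear (inv (coords \<A> c q))"
proof -
  let ?L = "frechet_derivative (snd (chart_at \<A> q) \<circ> chart_inv c) (at (snd c q))"
  have "?L (coords \<A> c q v) = v" for v
    using coords_transition[of c "chart_at \<A> q" q] assms chart_at_in by (simp add: coords_chart_at)
  then have "inj (coords \<A> c q)"
    by (metis injI)
  moreover from this have "surj (coords \<A> c q)"
    using coords_linear[OF assms] by (simp add: linear_injective_imp_surjective)
  ultimately show "inv (coords \<A> c q) (coords \<A> c q v) = v"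
    "coords \<A> c q (inv (coords \<A> c q) v) = v" "linear (inv (coords \<A> c q))"
    using coords_linear[OF assms] by (auto simp: surj_f_inv_f bij_def inj_linear_imp_inv_linear)
qed

lemma vf_rep_chart: "c \<in> \<A> \<Longrightarrow> q \<in> fst c \<Longrightarrow> vf_rep \<A> c X (snd c q) = coords \<A> c q (X q)"
  by (simp add: vf_rep_def chart_inv_chart)

lemma vf_rep_chart_at: "vf_rep \<A> (chart_at \<A> p) X (snd (chart_at \<A> p) p) = X p"
  by (simp add: vf_rep_chart chart_at_in coords_chart_at)

text \<open>Smoothness is demanded in all charts, but one chart around each point is enough:
  transition maps carry it to every other chart, and \<open>smooth_on_local\<close> glues the
  pieces. \<open>smooth_vfI\<close> is the analogue for fields, with the differential of the
  transition map acting on components.\<close>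

lemma smooth_funI:
  assumes "open W" "\<And>q. q \<in> W \<Longrightarrow> \<exists>c\<in>\<A>. q \<in> fst c \<and>
     (\<exists>V. open V \<and> q \<in> V \<and> smooth_on (snd c ` (fst c \<inter> V)) (f \<circ> chart_inv c))"
  shows "smooth_fun \<A> W f"
  unfolding smooth_fun_def
proof clarify
  fix E \<eta> assume "(E, \<eta>) \<in> \<A>"
  then obtain e where e: "e \<in> \<A>" "e = (E, \<eta>)" by auto
  have "smooth_on (snd e ` (fst e \<inter> W)) (f \<circ> chart_inv e)"
  proof (rule smooth_on_local)
    fix x assume "x \<in> snd e ` (fst e \<inter> W)"
    then obtain q where q: "q \<in> fst e" "q \<in> W" "x = snd e q" by auto
    obtain c V where c: "c \<in> \<A>" "q \<in> fst c" "open V" "q \<in> V"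
      "smooth_on (snd c ` (fst c \<inter> V)) (f \<circ> chart_inv c)" using assms(2) q by metis
    let ?T = "snd e ` (fst e \<inter> (fst c \<inter> V))"
    have T: "open ?T" "x \<in> ?T"
      using chart_image_open[OF e(1)] chart_open[OF c(1)] c q by auto
    have "smooth_on ?T (\<lambda>y. (f \<circ> chart_inv c) ((snd c \<circ> chart_inv e) y))"
      by (rule smooth_on_compose[OF T(1) chart_image_open[OF c(1,3)] c(5)])
        (use smooth_on_subset[OF transition_smooth[OF e(1) c(1)], of ?T] chart_inv_chart[OF e(1)]
          in \<open>auto simp: comp_def\<close>)
    then have "smooth_on ?T (f \<circ> chart_inv e)"
      by (rule smooth_on_transform[OF T(1)]) (use e(1) c(1) in \<open>auto simp: chart_inv_chart\<close>)
    then show "\<exists>T. open T \<and> x \<in> T \<and> smooth_on T (f \<circ> chart_inv e)"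
      using T by blast
  qed
  then show "smooth_on (\<eta> ` (E \<inter> W)) (f \<circ> inv_into E \<eta>)"
    by (simp add: e)
qed

lemma smooth_funD:
  "smooth_fun \<A> W f \<Longrightarrow> c \<in> \<A> \<Longrightarrow> smooth_on (snd c ` (fst c \<inter> W)) (f \<circ> chart_inv c)"
  by (fastforce simp: smooth_fun_def)

lemma smooth_vf_rep:
  assumes "smooth_vf \<A> W X" "c \<in> \<A>"
  shows "smooth_on (snd c ` (fst c \<inter> W)) (vf_rep \<A> c X)"
proof -
  have "snd c ` (fst c \<inter> (W \<inter> fst c)) = snd c ` (fst c \<inter> W)" by auto
  then show ?thesis
    using assms smooth_funD[of "W \<inter> fst c" "\<lambda>p. coords \<A> c p (X p)" c]
    by (simp add: smooth_vf_def comp_def vf_rep_def[abs_def])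
qed

lemma smooth_vfI:
  assumes "open W" "\<And>q. q \<in> W \<Longrightarrow> \<exists>c\<in>\<A>. q \<in> fst c \<and>
     (\<exists>V. open V \<and> q \<in> V \<and> smooth_on (snd c ` (fst c \<inter> V)) (vf_rep \<A> c X))"
  shows "smooth_vf \<A> W X"
  unfolding smooth_vf_def
proof
  fix d assume d: "d \<in> \<A>"
  show "smooth_fun \<A> (W \<inter> fst d) (\<lambda>p. coords \<A> d p (X p))"
  proof (rule smooth_funI)
    show "open (W \<inter> fst d)" using assms(1) chart_open[OF d] by blast
    fix q assume q: "q \<in> W \<inter> fst d"
    then obtain c V where c: "c \<in> \<A>" "q \<in> fst c" "open V" "q \<in> V"
      "smooth_on (snd c ` (fst c \<inter> V)) (vf_rep \<A> c X)" using assms(2) by (metis IntD1)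
    let ?V = "V \<inter> fst d"
    have S: "open (snd c ` (fst c \<inter> ?V))"
      using chart_image_open[OF c(1)] c chart_open[OF d] by blast
    have "smooth_on (snd c ` (fst c \<inter> ?V))
      (\<lambda>y. frechet_derivative (snd d \<circ> chart_inv c) (at y) (vf_rep \<A> c X y))"
      by (rule smooth_on_deriv_apply[OF S])
        (rule smooth_on_subset[OF transition_smooth[OF c(1) d]] smooth_on_subset[OF c(5)], blast)+
    then have "smooth_on (snd c ` (fst c \<inter> ?V)) ((\<lambda>p. coords \<A> d p (X p)) \<circ> chart_inv c)"
      by (rule smooth_on_transform[OF S])
        (use coords_transition[OF c(1) d] c(1) in \<open>auto simp: vf_rep_chart chart_inv_chart\<close>)
    then show "\<exists>c\<in>\<A>. q \<in> fst c \<and> (\<exists>V. open V \<and> q \<in> V \<and>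
       smooth_on (snd c ` (fst c \<inter> V)) ((\<lambda>p. coords \<A> d p (X p)) \<circ> chart_inv c))"
      using c chart_open[OF d] q by (intro bexI[of _ c] conjI exI[of _ ?V]) auto
  qed
qed

lemma smooth_vfI_charts:
  assumes "open W" "\<And>c. c \<in> \<A> \<Longrightarrow> smooth_on (snd c ` (fst c \<inter> W)) (vf_rep \<A> c X)"
  shows "smooth_vf \<A> W X"
  by (rule smooth_vfI[OF assms(1)])
    (use chart_at_in assms in blast)

lemma smooth_vf_subset: "smooth_vf \<A> W X \<Longrightarrow> V \<subseteq> W \<Longrightarrow> open V \<Longrightarrow> smooth_vf \<A> V X"
  by (rule smooth_vfI_charts) (auto intro: smooth_on_subset smooth_vf_rep)

lemma smooth_vf_cong:
  assumes "smooth_vf \<A> W X" "open W" "\<And>q. q \<in> W \<Longrightarrow> X q = Y q"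
  shows "smooth_vf \<A> W Y"
proof (rule smooth_vfI_charts[OF assms(2)])
  fix c assume c: "c \<in> \<A>"
  show "smooth_on (snd c ` (fst c \<inter> W)) (vf_rep \<A> c Y)"
    by (rule smooth_on_transform[OF chart_image_open[OF c assms(2)] smooth_vf_rep[OF assms(1) c]])
      (use c assms(3) in \<open>auto simp: vf_rep_chart\<close>)
qed

lemma vf_rep_combine:
  assumes "c \<in> \<A>" "y \<in> snd c ` fst c"
  shows "vf_rep \<A> c (\<lambda>q. X q + Y q) y = vf_rep \<A> c X y + vf_rep \<A> c Y y"
    and "vf_rep \<A> c (\<lambda>q. f q *\<^sub>R X q) y = f (chart_inv c y) *\<^sub>R vf_rep \<A> c X y"
  using assms coords_linear[OF assms(1)]
  by (auto simp: vf_rep_chart chart_inv_chart linear_add linear_scale)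

lemma smooth_vf_add:
  assumes "open W" "smooth_vf \<A> W X" "smooth_vf \<A> W Y"
  shows "smooth_vf \<A> W (\<lambda>q. X q + Y q)"
proof (rule smooth_vfI_charts[OF assms(1)])
  fix c assume c: "c \<in> \<A>"
  note S = chart_image_open[OF c assms(1)]
  have "smooth_on (snd c ` (fst c \<inter> W)) (\<lambda>y. vf_rep \<A> c X y + vf_rep \<A> c Y y)"
    by (intro smooth_on_add S smooth_vf_rep assms c)
  then show "smooth_on (snd c ` (fst c \<inter> W)) (vf_rep \<A> c (\<lambda>q. X q + Y q))"
    by (subst smooth_on_cong[OF S vf_rep_combine(1)[OF c]]) auto
qed

lemma smooth_vf_scale:
  assumes "open W" "smooth_fun \<A> W f" "smooth_vf \<A> W X"
  shows "smooth_vf \<A> W (\<lambda>q. f q *\<^sub>R X q)"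
proof (rule smooth_vfI_charts[OF assms(1)])
  fix c assume c: "c \<in> \<A>"
  note S = chart_image_open[OF c assms(1)]
  have "smooth_on (snd c ` (fst c \<inter> W)) (\<lambda>y. (f \<circ> chart_inv c) y *\<^sub>R vf_rep \<A> c X y)"
    by (intro smooth_on_scaleR S smooth_vf_rep smooth_funD assms c)
  then show "smooth_on (snd c ` (fst c \<inter> W)) (vf_rep \<A> c (\<lambda>q. f q *\<^sub>R X q))"
    by (subst smooth_on_cong[OF S vf_rep_combine(2)[OF c]]) (auto simp: comp_def)
qed

lemma smooth_fun_const: "smooth_fun \<A> W (\<lambda>q. c)"
  by (auto simp: smooth_fun_def comp_def smooth_on_const)

lemma smooth_vf_diff:
  assumes "open W" "smooth_vf \<A> W X" "smooth_vf \<A> W Y"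
  shows "smooth_vf \<A> W (\<lambda>q. X q - Y q)"
  using smooth_vf_add[OF assms(1,2) smooth_vf_scale[OF assms(1) smooth_fun_const assms(3)], of "-1"]
  by simp

text \<open>The supply of smooth fields with prescribed values. Endomorphism fields and 1-forms are
  known only through their action on smooth fields, so these fields extract their components in a
  chart.\<close>

lemma smooth_vf_const_coords:
  assumes "c \<in> \<A>"
  shows "smooth_vf \<A> (fst c) (\<lambda>q. inv (coords \<A> c q) v)"
proof (rule smooth_vfI)
  show "open (fst c)" using chart_open assms .
  fix q assume q: "q \<in> fst c"
  have "smooth_on (snd c ` (fst c \<inter> fst c)) (vf_rep \<A> c (\<lambda>q. inv (coords \<A> c q) v))"
    by (subst smooth_on_cong[where g = "\<lambda>_. v", OF chart_image_open[OF assms chart_open[OF assms]]])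
      (auto simp: vf_rep_chart[OF assms] coords_inv(2)[OF assms] smooth_on_const)
  then show "\<exists>c'\<in>\<A>. q \<in> fst c' \<and> (\<exists>V. open V \<and> q \<in> V \<and>
     smooth_on (snd c' ` (fst c' \<inter> V)) (vf_rep \<A> c' (\<lambda>q. inv (coords \<A> c q) v)))"
    using assms q chart_open[OF assms] by blast
qed

end

section \<open>Lie brackets and Nijenhuis tensors in coordinates\<close>

context
  fixes \<A> :: "('m::topological_space, 'e::euclidean_space) atlas"
  assumes A: "smooth_atlas \<A>"
begin

lemma coord_vf_smooth: "smooth_vf \<A> (fst (chart_at \<A> p)) (coord_vf \<A> p v)"
  using smooth_vf_const_coords[OF A chart_at_in(1)[OF A]] by (simp add: coord_vf_def[abs_def])

lemma coord_vf_smooth_at: "smooth_vf_at \<A> p (coord_vf \<A> p v)"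
  unfolding smooth_vf_at_def
  by (intro exI[of _ "fst (chart_at \<A> p)"] conjI coord_vf_smooth chart_at_in[OF A] chart_open[OF A])

lemma coord_vf_self: "coord_vf \<A> p v p = v"
  by (simp add: coord_vf_def coords_chart_at[OF A] inv_id[unfolded id_def])

lemma smooth_vf_atI: "smooth_vf \<A> W X \<Longrightarrow> open W \<Longrightarrow> p \<in> W \<Longrightarrow> smooth_vf_at \<A> p X"
  unfolding smooth_vf_at_def by blast

lemma smooth_vf_at_within:
  assumes "smooth_vf_at \<A> p X" "open U" "p \<in> U"
  obtains W where "open W" "p \<in> W" "W \<subseteq> U" "smooth_vf \<A> W X"
proof -
  obtain W where "open W" "p \<in> W" "smooth_vf \<A> W X"
    using assms(1) unfolding smooth_vf_at_def by blast
  then show thesis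
    using that[of "W \<inter> U"] smooth_vf_subset[OF A, of W X "W \<inter> U"] assms by auto
qed

lemma smooth_vf_at_within2:
  assumes "smooth_vf_at \<A> p X" "smooth_vf_at \<A> p Y" "open U" "p \<in> U"
  obtains W where "open W" "p \<in> W" "W \<subseteq> U" "smooth_vf \<A> W X" "smooth_vf \<A> W Y"
proof -
  obtain W where W: "open W" "p \<in> W" "W \<subseteq> U" "smooth_vf \<A> W X"
    using smooth_vf_at_within[OF assms(1,3,4)] .
  obtain V where "open V" "p \<in> V" "V \<subseteq> W" "smooth_vf \<A> V Y"
    using smooth_vf_at_within[OF assms(2) W(1,2)] .
  then show thesis
    using that[of V] smooth_vf_subset[OF A W(4), of V] W(3) by blast
qed

section \<open>Endomorphism fields and their matrices in a chart\<close>

lemma smooth_endo_linear: "smooth_endo \<A> U J \<Longrightarrow> p \<in> U \<Longrightarrow> linear (J p)"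
  by (simp add: smooth_endo_def)

lemma smooth_endo_vf:
  "smooth_endo \<A> U J \<Longrightarrow> open W \<Longrightarrow> W \<subseteq> U \<Longrightarrow> smooth_vf \<A> W X \<Longrightarrow>
   smooth_vf \<A> W (\<lambda>p. J p (X p))"
  by (simp add: smooth_endo_def)

lemma smooth_endo_vf_at:
  assumes "smooth_endo \<A> U J" "open U" "p \<in> U" "smooth_vf_at \<A> p X"
  shows "smooth_vf_at \<A> p (\<lambda>p. J p (X p))"
proof -
  obtain W where "open W" "p \<in> W" "W \<subseteq> U" "smooth_vf \<A> W X"
    using smooth_vf_at_within[OF assms(4,2,3)] .
  then show ?thesis
    using smooth_vf_atI[OF smooth_endo_vf[OF assms(1)]] by blast
qed

lemma endo_rep_chart:
  "c \<in> \<A> \<Longrightarrow> q \<in> fst c \<Longrightarrow>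
   endo_rep \<A> c J (snd c q) v = coords \<A> c q (J q (inv (coords \<A> c q) v))"
  by (simp add: endo_rep_def chart_inv_chart[OF A])

lemma endo_rep_coords:
  "c \<in> \<A> \<Longrightarrow> q \<in> fst c \<Longrightarrow> endo_rep \<A> c J (snd c q) (coords \<A> c q v) = coords \<A> c q (J q v)"
  by (simp add: endo_rep_chart coords_inv[OF A])

lemma endo_rep_chart_at: "endo_rep \<A> (chart_at \<A> p) J (snd (chart_at \<A> p) p) v = J p v"
  by (simp add: endo_rep_chart chart_at_in[OF A] coords_chart_at[OF A] inv_id[unfolded id_def])

lemma endo_rep_linear:
  assumes "c \<in> \<A>" "y \<in> snd c ` (fst c \<inter> U)" "smooth_endo \<A> U J"
  shows "linear (endo_rep \<A> c J y)"
proof -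
  obtain q where q: "q \<in> fst c" "q \<in> U" "y = snd c q" using assms by blast
  have "linear (coords \<A> c q \<circ> (J q \<circ> inv (coords \<A> c q)))"
    by (intro linear_compose coords_inv(3)[OF A assms(1) q(1)] coords_linear[OF A assms(1) q(1)]
        smooth_endo_linear[OF assms(3) q(2)])
  moreover have "endo_rep \<A> c J y = coords \<A> c q \<circ> (J q \<circ> inv (coords \<A> c q))"
    by (simp add: fun_eq_iff q(3) endo_rep_chart[OF assms(1) q(1)])
  ultimately show ?thesis by simp
qed

lemma vf_rep_endo:
  assumes "c \<in> \<A>" "y \<in> snd c ` fst c"
  shows "vf_rep \<A> c (\<lambda>q. J q (X q)) y = endo_rep \<A> c J y (vf_rep \<A> c X y)"
  using assms by (auto simp: vf_rep_chart[OF A] endo_rep_coords)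

text \<open>Applying \<open>J\<close> to a field with constant components in \<open>c\<close> gives
  a smooth field whose components are a column combination of the matrix of
  \<open>J\<close>.\<close>

lemma endo_rep_smooth:
  assumes "smooth_endo \<A> U J" "open U" "c \<in> \<A>"
  shows "smooth_on (snd c ` (fst c \<inter> U)) (\<lambda>y. endo_rep \<A> c J y v)"
proof -
  let ?X = "\<lambda>q. inv (coords \<A> c q) v"
  have W: "open (fst c \<inter> U)" using assms chart_open[OF A] by blast
  have "smooth_vf \<A> (fst c \<inter> U) ?X"
    using smooth_vf_subset[OF A smooth_vf_const_coords[OF A assms(3)] _ W] by blast
  then have "smooth_vf \<A> (fst c \<inter> U) (\<lambda>q. J q (?X q))"
    using smooth_endo_vf[OF assms(1) W] by blast
  from smooth_vf_rep[OF A this assms(3)]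
  have "smooth_on (snd c ` (fst c \<inter> U)) (vf_rep \<A> c (\<lambda>q. J q (?X q)))"
    by (simp add: Int_absorb1)
  then show ?thesis
    by (rule smooth_on_transform[OF chart_image_open[OF A assms(3,2)]])
      (use assms(3) in \<open>auto simp: vf_rep_chart[OF A] endo_rep_chart\<close>)
qed

section \<open>The bracket and the Nijenhuis tensor in an arbitrary chart\<close>

lemma lie_bracket_chart_at:
  fixes p defines "c \<equiv> chart_at \<A> p"
  shows "lie_bracket \<A> X Y p = frechet_derivative (vf_rep \<A> c Y) (at (snd c p)) (X p)
     - frechet_derivative (vf_rep \<A> c X) (at (snd c p)) (Y p)"
  unfolding lie_bracket_def Let_def mderiv_chart_at[of _ _ p] c_def
  by (simp add: comp_def vf_rep_def[abs_def])

lemma vf_rep_differentiable: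
  assumes "smooth_vf \<A> W X" "c \<in> \<A>" "p \<in> fst c" "p \<in> W"
  shows "vf_rep \<A> c X differentiable at (snd c p)"
  using smooth_on_differentiable[OF smooth_vf_rep[OF A assms(1,2)]] assms by blast

text \<open>Chart independence of the bracket: the components of a field in two charts are related
  by the transition map, so \<open>bracket_related\<close> applies with that map as
  \<open>g\<close>.\<close>

lemma lie_bracket_coords:
  assumes "smooth_vf \<A> W X" "smooth_vf \<A> W Y" "open W" "p \<in> W" "c \<in> \<A>" "p \<in> fst c"
  shows "coords \<A> c p (lie_bracket \<A> X Y p) =
     frechet_derivative (vf_rep \<A> c Y) (at (snd c p)) (vf_rep \<A> c X (snd c p))
     - frechet_derivative (vf_rep \<A> c X) (at (snd c p)) (vf_rep \<A> c Y (snd c p))"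
proof -
  let ?d = "chart_at \<A> p"
  let ?g = "snd c \<circ> chart_inv ?d"
  let ?S = "snd ?d ` (fst ?d \<inter> (fst c \<inter> W))"
  note d = chart_at_in[OF A, of p]
  have S: "open ?S" "snd ?d p \<in> ?S"
    using chart_image_open[OF A d(1)] chart_open[OF A assms(5)] assms d by blast+
  have g: "?g (snd ?d p) = snd c p"
    by (simp add: chart_inv_chart[OF A d])
  have rel: "vf_rep \<A> c Z (?g y) = frechet_derivative ?g (at y) (vf_rep \<A> ?d Z y)" if y: "y \<in> ?S" for y Z
  proof -
    obtain q where "q \<in> fst ?d" "q \<in> fst c" "y = snd ?d q" using y by blast
    then show ?thesis
      using coords_transition[OF A d(1) assms(5)] d assms(5)
      by (simp add: vf_rep_chart[OF A] chart_inv_chart[OF A])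
  qed
  have "coords \<A> c p w = frechet_derivative ?g (at (snd ?d p)) w" for w
    using coords_transition[OF A d(1) assms(5) d(2) assms(6)] by (simp add: coords_chart_at[OF A])
  moreover have "frechet_derivative ?g (at (snd ?d p))
      (frechet_derivative (vf_rep \<A> ?d Y) (at (snd ?d p)) (vf_rep \<A> ?d X (snd ?d p))
       - frechet_derivative (vf_rep \<A> ?d X) (at (snd ?d p)) (vf_rep \<A> ?d Y (snd ?d p))) =
     frechet_derivative (vf_rep \<A> c Y) (at (?g (snd ?d p))) (vf_rep \<A> c X (?g (snd ?d p)))
     - frechet_derivative (vf_rep \<A> c X) (at (?g (snd ?d p))) (vf_rep \<A> c Y (?g (snd ?d p)))"
  proof (rule bracket_related[OF S])
    show "smooth_on ?S ?g"
      by (rule smooth_on_subset[OF transition_smooth[OF A d(1) assms(5)]]) blast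
    show "vf_rep \<A> c X differentiable at (?g (snd ?d p))" "vf_rep \<A> c Y differentiable at (?g (snd ?d p))"
      unfolding g by (rule vf_rep_differentiable[OF _ assms(5,6,4)], rule assms)+
    show "vf_rep \<A> ?d X differentiable at (snd ?d p)" "vf_rep \<A> ?d Y differentiable at (snd ?d p)"
      by (rule vf_rep_differentiable[OF _ d assms(4)], rule assms)+
    show "vf_rep \<A> c X (?g y) = frechet_derivative ?g (at y) (vf_rep \<A> ?d X y)" if "y \<in> ?S" for y
      by (rule rel[OF that])
    show "vf_rep \<A> c Y (?g y) = frechet_derivative ?g (at y) (vf_rep \<A> ?d Y y)" if "y \<in> ?S" for y
      by (rule rel[OF that])
  qed
  ultimately show ?thesis
    unfolding g by (simp add: lie_bracket_chart_at vf_rep_chart_at[OF A])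
qed

text \<open>The selected chart may jump with the point, so the definition of the bracket shows no
  smoothness; the formula in one fixed chart does.\<close>

lemma lie_bracket_smooth:
  assumes "open W" "smooth_vf \<A> W X" "smooth_vf \<A> W Y"
  shows "smooth_vf \<A> W (lie_bracket \<A> X Y)"
proof (rule smooth_vfI_charts[OF A assms(1)])
  fix c assume c: "c \<in> \<A>"
  let ?S = "snd c ` (fst c \<inter> W)"
  note S = chart_image_open[OF A c assms(1)]
  note X = smooth_vf_rep[OF A assms(2) c] and Y = smooth_vf_rep[OF A assms(3) c]
  have "smooth_on ?S (\<lambda>y. frechet_derivative (vf_rep \<A> c Y) (at y) (vf_rep \<A> c X y)
     - frechet_derivative (vf_rep \<A> c X) (at y) (vf_rep \<A> c Y y))"
    by (intro smooth_on_diff smooth_on_deriv_apply S X Y)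
  then show "smooth_on ?S (vf_rep \<A> c (lie_bracket \<A> X Y))"
    by (rule smooth_on_transform[OF S])
      (use c in \<open>auto simp: vf_rep_chart[OF A] lie_bracket_coords[OF assms(2,3,1)]\<close>)
qed

lemma nijenhuis_smooth:
  assumes "smooth_endo \<A> U J" "open W" "W \<subseteq> U" "smooth_vf \<A> W X" "smooth_vf \<A> W Y"
  shows "smooth_vf \<A> W (nijenhuis \<A> J X Y)"
  unfolding nijenhuis_def[abs_def] Let_def
  by (intro smooth_vf_diff[OF A] lie_bracket_smooth smooth_endo_vf[OF assms(1-3)] assms(2,4,5))

text \<open>The right-hand side sees only the values of \<open>X\<close> and \<open>Y\<close> at
  \<open>p\<close>. Hence on M the fields \<open>coord_vf\<close> can stand in for extensions of
  fields tangent to N.\<close>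

lemma nijenhuis_rep:
  fixes p defines "c \<equiv> chart_at \<A> p"
  assumes J: "smooth_endo \<A> U J" "open U" "p \<in> U" and sq: "\<And>v. J p (J p v) = - v"
    and "smooth_vf_at \<A> p X" "smooth_vf_at \<A> p Y"
  shows "nijenhuis \<A> J X Y p = flat_nijenhuis (endo_rep \<A> c J) (snd c p) (X p) (Y p)"
proof -
  obtain W where W: "open W" "p \<in> W" "W \<subseteq> U" "smooth_vf \<A> W X" "smooth_vf \<A> W Y"
    using smooth_vf_at_within2[OF assms(6,7) J(2,3)] .
  have c: "c \<in> \<A>" "p \<in> fst c" unfolding c_def using chart_at_in[OF A] by auto
  let ?S = "snd c ` (fst c \<inter> U)"
  have S: "open ?S" "snd c p \<in> ?S"
    using chart_image_open[OF A c(1) J(2)] c J(3) by auto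
  have JZ: "frechet_derivative (vf_rep \<A> c (\<lambda>q. J q (Z q))) (at (snd c p))
    = frechet_derivative (\<lambda>y. endo_rep \<A> c J y (vf_rep \<A> c Z y)) (at (snd c p))" for Z
    by (rule frechet_derivative_cong_open[OF S]) (use c in \<open>auto simp: vf_rep_endo\<close>)
  have rep: "vf_rep \<A> c Z (snd c p) = Z p" for Z
    unfolding c_def by (rule vf_rep_chart_at[OF A])
  have Jp: "endo_rep \<A> c J (snd c p) v = J p v" for v
    unfolding c_def by (rule endo_rep_chart_at)
  have "(\<lambda>y. endo_rep \<A> c J y v) differentiable at (snd c p)" for v
    using smooth_on_differentiable[OF endo_rep_smooth[OF J(1,2) c(1)] S(2)] .
  from flat_nijenhuis_bracket[OF S endo_rep_linear[OF c(1) _ J(1)] this _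
      vf_rep_differentiable[OF W(4) c W(2)] vf_rep_differentiable[OF W(5) c W(2)]]
  show ?thesis
    unfolding nijenhuis_def Let_def lie_bracket_chart_at c_def[symmetric] JZ rep Jp
    using sq by simp
qed

end

section \<open>Admissible bases and connections preserving the quaternionic structure\<close>

lemma mderiv_const: "mderiv \<A> (\<lambda>q. c) p v = 0"
  by (simp add: mderiv_chart_at comp_def)

text \<open>A connection only sees germs: the indicator function of a neighbourhood of \<open>p\<close> is smooth at
  \<open>p\<close>, so it can play the role of a bump function in the Leibniz rule.\<close>

lemma connection_germ:
  assumes A: "smooth_atlas \<A>" and D: "connection \<A> D"
    and "smooth_vf_at \<A> p Y" "smooth_vf_at \<A> p Z" "open W" "p \<in> W"
    and eq: "\<And>q. q \<in> W \<Longrightarrow> Y q = Z q"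
  shows "D p v Y = D p v Z"
proof -
  define f :: "'a \<Rightarrow> real" where "f = indicator W"
  have f: "f q = 1" if "q \<in> W" for q
    using that by (simp add: f_def)
  have "smooth_fun \<A> W f"
    unfolding smooth_fun_def
  proof clarify
    fix V \<phi> assume "(V, \<phi>) \<in> \<A>"
    then have c: "(V, \<phi>) \<in> \<A>" .
    show "smooth_on (\<phi> ` (V \<inter> W)) (f \<circ> inv_into V \<phi>)"
    proof (rule smooth_on_transform)
      show "open (\<phi> ` (V \<inter> W))"
        using chart_image_open[OF A c assms(5)] by simp
      show "smooth_on (\<phi> ` (V \<inter> W)) (\<lambda>x. 1 :: real)"
        by (rule smooth_on_const)
      show "1 = (f \<circ> inv_into V \<phi>) x" if "x \<in> \<phi> ` (V \<inter> W)" for x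
        using that chart_inv_chart[OF A c] f by auto
    qed
  qed
  then have "smooth_fun_at \<A> p f"
    unfolding smooth_fun_at_def using assms by blast
  moreover have "mderiv \<A> f p v = 0"
    using mderiv_cong[OF A assms(5,6), of f "\<lambda>_. 1"] f by (simp add: mderiv_const)
  ultimately have "D p v (\<lambda>q. f q *\<^sub>R X q) = D p v X" if "smooth_vf_at \<A> p X" for X
    using D that f[OF assms(6)] unfolding connection_def by simp
  moreover have "f q *\<^sub>R Y q = f q *\<^sub>R Z q" for q
    using eq by (cases "q \<in> W") (auto simp: f_def)
  then have "(\<lambda>q. f q *\<^sub>R Y q) = (\<lambda>q. f q *\<^sub>R Z q)"
    by (rule ext)
  ultimately show ?thesis
    using assms(3,4) by metis
qed

lemma connection_minus:
  assumes "connection \<A> D" "smooth_vf_at \<A> p Y"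
  shows "D p v (\<lambda>q. - Y q) = - D p v Y"
proof -
  have "smooth_fun_at \<A> p (\<lambda>q. -1 :: real)"
    unfolding smooth_fun_at_def smooth_fun_def by (auto simp: comp_def smooth_on_const)
  with assms have "D p v (\<lambda>q. (-1) *\<^sub>R Y q) = mderiv \<A> (\<lambda>q. -1) p v *\<^sub>R Y p + (-1) *\<^sub>R D p v Y"
    unfolding connection_def by blast
  then show ?thesis
    by (simp add: mderiv_const)
qed

section \<open>Quaternionic algebra in a fibre of Q, and change of admissible basis\<close>

lemma admissible_basisD:
  assumes "admissible_basis \<A> Q U J"
  shows "open U" "a \<in> {1, 2, 3} \<Longrightarrow> smooth_endo \<A> U (J a)"
    and "p \<in> U \<Longrightarrow> Q p = {\<lambda>v. x *\<^sub>R J 1 p v + y *\<^sub>R J 2 p v + z *\<^sub>R J 3 p v | x y z. True}"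
    and "p \<in> U \<Longrightarrow> linear (J 1 p)" "p \<in> U \<Longrightarrow> linear (J 2 p)" "p \<in> U \<Longrightarrow> linear (J 3 p)"
  using assms unfolding admissible_basis_def smooth_endo_def by auto

lemma quaternion_relations:
  assumes "admissible_basis \<A> Q U J" "p \<in> U"
  shows "J 1 p (J 1 p v) = - v" "J 1 p (J 2 p v) = J 3 p v" "J 1 p (J 3 p v) = - J 2 p v"
    "J 2 p (J 1 p v) = - J 3 p v" "J 2 p (J 2 p v) = - v" "J 2 p (J 3 p v) = J 1 p v"
    "J 3 p (J 1 p v) = J 2 p v" "J 3 p (J 2 p v) = - J 1 p v" "J 3 p (J 3 p v) = - v"
proof -
  have b: "J 1 p (J 1 p v) = - v" "J 2 p (J 2 p v) = - v" "J 3 p (J 3 p v) = - v"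
    "J 1 p (J 2 p v) = J 3 p v" "J 2 p (J 1 p v) = - J 3 p v" for v
    using assms by (auto simp: admissible_basis_def)
  have l: "J a p (- v) = - J a p v" if "a \<in> {1, 2, 3}" for a v
    using assms that by (auto intro: linear_neg simp: admissible_basis_def smooth_endo_def)
  show "J 1 p (J 1 p v) = - v" "J 1 p (J 2 p v) = J 3 p v" "J 2 p (J 1 p v) = - J 3 p v"
    "J 2 p (J 2 p v) = - v" "J 3 p (J 3 p v) = - v"
    by (fact b)+
  show 1: "J 1 p (J 3 p v) = - J 2 p v" for v
    using b(1)[of "J 2 p v"] b(4) by simp
  show "J 3 p (J 1 p v) = J 2 p v"
    using b(4)[of "J 1 p v", symmetric] b(5) l 1 by simp
  show 2: "J 3 p (J 2 p v) = - J 1 p v"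
    using b(4)[of "J 2 p v", symmetric] b(2) l by simp
  show "J 2 p (J 3 p v) = J 1 p v"
    using b(5)[of "J 2 p v"] 2 by (simp add: b(4) del: One_nat_def)
qed

text \<open>Multiplication of imaginary quaternions: minus the inner product of the coefficient
  vectors, plus their cross product.\<close>

lemma quaternion_mult:
  fixes s1 s2 s3 t1 t2 t3 :: real
  assumes "admissible_basis \<A> Q U J" "p \<in> U"
  shows "s1 *\<^sub>R J 1 p (t1 *\<^sub>R J 1 p v + t2 *\<^sub>R J 2 p v + t3 *\<^sub>R J 3 p v)
     + s2 *\<^sub>R J 2 p (t1 *\<^sub>R J 1 p v + t2 *\<^sub>R J 2 p v + t3 *\<^sub>R J 3 p v)
     + s3 *\<^sub>R J 3 p (t1 *\<^sub>R J 1 p v + t2 *\<^sub>R J 2 p v + t3 *\<^sub>R J 3 p v)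
     = - ((s1 * t1 + s2 * t2 + s3 * t3) *\<^sub>R v)
       + (s2 * t3 - s3 * t2) *\<^sub>R J 1 p v + (s3 * t1 - s1 * t3) *\<^sub>R J 2 p v
       + (s1 * t2 - s2 * t1) *\<^sub>R J 3 p v"
  using admissible_basisD(4-6)[OF assms(1,2)]
  by (simp add: linear_add linear_scale quaternion_relations[OF assms] algebra_simps
      del: One_nat_def)

text \<open>Recovers a coefficient from the endomorphism itself: the anticommutator with
  \<open>J a\<close> is minus twice the coefficient \<open>t_a\<close> times the identity. This
  shows the coefficients to be unique and, later, smooth.\<close>

lemma quaternion_anticommutator:
  fixes t1 t2 t3 :: real
  assumes "admissible_basis \<A> Q U J" "p \<in> U"
  shows "J 1 p (t1 *\<^sub>R J 1 p v + t2 *\<^sub>R J 2 p v + t3 *\<^sub>R J 3 p v)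
      + (t1 *\<^sub>R J 1 p (J 1 p v) + t2 *\<^sub>R J 2 p (J 1 p v) + t3 *\<^sub>R J 3 p (J 1 p v)) = - (t1 *\<^sub>R v + t1 *\<^sub>R v)"
    "J 2 p (t1 *\<^sub>R J 1 p v + t2 *\<^sub>R J 2 p v + t3 *\<^sub>R J 3 p v)
      + (t1 *\<^sub>R J 1 p (J 2 p v) + t2 *\<^sub>R J 2 p (J 2 p v) + t3 *\<^sub>R J 3 p (J 2 p v)) = - (t2 *\<^sub>R v + t2 *\<^sub>R v)"
    "J 3 p (t1 *\<^sub>R J 1 p v + t2 *\<^sub>R J 2 p v + t3 *\<^sub>R J 3 p v)
      + (t1 *\<^sub>R J 1 p (J 3 p v) + t2 *\<^sub>R J 2 p (J 3 p v) + t3 *\<^sub>R J 3 p (J 3 p v)) = - (t3 *\<^sub>R v + t3 *\<^sub>R v)"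
  using admissible_basisD(4-6)[OF assms]
  by (simp_all add: linear_add linear_scale quaternion_relations[OF assms] algebra_simps
      del: One_nat_def)

lemma smooth_endo_combine:
  assumes "smooth_atlas \<A>" and "\<And>a. a \<in> {1, 2, 3} \<Longrightarrow> smooth_endo \<A> U (J a)"
  shows "smooth_endo \<A> U (\<lambda>p v. s1 *\<^sub>R J 1 p v + s2 *\<^sub>R J 2 p v + s3 *\<^sub>R J 3 p v)"
  unfolding smooth_endo_def
proof (intro conjI ballI allI impI)
  fix p assume "p \<in> U"
  then have "linear (J 1 p)" "linear (J 2 p)" "linear (J 3 p)"
    using assms(2) by (auto simp: smooth_endo_def)
  then show "linear (\<lambda>v. s1 *\<^sub>R J 1 p v + s2 *\<^sub>R J 2 p v + s3 *\<^sub>R J 3 p v)"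
    by (intro linear_compose_add linear_compose_scale_right)
next
  fix W X assume "open W" "W \<subseteq> U" "smooth_vf \<A> W X"
  then have "smooth_vf \<A> W (\<lambda>p. J a p (X p))" if "a \<in> {1, 2, 3}" for a
    using assms(2)[OF that] by (simp add: smooth_endo_def)
  then show "smooth_vf \<A> W (\<lambda>p. s1 *\<^sub>R J 1 p (X p) + s2 *\<^sub>R J 2 p (X p) + s3 *\<^sub>R J 3 p (X p))"
    using \<open>open W\<close>
    by (intro smooth_vf_add[OF assms(1)] smooth_vf_scale[OF assms(1)] smooth_fun_const[OF assms(1)]) auto
qed

text \<open>If \<open>(s1, s2)\<close> is nonzero, its quarter turn, normalised, is orthogonal to
  \<open>s\<close>; otherwise the first coordinate vector is.\<close>

lemma orthonormal_completion:
  fixes s1 s2 s3 :: real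
  assumes "s1\<^sup>2 + s2\<^sup>2 + s3\<^sup>2 = 1"
  obtains t1 t2 t3 where "t1\<^sup>2 + t2\<^sup>2 + t3\<^sup>2 = 1" "s1 * t1 + s2 * t2 + s3 * t3 = 0"
proof (cases "s1\<^sup>2 + s2\<^sup>2 = 0")
  case True
  then show thesis
    using that[of 1 0 0] by (simp add: sum_power2_eq_zero_iff)
next
  case False
  define r where "r = sqrt (s1\<^sup>2 + s2\<^sup>2)"
  have "r\<^sup>2 = s1\<^sup>2 + s2\<^sup>2" "r \<noteq> 0"
    using False by (auto simp: r_def)
  then show thesis
    using that[of "- s2 / r" "s1 / r" 0] False
    by (simp add: power_divide add_divide_distrib[symmetric] add.commute)
qed

text \<open>A rotation with constant coefficients preserves the quaternion relations and smoothness,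
  so any unit combination of \<open>I\<close> can become the first member, on the same
  \<open>U\<close>.\<close>

lemma admissible_basis_rotate:
  fixes s1 s2 s3 :: real
  assumes A: "smooth_atlas \<A>" and I: "admissible_basis \<A> Q U I"
    and s: "s1\<^sup>2 + s2\<^sup>2 + s3\<^sup>2 = 1"
  obtains J where "admissible_basis \<A> Q U J"
    "J 1 = (\<lambda>p v. s1 *\<^sub>R I 1 p v + s2 *\<^sub>R I 2 p v + s3 *\<^sub>R I 3 p v)"
proof -
  obtain t1 t2 t3 where t: "t1\<^sup>2 + t2\<^sup>2 + t3\<^sup>2 = 1" "s1 * t1 + s2 * t2 + s3 * t3 = 0"
    using orthonormal_completion[OF s] .
  \<comment> \<open>The cross product of \<open>s\<close> and \<open>t\<close>, so that
    \<open>s\<close>, \<open>t\<close>, \<open>r\<close> are the rows of a rotation matrix.\<close>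
  define r1 r2 r3 where r: "r1 = s2 * t3 - s3 * t2" "r2 = s3 * t1 - s1 * t3" "r3 = s1 * t2 - s2 * t1"
  define R where "R x y z = (\<lambda>p v. x *\<^sub>R I 1 p v + y *\<^sub>R I 2 p v + z *\<^sub>R I 3 p v)" for x y z :: real
  define J where "J a = (if a = (1::nat) then R s1 s2 s3 else if a = 2 then R t1 t2 t3 else R r1 r2 r3)" for a
  have J: "J 1 = R s1 s2 s3" "J 2 = R t1 t2 t3" "J 3 = R r1 r2 r3"
    by (auto simp: J_def)
  have rr: "r1\<^sup>2 + r2\<^sup>2 + r3\<^sup>2 = 1"
    using s t unfolding r by algebra
  \<comment> \<open>The columns of that matrix are orthonormal as well: this inverts the change of
    basis, so that the new basis spans the whole fibre.\<close>
  have orth: "s1 * s1 + t1 * t1 + r1 * r1 = 1" "s2 * s2 + t2 * t2 + r2 * r2 = 1"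
    "s3 * s3 + t3 * t3 + r3 * r3 = 1" "s1 * s2 + t1 * t2 + r1 * r2 = 0"
    "s1 * s3 + t1 * t3 + r1 * r3 = 0" "s2 * s3 + t2 * t3 + r2 * r3 = 0"
    using s t unfolding r by algebra+
  have mult: "R x y z p (R x' y' z' p v) = - ((x * x' + y * y' + z * z') *\<^sub>R v)
      + R (y * z' - z * y') (z * x' - x * z') (x * y' - y * x') p v"
    if "p \<in> U" for x y z x' y' z' p v
    using quaternion_mult[OF I that, of x x' v y' z' y z] unfolding R_def by (simp only: add.assoc)
  have sq: "R x y z p (R x y z p v) = - v" if "p \<in> U" "x\<^sup>2 + y\<^sup>2 + z\<^sup>2 = 1" for x y z p v
    using mult[OF that(1), of x y z x y z v] that(2) by (simp add: R_def power2_eq_square mult.commute)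
  have "R s1 s2 s3 p (R t1 t2 t3 p v) = R r1 r2 r3 p v" "R t1 t2 t3 p (R s1 s2 s3 p v) = - R r1 r2 r3 p v"
    if "p \<in> U" for p v
    using mult[OF that, of s1 s2 s3 t1 t2 t3 v] mult[OF that, of t1 t2 t3 s1 s2 s3 v] t(2)
    by (simp_all add: r[symmetric] mult.commute)
      (simp_all add: r R_def algebra_simps)
  moreover have "Q p = {\<lambda>v. x *\<^sub>R R s1 s2 s3 p v + y *\<^sub>R R t1 t2 t3 p v + z *\<^sub>R R r1 r2 r3 p v | x y z. True}"
    (is "_ = ?Q'") if p: "p \<in> U" for p
  proof -
    have Q: "Q p = {R x y z p | x y z. True}"
      using admissible_basisD(3)[OF I p] by (simp add: R_def)
    have comb: "(\<lambda>v. x *\<^sub>R R s1 s2 s3 p v + y *\<^sub>R R t1 t2 t3 p v + z *\<^sub>R R r1 r2 r3 p v)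
      = R (x * s1 + y * t1 + z * r1) (x * s2 + y * t2 + z * r2) (x * s3 + y * t3 + z * r3) p" for x y z
      by (simp add: R_def fun_eq_iff algebra_simps)
    have "R x y z p \<in> ?Q'" for x y z
    proof -
      let ?x = "x * s1 + y * s2 + z * s3" and ?y = "x * t1 + y * t2 + z * t3"
        and ?z = "x * r1 + y * r2 + z * r3"
      have "?x * s1 + ?y * t1 + ?z * r1 = x" "?x * s2 + ?y * t2 + ?z * r2 = y"
        "?x * s3 + ?y * t3 + ?z * r3 = z"
        using orth by algebra+
      then have "R x y z p = (\<lambda>v. ?x *\<^sub>R R s1 s2 s3 p v + ?y *\<^sub>R R t1 t2 t3 p v + ?z *\<^sub>R R r1 r2 r3 p v)"
        using comb by simp
      then show ?thesis by blast
    qed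
    then show ?thesis
      unfolding Q using comb by blast
  qed
  moreover have "smooth_endo \<A> U (R x y z)" for x y z
    unfolding R_def by (rule smooth_endo_combine[OF A admissible_basisD(2)[OF I]])
  ultimately have "admissible_basis \<A> Q U J"
    unfolding admissible_basis_def J using admissible_basisD(1)[OF I] sq s t(1) rr
    by (auto simp: J simp del: One_nat_def)
  then show thesis
    using that J(1) unfolding R_def by blast
qed

section \<open>The covariant derivative of \<open>J 1\<close> for the two connections\<close>

context
  fixes \<A> :: "('m::topological_space, 'e::euclidean_space) atlas"
    and Q :: "'m \<Rightarrow> ('e \<Rightarrow> 'e) set" and \<omega> :: "'m \<Rightarrow> 'e \<Rightarrow> 'e \<Rightarrow> real"
    and Dvol D :: "('m, 'e) conn"
    and U :: "'m set" and J :: "nat \<Rightarrow> 'm \<Rightarrow> 'e \<Rightarrow> 'e" and p :: 'm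
  assumes A: "smooth_atlas \<A>" and qsH: "almost_qsH \<A> Q \<omega>"
    and Dvol: "unimodular_oproiu \<A> Q \<omega> Dvol" and D: "qsH_connection \<A> \<omega> Dvol D"
    and J: "admissible_basis \<A> Q U J" and p: "p \<in> U"
begin

lemma smooth_J_vf: "smooth_vf_at \<A> p Y \<Longrightarrow> smooth_vf_at \<A> p (\<lambda>q. J 1 q (Y q))"
  using smooth_endo_vf_at[OF A admissible_basisD(2)[OF J] admissible_basisD(1)[OF J] p] by simp

text \<open>Differentiating \<open>J 1 (J 1 Y) = - Y\<close> shows that the derivative
  \<open>B\<close> of \<open>J 1\<close> anticommutes with \<open>J 1\<close>. A component
  \<open>x *\<^sub>R J 1\<close> of \<open>B\<close> would have to satisfy
  \<open>2 *\<^sub>R (x *\<^sub>R w) = 0\<close>.\<close>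

lemma cov_endo_Dvol:
  obtains y z where
    "\<And>Y. smooth_vf_at \<A> p Y \<Longrightarrow> cov_endo Dvol (J 1) p v Y = y *\<^sub>R J 2 p (Y p) + z *\<^sub>R J 3 p (Y p)"
proof -
  have conn: "connection \<A> Dvol" "preserves_Q \<A> Q Dvol"
    using Dvol by (auto simp: unimodular_oproiu_def)
  have "J 1 q \<in> Q q" if "q \<in> U" for q
  proof -
    have "J 1 q = (\<lambda>v. 1 *\<^sub>R J 1 q v + 0 *\<^sub>R J 2 q v + 0 *\<^sub>R J 3 q v)" by simp
    then show ?thesis unfolding admissible_basisD(3)[OF J that] by blast
  qed
  then obtain B where B: "B \<in> Q p" "\<And>Y. smooth_vf_at \<A> p Y \<Longrightarrow> cov_endo Dvol (J 1) p v Y = B (Y p)"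
    using conn(2) admissible_basisD(1)[OF J] admissible_basisD(2)[OF J, of 1] p
    unfolding preserves_Q_def by (metis insertI1)
  obtain x y z where xyz: "B = (\<lambda>v. x *\<^sub>R J 1 p v + y *\<^sub>R J 2 p v + z *\<^sub>R J 3 p v)"
    using B(1) unfolding admissible_basisD(3)[OF J p] by blast
  note J1 = linear_add[OF admissible_basisD(4)[OF J p]] linear_diff[OF admissible_basisD(4)[OF J p]]
    linear_scale[OF admissible_basisD(4)[OF J p]] linear_neg[OF admissible_basisD(4)[OF J p]]
  obtain w :: 'e where w: "w \<in> Basis" using nonempty_Basis by blast
  define Y where "Y = coord_vf \<A> p w"
  have Y: "smooth_vf_at \<A> p Y" "Y p = w"
    unfolding Y_def using coord_vf_smooth_at[OF A] coord_vf_self[OF A] by blast+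
  have minus: "smooth_vf_at \<A> p (\<lambda>q. - Y q)"
  proof -
    obtain W where "open W" "p \<in> W" "smooth_vf \<A> W Y"
      using Y(1) unfolding smooth_vf_at_def by blast
    then have "smooth_vf \<A> W (\<lambda>q. (-1) *\<^sub>R Y q)"
      by (intro smooth_vf_scale[OF A] smooth_fun_const[OF A])
    then show ?thesis
      using \<open>open W\<close> \<open>p \<in> W\<close> by (auto simp: smooth_vf_at_def)
  qed
  \<comment> \<open>\<open>J 1\<close> squares to minus one only on \<open>U\<close>, so the two
    fields agree as germs at \<open>p\<close> and not everywhere.\<close>
  have "Dvol p v (\<lambda>q. J 1 q (J 1 q (Y q))) = Dvol p v (\<lambda>q. - Y q)"
    by (rule connection_germ[OF A conn(1) _ minus admissible_basisD(1)[OF J] p])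
      (use smooth_J_vf Y(1) quaternion_relations(1)[OF J] in auto)
  also have "\<dots> = - Dvol p v Y"
    by (rule connection_minus[OF conn(1) Y(1)])
  finally have "cov_endo Dvol (J 1) p v (\<lambda>q. J 1 q (Y q)) = - J 1 p (cov_endo Dvol (J 1) p v Y)"
    unfolding cov_endo_def by (simp add: J1 quaternion_relations[OF J p] del: One_nat_def)
  then have "B (J 1 p w) = - J 1 p (B w)"
    by (simp only: B(2) Y smooth_J_vf)
  then have "- (x *\<^sub>R w) = x *\<^sub>R w"
    by (simp add: xyz J1 quaternion_relations[OF J p] del: One_nat_def)
  then have "2 *\<^sub>R (x *\<^sub>R w) = 0"
    by (simp only: neg_eq_iff_add_eq_0 scaleR_2)
  then have "x = 0"
    using w by auto
  then show thesis
    using that B(2) xyz by simp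
qed

lemma omega_J: "q \<in> U \<Longrightarrow> \<omega> q (J 1 q v) (J 1 q w) = \<omega> q v w"
  using qsH J unfolding almost_qsH_def by blast

text \<open>The difference tensor \<open>A'\<close> is dual to half the derivative of \<omega>. That
  derivative inherits \<open>J 1\<close>-invariance from \<omega> up to terms pairing the derivative
  of \<open>J 1\<close> with \<open>J 1\<close>; these vanish by \<open>anti\<close>, and
  nondegeneracy makes \<open>A'\<close> commute with \<open>J 1\<close>.\<close>

lemma cov_endo_D:
  assumes Y: "smooth_vf_at \<A> p Y"
  shows "cov_endo D (J 1) p v Y = cov_endo Dvol (J 1) p v Y"
proof -
  obtain A' where A': "\<And>p v Y. smooth_vf_at \<A> p Y \<Longrightarrow> D p v Y = Dvol p v Y + A' p v (Y p)"
     "\<And>p v Y Z. smooth_vf_at \<A> p Y \<Longrightarrow> smooth_vf_at \<A> p Z \<Longrightarrow>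
       \<omega> p (A' p v (Y p)) (Z p) = cov_2form \<A> Dvol \<omega> p v Y Z / 2"
    using D unfolding qsH_connection_def by blast
  have bil: "bilinear (\<omega> p)"
    using qsH by (simp add: almost_qsH_def smooth_2form_def)
  have nondeg: "v = 0" if "\<And>w. \<omega> p v w = 0" for v
    using qsH that unfolding almost_qsH_def by blast
  note bil_simps = bilinear_ladd[OF bil] bilinear_radd[OF bil] bilinear_lsub[OF bil]
    bilinear_rsub[OF bil] bilinear_lmul[OF bil] bilinear_rmul[OF bil] bilinear_lneg[OF bil] bilinear_rneg[OF bil]
  obtain y z where yz:
    "\<And>Y. smooth_vf_at \<A> p Y \<Longrightarrow> cov_endo Dvol (J 1) p v Y = y *\<^sub>R J 2 p (Y p) + z *\<^sub>R J 3 p (Y p)"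
    using cov_endo_Dvol[of v] by blast
  have DJ: "Dvol p v (\<lambda>q. J 1 q (Y q)) = J 1 p (Dvol p v Y) + y *\<^sub>R J 2 p (Y p) + z *\<^sub>R J 3 p (Y p)"
    if "smooth_vf_at \<A> p Y" for Y
    using yz[OF that] by (simp add: cov_endo_def algebra_simps)
  \<comment> \<open>Inserting \<open>J a\<close> and then \<open>J 1\<close> into both slots costs
    one sign each for a square, and exchanging \<open>J a\<close> with \<open>J 1\<close> in between
    costs a third.\<close>
  have anti: "\<omega> p (J a p u) (J 1 p w) + \<omega> p (J 1 p u) (J a p w) = 0" if a: "a = 2 \<or> a = 3" for a u w
  proof -
    have inv: "\<omega> p (J a p u) (J a p w) = \<omega> p u w" for u w
      using qsH J p a unfolding almost_qsH_def by blast
    have "\<omega> p (J 1 p u) (J a p w) = \<omega> p (J a p (J 1 p u)) (J a p (J a p w))"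
      by (simp only: inv)
    also have "\<dots> = \<omega> p (J 1 p (J a p u)) w"
      using a by (auto simp: quaternion_relations[OF J p] bil_simps simp del: One_nat_def)
    also have "\<dots> = \<omega> p (J 1 p (J 1 p (J a p u))) (J 1 p w)"
      by (simp only: omega_J[OF p])
    finally show ?thesis
      by (simp add: quaternion_relations[OF J p] bil_simps del: One_nat_def)
  qed
  have "\<omega> p (A' p v (J 1 p (Y p)) - J 1 p (A' p v (Y p))) w = 0" for w
  proof -
    \<comment> \<open>Chosen so that \<open>J 1 (Z p) = w\<close>: the identity for
      \<open>A'\<close> is available only with \<open>J 1\<close> applied in the second
      slot.\<close>
    define Z where "Z = coord_vf \<A> p (- J 1 p w)"
    have Z: "smooth_vf_at \<A> p Z" "J 1 p (Z p) = w"
      using coord_vf_smooth_at[OF A] coord_vf_self[OF A] quaternion_relations(1)[OF J p]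
        linear_neg[OF admissible_basisD(4)[OF J p]] by (auto simp: Z_def simp del: One_nat_def)
    have "mderiv \<A> (\<lambda>q. \<omega> q (J 1 q (Y q)) (J 1 q (Z q))) p = mderiv \<A> (\<lambda>q. \<omega> q (Y q) (Z q)) p"
      by (rule mderiv_cong[OF A admissible_basisD(1)[OF J] p]) (rule omega_J)
    then have "cov_2form \<A> Dvol \<omega> p v (\<lambda>q. J 1 q (Y q)) (\<lambda>q. J 1 q (Z q))
       = cov_2form \<A> Dvol \<omega> p v Y Z
         - y * (\<omega> p (J 2 p (Y p)) (J 1 p (Z p)) + \<omega> p (J 1 p (Y p)) (J 2 p (Z p)))
         - z * (\<omega> p (J 3 p (Y p)) (J 1 p (Z p)) + \<omega> p (J 1 p (Y p)) (J 3 p (Z p)))"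
      unfolding cov_2form_def DJ[OF Y] DJ[OF Z(1)]
      by (simp add: bil_simps omega_J[OF p] algebra_simps del: One_nat_def)
    then have "\<omega> p (A' p v (J 1 p (Y p))) (J 1 p (Z p)) = \<omega> p (A' p v (Y p)) (Z p)"
      using A'(2)[OF smooth_J_vf[OF Y] smooth_J_vf[OF Z(1)], of v] A'(2)[OF Y Z(1), of v] by (simp add: anti del: One_nat_def)
    also have "\<dots> = \<omega> p (J 1 p (A' p v (Y p))) (J 1 p (Z p))"
      by (simp only: omega_J[OF p])
    finally show ?thesis
      by (simp add: bil_simps Z del: One_nat_def)
  qed
  then have "A' p v (J 1 p (Y p)) = J 1 p (A' p v (Y p))"
    using nondeg by (metis right_minus_eq)
  then show ?thesis
    using A'(1)[OF Y] A'(1)[OF smooth_J_vf[OF Y]] linear_add[OF admissible_basisD(4)[OF J p]]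
    by (simp add: cov_endo_def)
qed

text \<open>Without torsion, brackets are differences of covariant derivatives; those of
  \<open>X\<close> and \<open>Y\<close> cancel by \<open>J 1\<close> squared being minus one, and
  only the derivative of \<open>J 1\<close> survives. As both connections give \<open>J 1\<close>
  the same derivative, \<open>C\<close> may be computed from \<open>D\<close> whichever of them is
  torsion-free.\<close>

lemma nijenhuis_torsion_free:
  assumes "torsion_free \<A> D \<or> torsion_free \<A> Dvol"
    and C: "\<And>v Y. smooth_vf_at \<A> p Y \<Longrightarrow> cov_endo D (J 1) p v Y = C v (Y p)"
    and X: "smooth_vf_at \<A> p X" and Y: "smooth_vf_at \<A> p Y"
  shows "nijenhuis \<A> (J 1) X Y p = C (J 1 p (X p)) (Y p) - C (J 1 p (Y p)) (X p)
     - J 1 p (C (X p) (Y p)) + J 1 p (C (Y p) (X p))"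
proof -
  obtain E where E: "torsion_free \<A> E" "\<And>v Y. smooth_vf_at \<A> p Y \<Longrightarrow> cov_endo E (J 1) p v Y = C v (Y p)"
    using assms(1) C cov_endo_D by metis
  have EJ: "E p v (\<lambda>q. J 1 q (Y q)) = J 1 p (E p v Y) + C v (Y p)" if "smooth_vf_at \<A> p Y" for Y v
    using E(2)[OF that, of v] by (simp add: cov_endo_def algebra_simps)
  have br: "lie_bracket \<A> X Y p = E p (X p) Y - E p (Y p) X"
    if "smooth_vf_at \<A> p X" "smooth_vf_at \<A> p Y" for X Y
    using E(1) that by (simp add: torsion_free_def torsion_def)
  note J1 = linear_add[OF admissible_basisD(4)[OF J p]] linear_diff[OF admissible_basisD(4)[OF J p]]
  show ?thesis
    unfolding nijenhuis_def Let_def br[OF smooth_J_vf[OF X] smooth_J_vf[OF Y]] br[OF smooth_J_vf[OF X] Y]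
      br[OF X smooth_J_vf[OF Y]] br[OF X Y] EJ[OF X] EJ[OF Y]
    by (simp add: J1 quaternion_relations[OF J p] del: One_nat_def)
qed

end

section \<open>Almost complex submanifolds\<close>

text \<open>The set \<open>L\<close> of vectors that \<open>J 2\<close> keeps in \<open>T\<close> is
  Q-invariant: \<open>J 1\<close> preserves \<open>T\<close> and anticommutes with
  \<open>J 2\<close>, and \<open>J 3 = J 1 J 2\<close>. So \<open>L\<close> is one of the subspaces
  spanning \<open>TQ\<close>, and it contains \<open>w\<close> together with
  \<open>J 2 w\<close>.\<close>

lemma TQ_I:
  fixes \<iota> :: "'n \<Rightarrow> 'm::topological_space" and x :: 'n
    and \<A> :: "('m, 'e::euclidean_space) atlas" and \<B> :: "('n, 'f::euclidean_space) atlas"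
  defines "T \<equiv> range (tangent_map \<B> \<A> \<iota> x)"
  assumes J: "admissible_basis \<A> Q U J" "\<iota> x \<in> U"
    and T: "subspace T"
    and J1: "\<And>v. v \<in> T \<Longrightarrow> J 1 (\<iota> x) v \<in> T"
    and w: "w \<in> T" "J 2 (\<iota> x) w \<in> T"
  shows "w \<in> TQ \<B> \<A> Q \<iota> x" "J 2 (\<iota> x) w \<in> TQ \<B> \<A> Q \<iota> x"
proof -
  let ?p = "\<iota> x"
  define L where "L = {v \<in> T. J 2 ?p v \<in> T}"
  note lin = admissible_basisD(4,5,6)[OF J]
  note rel = quaternion_relations[OF J]
  have minus: "- v \<in> T \<longleftrightarrow> v \<in> T" for v
    using T by (metis minus_minus subspace_neg)
  have L: "subspace L"
    unfolding L_def using T lin(2)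
    by (auto simp: subspace_def linear_add linear_scale linear_0)
  have L1: "J 1 ?p v \<in> L" if "v \<in> L" for v
    using that J1 minus unfolding L_def
    by (simp add: rel del: One_nat_def) (metis rel(2) J1)
  have L2: "J 2 ?p v \<in> L" if "v \<in> L" for v
    using that minus unfolding L_def by (simp add: rel)
  have L3: "J 3 ?p v \<in> L" if "v \<in> L" for v
    using L1[OF L2[OF that]] by (simp only: rel)
  have "B ` L \<subseteq> L" if "B \<in> Q ?p" for B
    using that L L1 L2 L3 unfolding admissible_basisD(3)[OF J]
    by (auto intro!: subspace_add subspace_scale)
  then have "L \<subseteq> TQ \<B> \<A> Q \<iota> x"
    unfolding TQ_def T_def[symmetric] using L L_def by (intro order_trans[OF _ span_superset] Union_upper) auto
  moreover have "w \<in> L" using w by (simp add: L_def)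
  ultimately show "w \<in> TQ \<B> \<A> Q \<iota> x" "J 2 ?p w \<in> TQ \<B> \<A> Q \<iota> x"
    using L2 by auto
qed

section \<open>The differential of the inclusion in charts; pulling back 1-forms and Nijenhuis
  tensors\<close>

context
  fixes \<A> :: "('m::topological_space, 'e::euclidean_space) atlas"
    and \<B> :: "('n::topological_space, 'f::euclidean_space) atlas"
    and \<iota> :: "'n \<Rightarrow> 'm"
  assumes A: "smooth_atlas \<A>" and B: "smooth_atlas \<B>" and sub: "submanifold \<B> \<A> \<iota>"
begin

lemma vimage_open: "open W \<Longrightarrow> open (\<iota> -` W)"
  using sub by (auto simp: submanifold_def intro: open_vimage)

lemma inclusion_rep_smooth:
  assumes "c \<in> \<A>" "d \<in> \<B>"
  shows "smooth_on (snd d ` (fst d \<inter> \<iota> -` fst c)) (snd c \<circ> \<iota> \<circ> chart_inv d)"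
  using sub smooth_funD[OF B _ assms(2), of "\<iota> -` fst c" "snd c \<circ> \<iota>"] assms(1)
  by (auto simp: submanifold_def)

lemma inclusion_rep_differentiable:
  assumes "c \<in> \<A>" "d \<in> \<B>" "x \<in> fst d" "\<iota> x \<in> fst c"
  shows "(snd c \<circ> \<iota> \<circ> chart_inv d) differentiable at (snd d x)"
  by (rule smooth_on_differentiable[OF inclusion_rep_smooth[OF assms(1,2)]]) (use assms in auto)

lemma tangent_map_coords:
  assumes c: "c \<in> \<A>" "\<iota> x \<in> fst c" and d: "d \<in> \<B>" "x \<in> fst d"
  shows "coords \<A> c (\<iota> x) (tangent_map \<B> \<A> \<iota> x v) =
    frechet_derivative (snd c \<circ> \<iota> \<circ> chart_inv d) (at (snd d x)) (coords \<B> d x v)"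
proof -
  let ?e = "chart_at \<A> (\<iota> x)"
  let ?S = "snd d ` (fst d \<inter> \<iota> -` (fst ?e \<inter> fst c))"
  let ?g = "snd ?e \<circ> \<iota> \<circ> chart_inv d" and ?t = "snd c \<circ> chart_inv ?e"
  note e = chart_at_in[OF A, of "\<iota> x"]
  have S: "open ?S" "snd d x \<in> ?S"
    using chart_image_open[OF B d(1) vimage_open[OF open_Int[OF chart_open[OF A e(1)] chart_open[OF A c(1)]]]]
      e c d by auto
  have gx: "?g (snd d x) = snd ?e (\<iota> x)"
    using chart_inv_chart[OF B d] by simp
  have g: "(?g has_derivative frechet_derivative ?g (at (snd d x))) (at (snd d x))"
    by (rule has_derivative_frechet[OF inclusion_rep_differentiable]) (use d e in auto)
  have t: "(?t has_derivative frechet_derivative ?t (at (snd ?e (\<iota> x)))) (at (?g (snd d x)))"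
    unfolding gx by (rule has_derivative_frechet[OF transition_differentiable[OF A e(1) c(1) e(2) c(2)]])
  have "tangent_map \<B> \<A> \<iota> x v = frechet_derivative ?g (at (snd d x)) (coords \<B> d x v)"
    unfolding tangent_map_def
    using mderiv_chain[OF B d, of "snd ?e \<circ> \<iota>" v] inclusion_rep_differentiable[OF e(1) d e(2)] by simp
  then have "coords \<A> c (\<iota> x) (tangent_map \<B> \<A> \<iota> x v) =
    frechet_derivative ?t (at (snd ?e (\<iota> x))) (frechet_derivative ?g (at (snd d x)) (coords \<B> d x v))"
    using coords_transition[OF A e(1) c(1) e(2) c(2)] coords_chart_at[OF A] by simp
  also have "\<dots> = frechet_derivative (\<lambda>y. ?t (?g y)) (at (snd d x)) (coords \<B> d x v)"
    using frechet_derivative_eq[OF has_derivative_compose[OF g t]] by simp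
  also have "frechet_derivative (\<lambda>y. ?t (?g y)) (at (snd d x)) =
      frechet_derivative (snd c \<circ> \<iota> \<circ> chart_inv d) (at (snd d x))"
    by (rule frechet_derivative_cong_open[OF S])
      (use chart_inv_chart[OF A e(1)] chart_inv_chart[OF B d(1)] in auto)
  finally show ?thesis .
qed

lemma tangent_map_linear: "linear (tangent_map \<B> \<A> \<iota> x)"
proof -
  let ?c = "chart_at \<A> (\<iota> x)" and ?d = "chart_at \<B> x"
  have "tangent_map \<B> \<A> \<iota> x = frechet_derivative (snd ?c \<circ> \<iota> \<circ> chart_inv ?d) (at (snd ?d x))"
    using tangent_map_coords[OF chart_at_in[OF A] chart_at_in[OF B]]
      coords_chart_at[OF A] coords_chart_at[OF B] by (metis (no_types, lifting) ext)
  then show ?thesis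
    using linear_frechet_derivative[OF inclusion_rep_differentiable] chart_at_in[OF A] chart_at_in[OF B]
    by metis
qed

text \<open>A smooth 1-form is tested on fields of M, but \<open>X\<close> lives on N. Expanding
  \<alpha> over the coordinate fields of a chart of M separates smooth coefficients, composed with
  the inclusion, from the components of the pushed-forward vector. This provides the smoothness of
  \<psi> along N.\<close>

lemma smooth_1form_along:
  assumes \<alpha>: "smooth_1form \<A> U \<alpha>" "open U" and W: "open W" "\<iota> ` W \<subseteq> U" and X: "smooth_vf \<B> W X"
  shows "smooth_fun \<B> W (\<lambda>x. \<alpha> (\<iota> x) (tangent_map \<B> \<A> \<iota> x (X x)))"
proof (rule smooth_funI[OF B W(1)])
  fix x assume x: "x \<in> W"
  let ?c = "chart_at \<A> (\<iota> x)" and ?d = "chart_at \<B> x"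
  note c = chart_at_in[OF A, of "\<iota> x"] and d = chart_at_in[OF B, of x]
  let ?V = "W \<inter> \<iota> -` fst ?c"
  let ?S = "snd ?d ` (fst ?d \<inter> ?V)" and ?g = "snd ?c \<circ> \<iota> \<circ> chart_inv ?d"
  let ?E = "\<lambda>i q. inv (coords \<A> ?c q) i"
  have V: "open ?V" using W(1) vimage_open chart_open[OF A c(1)] by auto
  then have S: "open ?S" by (rule chart_image_open[OF B d(1)])
  let ?U = "fst ?c \<inter> U"
  have U: "open ?U" using chart_open[OF A c(1)] \<alpha>(2) by auto
  have g: "smooth_on ?S ?g"
    by (rule smooth_on_subset[OF inclusion_rep_smooth[OF c(1) d(1)]]) blast
  have coef: "smooth_on ?S (\<lambda>y. ((\<lambda>q. \<alpha> q (?E i q)) \<circ> chart_inv ?c) (?g y))" for i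
  proof (rule smooth_on_compose[OF S chart_image_open[OF A c(1) U] _ g])
    have "smooth_vf \<A> ?U (?E i)"
      by (rule smooth_vf_subset[OF A smooth_vf_const_coords[OF A c(1)] _ U]) blast
    then have "smooth_fun \<A> ?U (\<lambda>q. \<alpha> q (?E i q))"
      using \<alpha>(1) U unfolding smooth_1form_def by blast
    then show "smooth_on (snd ?c ` (fst ?c \<inter> ?U)) ((\<lambda>q. \<alpha> q (?E i q)) \<circ> chart_inv ?c)"
      by (rule smooth_funD[OF A _ c(1)])
    show "?g ` ?S \<subseteq> snd ?c ` (fst ?c \<inter> ?U)"
      using W(2) chart_inv_chart[OF B d(1)] by auto
  qed
  have vel: "smooth_on ?S (\<lambda>y. frechet_derivative ?g (at y) (vf_rep \<B> ?d X y))"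
    by (intro smooth_on_deriv_apply S g smooth_on_subset[OF smooth_vf_rep[OF B X d(1)]]) blast
  have "smooth_on ?S (\<lambda>y. \<Sum>i\<in>Basis. (frechet_derivative ?g (at y) (vf_rep \<B> ?d X y) \<bullet> i) *\<^sub>R
      ((\<lambda>q. \<alpha> q (?E i q)) \<circ> chart_inv ?c) (?g y))"
    by (intro smooth_on_sum smooth_on_scaleR S finite_Basis coef
        smooth_on_linear[OF bounded_linear_inner_left] vel)
  then have "smooth_on ?S ((\<lambda>x. \<alpha> (\<iota> x) (tangent_map \<B> \<A> \<iota> x (X x))) \<circ> chart_inv ?d)"
  proof (rule smooth_on_transform[OF S])
    fix y assume "y \<in> ?S"
    then obtain z where z: "z \<in> fst ?d" "z \<in> W" "\<iota> z \<in> fst ?c" "y = snd ?d z" by blast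
    let ?v = "coords \<A> ?c (\<iota> z) (tangent_map \<B> \<A> \<iota> z (X z))"
    note inv = chart_inv_chart[OF A c(1) z(3)] chart_inv_chart[OF B d(1) z(1)]
    have v: "frechet_derivative ?g (at y) (vf_rep \<B> ?d X y) = ?v"
      using tangent_map_coords[OF c(1) z(3) d(1) z(1)] vf_rep_chart[OF B d(1) z(1)] z(4) by simp
    have "linear (\<alpha> (\<iota> z))"
      using \<alpha>(1) W(2) z(2) by (auto simp: smooth_1form_def)
    then have "linear (\<alpha> (\<iota> z) \<circ> inv (coords \<A> ?c (\<iota> z)))"
      by (rule linear_compose[OF coords_inv(3)[OF A c(1) z(3)]])
    from linear_Basis_expansion[OF this, of ?v]
    show "(\<Sum>i\<in>Basis. (frechet_derivative ?g (at y) (vf_rep \<B> ?d X y) \<bullet> i) *\<^sub>R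
      ((\<lambda>q. \<alpha> q (?E i q)) \<circ> chart_inv ?c) (?g y))
      = ((\<lambda>x. \<alpha> (\<iota> x) (tangent_map \<B> \<A> \<iota> x (X x))) \<circ> chart_inv ?d) y"
      unfolding v by (simp add: inv z(4) coords_inv(1)[OF A c(1) z(3)])
  qed
  then show "\<exists>c\<in>\<B>. x \<in> fst c \<and> (\<exists>V. open V \<and> x \<in> V \<and> smooth_on (snd c ` (fst c \<inter> V))
     ((\<lambda>x. \<alpha> (\<iota> x) (tangent_map \<B> \<A> \<iota> x (X x))) \<circ> chart_inv c))"
    using d c V x by (intro bexI[of _ ?d] conjI exI[of _ ?V]) auto
qed

text \<open>The manifold form of \<open>flat_nijenhuis_immersion\<close>, read in the charts
  selected at \<open>x\<close> and at \<open>\<iota> x\<close>, where tangent vectors coincide with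
  their components. \<open>E\<close> is again the derivative of the error coefficients.\<close>

lemma nijenhuis_immersion:
  fixes s :: "nat \<Rightarrow> 'n \<Rightarrow> real" and x :: 'n and J :: "nat \<Rightarrow> 'm \<Rightarrow> 'e \<Rightarrow> 'e"
  defines "E \<equiv> \<lambda>u w. \<Sum>a\<in>{1, 2, 3}. mderiv \<B> (s a) x u *\<^sub>R J a (\<iota> x) w"
  assumes Jhat: "smooth_endo \<B> UNIV Jhat" "\<And>v. Jhat x (Jhat x v) = - v"
    and J: "\<And>a. a \<in> {1, 2, 3} \<Longrightarrow> smooth_endo \<A> U (J a)" "open U"
    and sq: "\<And>w. J 1 (\<iota> x) (J 1 (\<iota> x) w) = - w"
    and W: "open W" "x \<in> W" "\<iota> ` W \<subseteq> U"
    and ds: "\<And>a. a \<in> {1, 2, 3} \<Longrightarrow>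
      (s a \<circ> chart_inv (chart_at \<B> x)) differentiable at (snd (chart_at \<B> x) x)"
    and s0: "\<And>a. a \<in> {1, 2, 3} \<Longrightarrow> s a x = 0"
    and rel: "\<And>z v. z \<in> W \<Longrightarrow> tangent_map \<B> \<A> \<iota> z (Jhat z v) =
       J 1 (\<iota> z) (tangent_map \<B> \<A> \<iota> z v)
         + (\<Sum>a\<in>{1, 2, 3}. s a z *\<^sub>R J a (\<iota> z) (tangent_map \<B> \<A> \<iota> z v))"
    and X: "smooth_vf_at \<B> x X" and Y: "smooth_vf_at \<B> x Y"
  shows "tangent_map \<B> \<A> \<iota> x (nijenhuis \<B> Jhat X Y x) =
      nijenhuis \<A> (J 1) (coord_vf \<A> (\<iota> x) (tangent_map \<B> \<A> \<iota> x (X x)))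
        (coord_vf \<A> (\<iota> x) (tangent_map \<B> \<A> \<iota> x (Y x))) (\<iota> x)
      + E (Jhat x (X x)) (tangent_map \<B> \<A> \<iota> x (Y x))
      - E (Jhat x (Y x)) (tangent_map \<B> \<A> \<iota> x (X x))
      - J 1 (\<iota> x) (E (X x) (tangent_map \<B> \<A> \<iota> x (Y x)))
      + J 1 (\<iota> x) (E (Y x) (tangent_map \<B> \<A> \<iota> x (X x)))"
proof -
  let ?c = "chart_at \<A> (\<iota> x)" and ?d = "chart_at \<B> x"
  note c = chart_at_in[OF A, of "\<iota> x"] and d = chart_at_in[OF B, of x]
  let ?T = "snd ?c ` (fst ?c \<inter> U)"
  let ?S = "snd ?d ` (fst ?d \<inter> (W \<inter> \<iota> -` fst ?c))"
  let ?g = "snd ?c \<circ> \<iota> \<circ> chart_inv ?d" and ?y = "snd ?d x"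
  have S: "open ?S" "?y \<in> ?S"
    using chart_image_open[OF B d(1) open_Int[OF W(1) vimage_open[OF chart_open[OF A c(1)]]]] c d W(2)
    by auto
  have T: "open ?T"
    using chart_image_open[OF A c(1) J(2)] .
  have gy: "?g (snd ?d z) = snd ?c (\<iota> z)" if "z \<in> fst ?d" for z
    using chart_inv_chart[OF B d(1) that] by simp
  have gx: "?g ?y = snd ?c (\<iota> x)" by (rule gy[OF d(2)])
  have gS: "?g ` ?S \<subseteq> ?T"
    using gy W(3) by auto
  have xU: "\<iota> x \<in> U" "snd ?c (\<iota> x) \<in> ?T" using W c by auto
  have dg: "frechet_derivative ?g (at ?y) v = tangent_map \<B> \<A> \<iota> x v" for v
    using tangent_map_coords[OF c d, of v] coords_chart_at[OF A] coords_chart_at[OF B] by simp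
  have g: "smooth_on ?S ?g"
    by (rule smooth_on_subset[OF inclusion_rep_smooth[OF c(1) d(1)]]) blast
  have "frechet_derivative ?g (at ?y) (flat_nijenhuis (endo_rep \<B> ?d Jhat) ?y (X x) (Y x)) =
      flat_nijenhuis (endo_rep \<A> ?c (J 1)) (?g ?y)
        (frechet_derivative ?g (at ?y) (X x)) (frechet_derivative ?g (at ?y) (Y x))
      + (\<Sum>a\<in>{1, 2, 3}. frechet_derivative (s a \<circ> chart_inv ?d) (at ?y) (endo_rep \<B> ?d Jhat ?y (X x))
           *\<^sub>R endo_rep \<A> ?c (J a) (?g ?y) (frechet_derivative ?g (at ?y) (Y x)))
      - (\<Sum>a\<in>{1, 2, 3}. frechet_derivative (s a \<circ> chart_inv ?d) (at ?y) (endo_rep \<B> ?d Jhat ?y (Y x))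
           *\<^sub>R endo_rep \<A> ?c (J a) (?g ?y) (frechet_derivative ?g (at ?y) (X x)))
      - endo_rep \<A> ?c (J 1) (?g ?y) (\<Sum>a\<in>{1, 2, 3}. frechet_derivative (s a \<circ> chart_inv ?d) (at ?y) (X x)
           *\<^sub>R endo_rep \<A> ?c (J a) (?g ?y) (frechet_derivative ?g (at ?y) (Y x)))
      + endo_rep \<A> ?c (J 1) (?g ?y) (\<Sum>a\<in>{1, 2, 3}. frechet_derivative (s a \<circ> chart_inv ?d) (at ?y) (Y x)
           *\<^sub>R endo_rep \<A> ?c (J a) (?g ?y) (frechet_derivative ?g (at ?y) (X x)))"
  proof (rule flat_nijenhuis_immersion[where J = "\<lambda>a. endo_rep \<A> ?c (J a)"
        and s = "\<lambda>a. s a \<circ> chart_inv ?d", OF S T gS g])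
    show "linear (endo_rep \<B> ?d Jhat y)" if "y \<in> ?S" for y
      by (rule endo_rep_linear[OF B d(1) _ Jhat(1)]) (use that in auto)
    show "(\<lambda>y. endo_rep \<B> ?d Jhat y v) differentiable at ?y" for v
      by (rule smooth_on_differentiable[OF endo_rep_smooth[OF B Jhat(1) open_UNIV d(1)]]) (use d in auto)
    show "linear (endo_rep \<A> ?c (J a) z)" if "a \<in> {1, 2, 3}" "z \<in> ?T" for a z
      by (rule endo_rep_linear[OF A c(1) that(2) J(1)[OF that(1)]])
    show "(\<lambda>z. endo_rep \<A> ?c (J a) z v) differentiable at (?g ?y)" if "a \<in> {1, 2, 3}" for a v
      unfolding gx
      by (rule smooth_on_differentiable[OF endo_rep_smooth[OF A J(1)[OF that] J(2) c(1)] xU(2)])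
    show "(s a \<circ> chart_inv ?d) differentiable at ?y" if "a \<in> {1, 2, 3}" for a
      by (rule ds[OF that])
    show "(s a \<circ> chart_inv ?d) ?y = 0" if "a \<in> {1, 2, 3}" for a
      using s0[OF that] chart_inv_chart[OF B d] by simp
    show "endo_rep \<A> ?c (J 1) (?g ?y) (endo_rep \<A> ?c (J 1) (?g ?y) w) = - w" for w
      unfolding gx endo_rep_chart_at[OF A] by (rule sq)
  next
    fix y v assume "y \<in> ?S"
    then obtain z where z: "z \<in> fst ?d" "z \<in> W" "\<iota> z \<in> fst ?c" "y = snd ?d z" by blast
    \<comment> \<open>The flat statement quantifies over component vectors \<open>v\<close>;
      \<open>u\<close> is the tangent vector of N at \<open>z\<close> with these components.\<close>
    define u where "u = inv (coords \<B> ?d z) v"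
    have v: "v = coords \<B> ?d z u"
      by (simp add: u_def coords_inv[OF B d(1) z(1)])
    have K: "endo_rep \<B> ?d Jhat y v = coords \<B> ?d z (Jhat z u)"
      unfolding v z(4) by (rule endo_rep_coords[OF B d(1) z(1)])
    have dg: "frechet_derivative ?g (at y) (coords \<B> ?d z u) = coords \<A> ?c (\<iota> z) (tangent_map \<B> \<A> \<iota> z u)" for u
      unfolding z(4) by (rule tangent_map_coords[OF c(1) z(3) d(1) z(1), symmetric])
    have Jz: "endo_rep \<A> ?c (J a) (?g y) (coords \<A> ?c (\<iota> z) w) = coords \<A> ?c (\<iota> z) (J a (\<iota> z) w)" for a w
      unfolding z(4) gy[OF z(1)] by (rule endo_rep_coords[OF A c(1) z(3)])
    note lin = coords_linear[OF A c(1) z(3)]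
    show "frechet_derivative ?g (at y) (endo_rep \<B> ?d Jhat y v) =
       endo_rep \<A> ?c (J 1) (?g y) (frechet_derivative ?g (at y) v)
         + (\<Sum>a\<in>{1, 2, 3}. (s a \<circ> chart_inv ?d) y *\<^sub>R
              endo_rep \<A> ?c (J a) (?g y) (frechet_derivative ?g (at y) v))"
      unfolding K unfolding v dg Jz rel[OF z(2)] linear_add[OF lin] linear_sum[OF lin] linear_scale[OF lin]
      using chart_inv_chart[OF B d(1) z(1)] z(4) by simp
  qed simp_all
  then show ?thesis
    unfolding gx dg endo_rep_chart_at[OF A] endo_rep_chart_at[OF B]
      mderiv_chart_at[of \<B> "s a" x for a, symmetric] E_def
    unfolding nijenhuis_rep[OF B Jhat(1) open_UNIV UNIV_I Jhat(2) X Y]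
      nijenhuis_rep[OF A J(1)[of 1, OF insertI1] J(2) xU(1) sq coord_vf_smooth_at[OF A] coord_vf_smooth_at[OF A]]
      coord_vf_self[OF A]
    by simp
qed

end

text \<open>An admissible basis near \<open>\<iota> x\<close> with \<open>J 1 = Jhat\<close> on \<open>TN\<close> only at the point \<open>x\<close>; the section of \<open>Q\<close>
  inducing \<open>Jhat\<close> is \<open>J 1 + s 1 J 1 + s 2 J 2 + s 3 J 3\<close> along \<open>N\<close>. This avoids extending the section to a
  neighbourhood in \<open>M\<close>, and \<open>s = 0\<close> is the case of an adapted basis.\<close>

definition frame_at ::
  "('n::topological_space, 'f::euclidean_space) atlas \<Rightarrow> ('n \<Rightarrow> 'f \<Rightarrow> 'f) \<Rightarrow>
   ('m::topological_space, 'e::euclidean_space) atlas \<Rightarrow> ('m \<Rightarrow> ('e \<Rightarrow> 'e) set) \<Rightarrow> ('n \<Rightarrow> 'm) \<Rightarrow>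
   'n \<Rightarrow> 'm set \<Rightarrow> (nat \<Rightarrow> 'm \<Rightarrow> 'e \<Rightarrow> 'e) \<Rightarrow> 'n set \<Rightarrow> (nat \<Rightarrow> 'n \<Rightarrow> real) \<Rightarrow> bool" where
  "frame_at \<B> Jhat \<A> Q \<iota> x U J W s \<longleftrightarrow> admissible_basis \<A> Q U J \<and> open W \<and> x \<in> W \<and> \<iota> ` W \<subseteq> U \<and>
     (\<forall>a\<in>{1, 2, 3}. s a x = 0 \<and>
        (s a \<circ> chart_inv (chart_at \<B> x)) differentiable at (snd (chart_at \<B> x) x)) \<and>
     (\<forall>u. mderiv \<B> (s 1) x u = 0) \<and>
     (\<forall>z\<in>W. \<forall>v. tangent_map \<B> \<A> \<iota> z (Jhat z v) = J 1 (\<iota> z) (tangent_map \<B> \<A> \<iota> z v)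
         + (\<Sum>a\<in>{1, 2, 3}. s a z *\<^sub>R J a (\<iota> z) (tangent_map \<B> \<A> \<iota> z v)))"

section \<open>Bases matching \<open>Jhat\<close> at one point, and the resulting form of its
  Nijenhuis tensor\<close>

context
  fixes \<A> :: "('m::topological_space, 'e::euclidean_space) atlas"
    and \<B> :: "('n::topological_space, 'f::euclidean_space) atlas"
    and \<iota> :: "'n \<Rightarrow> 'm" and Q :: "'m \<Rightarrow> ('e \<Rightarrow> 'e) set"
    and Jhat :: "'n \<Rightarrow> 'f \<Rightarrow> 'f"
  assumes A: "smooth_atlas \<A>" and B: "smooth_atlas \<B>" and sub: "submanifold \<B> \<A> \<iota>"
    and Jhat: "almost_complex_structure \<B> Jhat"
begin

text \<open>As an element of Q, \<open>S\<close> squares to minus the squared length of its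
  coefficients, on all of TM. On the image of TN it squares to minus one, and that image contains a
  nonzero vector.\<close>

lemma section_coefficients_unit:
  fixes x1 x2 x3 :: real
  assumes J: "admissible_basis \<A> Q U J" "\<iota> z \<in> U"
    and S: "\<And>v. S (tangent_map \<B> \<A> \<iota> z v) = tangent_map \<B> \<A> \<iota> z (Jhat z v)"
    and coef: "S = (\<lambda>v. x1 *\<^sub>R J 1 (\<iota> z) v + x2 *\<^sub>R J 2 (\<iota> z) v + x3 *\<^sub>R J 3 (\<iota> z) v)"
  shows "x1\<^sup>2 + x2\<^sup>2 + x3\<^sup>2 = 1"
proof -
  obtain v :: 'f where v: "v \<in> Basis" using nonempty_Basis by blast
  note lin = tangent_map_linear[OF A B sub, of z]
  let ?w = "tangent_map \<B> \<A> \<iota> z v"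
  have "inj (tangent_map \<B> \<A> \<iota> z)"
    using sub by (simp add: submanifold_def)
  then have w: "?w \<noteq> 0"
    using v linear_0[OF lin] nonzero_Basis by (metis injD)
  have "Jhat z (Jhat z v) = - v"
    using Jhat by (simp add: almost_complex_structure_def)
  then have "S (S ?w) = - ?w"
    by (simp add: S linear_neg[OF lin])
  moreover have "S (S ?w) = - ((x1 * x1 + x2 * x2 + x3 * x3) *\<^sub>R ?w)"
    using quaternion_mult[OF J, of x1 x1 ?w x2 x3 x2 x3] unfolding coef by (simp add: mult.commute)
  ultimately have "(x1 * x1 + x2 * x2 + x3 * x3 - 1) *\<^sub>R ?w = 0"
    by (simp add: scaleR_diff_left)
  then show ?thesis
    using w by (simp add: power2_eq_square)
qed

text \<open>The constant coefficients of \<open>S x\<close> in \<open>I\<close> give the rotation,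
  so the new \<open>J 1\<close> equals the section at \<open>x\<close>; how the section departs from
  \<open>J 1\<close> at other points of N is recorded in \<open>s\<close>.\<close>

lemma frame_at_exists:
  assumes Q: "almost_quaternionic \<A> Q" and sec: "section_along \<B> \<A> Q \<iota> S"
    and S: "\<And>z v. S z (tangent_map \<B> \<A> \<iota> z v) = tangent_map \<B> \<A> \<iota> z (Jhat z v)"
  obtains U J W s where "frame_at \<B> Jhat \<A> Q \<iota> x U J W s"
proof -
  obtain U I where I: "\<iota> x \<in> U" "admissible_basis \<A> Q U I"
    using Q unfolding almost_quaternionic_def by blast
  have SQ: "S z \<in> Q (\<iota> z)" for z
    using sec by (simp add: section_along_def)
  obtain x1 x2 x3 where x: "S x = (\<lambda>v. x1 *\<^sub>R I 1 (\<iota> x) v + x2 *\<^sub>R I 2 (\<iota> x) v + x3 *\<^sub>R I 3 (\<iota> x) v)"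
    using SQ[of x] unfolding admissible_basisD(3)[OF I(2,1)] by blast
  obtain J where J: "admissible_basis \<A> Q U J" and
    "J 1 = (\<lambda>p v. x1 *\<^sub>R I 1 p v + x2 *\<^sub>R I 2 p v + x3 *\<^sub>R I 3 p v)"
    using admissible_basis_rotate[OF A I(2) section_coefficients_unit[OF I(2,1) S x]] .
  then have J1: "J 1 (\<iota> x) = S x" by (simp add: x)
  note openU = admissible_basisD(1)[OF J]
  have t_ex: "\<exists>t :: nat \<Rightarrow> real. S z = (\<lambda>v. t 1 *\<^sub>R J 1 (\<iota> z) v + t 2 *\<^sub>R J 2 (\<iota> z) v + t 3 *\<^sub>R J 3 (\<iota> z) v)"
    if z: "\<iota> z \<in> U" for z
  proof -
    obtain y1 y2 y3 where "S z = (\<lambda>v. y1 *\<^sub>R J 1 (\<iota> z) v + y2 *\<^sub>R J 2 (\<iota> z) v + y3 *\<^sub>R J 3 (\<iota> z) v)"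
      using SQ[of z] unfolding admissible_basisD(3)[OF J z] by blast
    then show ?thesis
      by (intro exI[of _ "\<lambda>a::nat. if a = 1 then y1 else if a = 2 then y2 else y3"]) simp
  qed
  define t where "t z = (SOME t :: nat \<Rightarrow> real.
      S z = (\<lambda>v. t 1 *\<^sub>R J 1 (\<iota> z) v + t 2 *\<^sub>R J 2 (\<iota> z) v + t 3 *\<^sub>R J 3 (\<iota> z) v))" for z
  have t: "S z = (\<lambda>v. t z 1 *\<^sub>R J 1 (\<iota> z) v + t z 2 *\<^sub>R J 2 (\<iota> z) v + t z 3 *\<^sub>R J 3 (\<iota> z) v)"
    if "\<iota> z \<in> U" for z
    unfolding t_def by (rule someI_ex[OF t_ex[OF that]])
  \<comment> \<open>The coefficients of \<open>S\<close> are recovered from anticommutators, hence they are smooth.\<close>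
  have anti: "J a (\<iota> z) (S z v) + S z (J a (\<iota> z) v) = - (t z a *\<^sub>R v + t z a *\<^sub>R v)"
    if a: "a \<in> {1, 2, 3}" and z: "\<iota> z \<in> U" for a z v
  proof -
    have "J 1 (\<iota> z) (S z v) + S z (J 1 (\<iota> z) v) = - (t z 1 *\<^sub>R v + t z 1 *\<^sub>R v)"
      "J 2 (\<iota> z) (S z v) + S z (J 2 (\<iota> z) v) = - (t z 2 *\<^sub>R v + t z 2 *\<^sub>R v)"
      "J 3 (\<iota> z) (S z v) + S z (J 3 (\<iota> z) v) = - (t z 3 *\<^sub>R v + t z 3 *\<^sub>R v)"
      by (subst (1 2) t[OF z], rule quaternion_anticommutator[OF J z])+
    then show ?thesis using a by blast
  qed
  let ?c = "chart_at \<A> (\<iota> x)" and ?d = "chart_at \<B> x"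
  note c = chart_at_in[OF A, of "\<iota> x"] and d = chart_at_in[OF B, of x]
  define W where "W = \<iota> -` (fst ?c \<inter> U)"
  have W: "open W" "x \<in> W" "\<iota> ` W \<subseteq> U"
    using vimage_open[OF A B sub open_Int[OF chart_open[OF A c(1)] openU]] c I(1) by (auto simp: W_def)
  let ?D = "snd ?d ` (fst ?d \<inter> W)" and ?g = "snd ?c \<circ> \<iota> \<circ> chart_inv ?d"
  let ?T = "snd ?c ` (fst ?c \<inter> U)"
  have D: "open ?D" "snd ?d x \<in> ?D"
    using chart_image_open[OF B d(1) W(1)] d W(2) by auto
  have T: "open ?T" using chart_image_open[OF A c(1) openU] .
  have g: "smooth_on ?D ?g" "?g ` ?D \<subseteq> ?T"
    using smooth_on_subset[OF inclusion_rep_smooth[OF A B sub c(1) d(1)], of ?D]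
      chart_inv_chart[OF B d(1)] by (auto simp: W_def)
  \<comment> \<open>The matrix of the section along N: the base point is read in a chart of N, the
    vectors in a chart of M.\<close>
  define Sr where "Sr y v = (let z = chart_inv ?d y in
    coords \<A> ?c (\<iota> z) (S z (inv (coords \<A> ?c (\<iota> z)) v)))" for y v
  have Sr_smooth: "smooth_on ?D (\<lambda>y. Sr y v)" for v
  proof -
    have "smooth_vf_along \<B> \<A> \<iota> (\<iota> -` fst ?c) (\<lambda>z. S z (inv (coords \<A> ?c (\<iota> z)) v))"
      using sec smooth_vf_const_coords[OF A c(1), of v] chart_open[OF A c(1)]
      unfolding section_along_def by blast
    then have "smooth_fun \<B> (\<iota> -` fst ?c \<inter> \<iota> -` fst ?c)
        (\<lambda>z. coords \<A> ?c (\<iota> z) (S z (inv (coords \<A> ?c (\<iota> z)) v)))"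
      unfolding smooth_vf_along_def using c(1) by blast
    from smooth_funD[OF B this d(1)]
    have "smooth_on ?D ((\<lambda>z. coords \<A> ?c (\<iota> z) (S z (inv (coords \<A> ?c (\<iota> z)) v))) \<circ> chart_inv ?d)"
      by (rule smooth_on_subset) (auto simp: W_def)
    then show ?thesis
      by (simp add: Sr_def Let_def comp_def)
  qed
  have Jr_smooth: "smooth_on ?D (\<lambda>y. endo_rep \<A> ?c (J a) (?g y) v)" if "a \<in> {1, 2, 3}" for a v
    by (rule smooth_on_compose[OF D(1) T endo_rep_smooth[OF A admissible_basisD(2)[OF J that] openU c(1)] g])
  have lin: "linear (endo_rep \<A> ?c (J a) (?g y))" "linear (Sr y)" if a: "a \<in> {1, 2, 3}" and y: "y \<in> ?D" for a y
  proof -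
    show "linear (endo_rep \<A> ?c (J a) (?g y))"
      by (rule endo_rep_linear[OF A c(1) _ admissible_basisD(2)[OF J a]]) (use g(2) y in blast)
    obtain z where z: "z \<in> fst ?d" "\<iota> z \<in> fst ?c" "\<iota> z \<in> U" "y = snd ?d z"
      using y unfolding W_def by blast
    note l = admissible_basisD(4-6)[OF J z(3)]
    have "linear (S z)"
      unfolding t[OF z(3)] by (intro linear_compose_add linear_compose_scale_right l)
    then have "linear (coords \<A> ?c (\<iota> z) \<circ> (S z \<circ> inv (coords \<A> ?c (\<iota> z))))"
      by (intro linear_compose coords_inv(3)[OF A c(1) z(2)] coords_linear[OF A c(1) z(2)])
    moreover have "Sr y = coords \<A> ?c (\<iota> z) \<circ> (S z \<circ> inv (coords \<A> ?c (\<iota> z)))"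
      by (simp add: fun_eq_iff Sr_def Let_def z(4) chart_inv_chart[OF B d(1) z(1)])
    ultimately show "linear (Sr y)" by simp
  qed
  obtain e :: 'e where e: "e \<in> Basis" using nonempty_Basis by blast
  have t_smooth: "smooth_on ?D ((\<lambda>z. t z a) \<circ> chart_inv ?d)" if a: "a \<in> {1, 2, 3}" for a
  proof -
    note smooth_on_apply[OF D(1) lin(1)[OF a] Jr_smooth[OF a] Sr_smooth]
      smooth_on_apply[OF D(1) lin(2)[OF a] Sr_smooth Jr_smooth[OF a]]
    from smooth_on_linear[OF bounded_linear_inner_left D(1) smooth_on_add[OF D(1) this]]
    have "smooth_on ?D (\<lambda>y. (endo_rep \<A> ?c (J a) (?g y) (Sr y e) + Sr y (endo_rep \<A> ?c (J a) (?g y) e)) \<bullet> e)" .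
    \<comment> \<open>As \<open>e\<close> is a unit vector, the pairing with \<open>e\<close> is
      minus twice the coefficient.\<close>
    then have "smooth_on ?D (\<lambda>y. (- 1 / 2) *\<^sub>R ((endo_rep \<A> ?c (J a) (?g y) (Sr y e)
         + Sr y (endo_rep \<A> ?c (J a) (?g y) e)) \<bullet> e))"
      by (rule smooth_on_linear[OF bounded_linear_scaleR_right D(1)])
    then show ?thesis
    proof (rule smooth_on_transform[OF D(1)])
      fix y assume "y \<in> ?D"
      then obtain z where z: "z \<in> fst ?d" "\<iota> z \<in> fst ?c" "\<iota> z \<in> U" "y = snd ?d z"
        unfolding W_def by blast
      define w where "w = inv (coords \<A> ?c (\<iota> z)) e"
      have e_w: "e = coords \<A> ?c (\<iota> z) w"
        by (simp add: w_def coords_inv[OF A c(1) z(2)])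
      have Sr: "Sr y (coords \<A> ?c (\<iota> z) u) = coords \<A> ?c (\<iota> z) (S z u)" for u
        by (simp add: Sr_def Let_def z(4) chart_inv_chart[OF B d(1) z(1)] coords_inv[OF A c(1) z(2)])
      have Jr: "endo_rep \<A> ?c (J a) (?g y) (coords \<A> ?c (\<iota> z) u) = coords \<A> ?c (\<iota> z) (J a (\<iota> z) u)" for u
        using endo_rep_coords[OF A c(1) z(2)] by (simp add: z(4) chart_inv_chart[OF B d(1) z(1)])
      note l = coords_linear[OF A c(1) z(2)]
      have "endo_rep \<A> ?c (J a) (?g y) (Sr y e) + Sr y (endo_rep \<A> ?c (J a) (?g y) e)
        = coords \<A> ?c (\<iota> z) (J a (\<iota> z) (S z w) + S z (J a (\<iota> z) w))"
        unfolding e_w Sr Jr linear_add[OF l] ..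
      also have "\<dots> = - (t z a *\<^sub>R e + t z a *\<^sub>R e)"
        unfolding anti[OF a z(3)] by (simp add: linear_neg[OF l] linear_diff[OF l] linear_scale[OF l] e_w)
      finally show "(- 1 / 2) *\<^sub>R ((endo_rep \<A> ?c (J a) (?g y) (Sr y e)
         + Sr y (endo_rep \<A> ?c (J a) (?g y) e)) \<bullet> e) = ((\<lambda>z. t z a) \<circ> chart_inv ?d) y"
        using e by (simp add: z(4) chart_inv_chart[OF B d(1) z(1)] inner_diff_left)
    qed
  qed
  define s where "s a z = t z a - (if a = 1 then 1 else 0)" for a z
  have s_diff: "(s a \<circ> chart_inv ?d) differentiable at (snd ?d x)" if a: "a \<in> {1, 2, 3}" for a
  proof -
    have "(\<lambda>y. ((\<lambda>z. t z a) \<circ> chart_inv ?d) y - (if a = 1 then 1 else 0)) differentiable at (snd ?d x)"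
      by (intro differentiable_diff differentiable_const smooth_on_differentiable[OF t_smooth[OF a] D(2)])
    then show ?thesis by (simp add: s_def comp_def)
  qed
  \<comment> \<open>\<open>t x\<close> comes from a choice operator; the anticommutators force it to
    be \<open>(1, 0, 0)\<close>, because \<open>S x\<close> is \<open>J 1\<close> at
    \<open>\<iota> x\<close>.\<close>
  have s_zero: "s a x = 0" if a: "a \<in> {1, 2, 3}" for a
  proof -
    have "J a (\<iota> x) (J 1 (\<iota> x) e) + J 1 (\<iota> x) (J a (\<iota> x) e) = - (t x a *\<^sub>R e + t x a *\<^sub>R e)"
      using anti[OF a I(1), of e] by (simp only: J1)
    moreover have "J a (\<iota> x) (J 1 (\<iota> x) e) + J 1 (\<iota> x) (J a (\<iota> x) e) = - ((if a = 1 then 1 else 0) *\<^sub>R e + (if a = 1 then 1 else 0) *\<^sub>R e)"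
      using a by (auto simp: quaternion_relations[OF J I(1)] scaleR_2 simp del: One_nat_def)
    ultimately have "(t x a + t x a) *\<^sub>R e = ((if a = 1 then 1 else 0) + (if a = 1 then 1 else 0)) *\<^sub>R e"
      by (simp only: scaleR_add_left neg_equal_iff_equal)
    then show ?thesis
      using nonzero_Basis[OF e] unfolding s_def scaleR_cancel_right by (auto split: if_splits)
  qed
  \<comment> \<open>Along N the vector \<open>(1 + s 1, s 2, s 3)\<close> has length one and at
    \<open>x\<close> it is \<open>(1, 0, 0)\<close>, so its derivative there has no first component.
    This keeps \<open>J 1\<close> out of the error term.\<close>
  have s1: "mderiv \<B> (s 1) x u = 0" for u
  proof -
    let ?f = "\<lambda>a. s a \<circ> chart_inv ?d"
    let ?f' = "\<lambda>a. frechet_derivative (?f a) (at (snd ?d x))"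
    have f: "(?f a has_derivative ?f' a) (at (snd ?d x))" if "a \<in> {1, 2, 3}" for a
      by (rule has_derivative_frechet[OF s_diff[OF that]])
    have f0: "?f a (snd ?d x) = 0" if "a \<in> {1, 2, 3}" for a
      using s_zero[OF that] by (simp add: chart_inv_chart[OF B d])
    have "((\<lambda>y. (1 + ?f 1 y) * (1 + ?f 1 y) + ?f 2 y * ?f 2 y + ?f 3 y * ?f 3 y) has_derivative
       (\<lambda>u. ((1 + ?f 1 (snd ?d x)) * ?f' 1 u + ?f' 1 u * (1 + ?f 1 (snd ?d x)))
         + (?f 2 (snd ?d x) * ?f' 2 u + ?f' 2 u * ?f 2 (snd ?d x))
         + (?f 3 (snd ?d x) * ?f' 3 u + ?f' 3 u * ?f 3 (snd ?d x)))) (at (snd ?d x))"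
      by (intro has_derivative_add has_derivative_mult f)
        (use has_derivative_add[OF has_derivative_const f[of 1]] in auto)
    then have 1: "((\<lambda>y. (1 + ?f 1 y) * (1 + ?f 1 y) + ?f 2 y * ?f 2 y + ?f 3 y * ?f 3 y) has_derivative
       (\<lambda>u. 2 * ?f' 1 u)) (at (snd ?d x))"
      using f0[of 1] f0[of 2] f0[of 3] by (simp del: o_apply)
    have "(1 + ?f 1 y) * (1 + ?f 1 y) + ?f 2 y * ?f 2 y + ?f 3 y * ?f 3 y = 1" if y: "y \<in> ?D" for y
    proof -
      obtain z where z: "z \<in> fst ?d" "\<iota> z \<in> U" "y = snd ?d z"
        using y unfolding W_def by blast
      show ?thesis
        using section_coefficients_unit[OF J z(2) S t[OF z(2)]]
        by (simp add: s_def z chart_inv_chart[OF B d(1) z(1)] power2_eq_square)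
    qed
    note unit = has_derivative_cong_open[OF D this]
    have "((\<lambda>y. 1) has_derivative (\<lambda>u. 2 * ?f' 1 u)) (at (snd ?d x))"
      using 1 by (simp only: unit)
    from has_derivative_unique[OF this has_derivative_const] show ?thesis
      by (simp add: mderiv_chart_at fun_eq_iff)
  qed
  have rel: "tangent_map \<B> \<A> \<iota> z (Jhat z v) =
       J 1 (\<iota> z) (tangent_map \<B> \<A> \<iota> z v)
         + (\<Sum>a\<in>{1, 2, 3}. s a z *\<^sub>R J a (\<iota> z) (tangent_map \<B> \<A> \<iota> z v))" if "z \<in> W" for z v
  proof -
    have "\<iota> z \<in> U" using that by (simp add: W_def)
    then show ?thesis
      using S[of z v] t by (simp add: s_def algebra_simps)
  qed
  have "frame_at \<B> Jhat \<A> Q \<iota> x U J W s"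
    unfolding frame_at_def
    by (intro conjI ballI allI J W s_diff s_zero s1 rel)
  then show thesis by (rule that)
qed

text \<open>The derivatives of \<open>s 2\<close> and \<open>s 3\<close> enter exactly like \<beta>
  and \<delta>, whence the sums \<open>b\<close> and \<open>c\<close>. Since
  \<open>J 1 J 2 = J 3\<close> and \<open>J 1 J 3 = - J 2\<close>, the part with \<open>w\<close>
  undifferentiated is \<open>(b (Jhat u) + c u) J 2 w + (c (Jhat u) - b u) J 3 w\<close>, and
  \<open>J 3 = - J 2 J 1\<close> pulls \<open>J 2\<close> out. For \<open>b = \<gamma> 3\<close> and
  \<open>c = - \<gamma> 2\<close> the two coefficients are \<open>\<psi> u\<close> and
  \<open>\<psi> (Jhat u)\<close>.\<close>

lemma nijenhuis_eq_J2:
  fixes \<omega> :: "'m \<Rightarrow> 'e \<Rightarrow> 'e \<Rightarrow> real" and Dvol D :: "('m, 'e) conn"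
    and s :: "nat \<Rightarrow> 'n \<Rightarrow> real" and x :: 'n and \<beta> \<delta> :: "'e \<Rightarrow> real"
  defines "tm \<equiv> tangent_map \<B> \<A> \<iota>"
  defines "b \<equiv> \<lambda>u. \<beta> (tm x u) + mderiv \<B> (s 2) x u" and "c \<equiv> \<lambda>u. \<delta> (tm x u) + mderiv \<B> (s 3) x u"
  assumes qsH: "almost_qsH \<A> Q \<omega>" "unimodular_oproiu \<A> Q \<omega> Dvol" "qsH_connection \<A> \<omega> Dvol D"
    and tf: "torsion_free \<A> D \<or> torsion_free \<A> Dvol"
    and F: "frame_at \<B> Jhat \<A> Q \<iota> x U J W s"
    and cov: "\<And>v Y. smooth_vf_at \<A> (\<iota> x) Y \<Longrightarrow> cov_endo D (J 1) (\<iota> x) v Y =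
       \<beta> v *\<^sub>R J 2 (\<iota> x) (Y (\<iota> x)) + \<delta> v *\<^sub>R J 3 (\<iota> x) (Y (\<iota> x))"
    and X: "smooth_vf_at \<B> x X" and Y: "smooth_vf_at \<B> x Y"
  shows "tm x (nijenhuis \<B> Jhat X Y x) = J 2 (\<iota> x) (tm x (
      (b (Jhat x (X x)) + c (X x)) *\<^sub>R Y x - (c (Jhat x (X x)) - b (X x)) *\<^sub>R Jhat x (Y x)
      - (b (Jhat x (Y x)) + c (Y x)) *\<^sub>R X x + (c (Jhat x (Y x)) - b (Y x)) *\<^sub>R Jhat x (X x)))"
    and "\<And>v. J 1 (\<iota> x) (tm x v) = tm x (Jhat x v)"
proof -
  let ?p = "\<iota> x"
  have J: "admissible_basis \<A> Q U J" and W: "open W" "x \<in> W" "\<iota> ` W \<subseteq> U"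
    and s1: "\<And>u. mderiv \<B> (s 1) x u = 0"
    using F by (simp_all add: frame_at_def)
  have s0: "s a x = 0" and ds: "(s a \<circ> chart_inv (chart_at \<B> x)) differentiable at (snd (chart_at \<B> x) x)"
    if "a \<in> {1, 2, 3}" for a
    using F that unfolding frame_at_def by blast+
  have rel: "tangent_map \<B> \<A> \<iota> z (Jhat z v) = J 1 (\<iota> z) (tangent_map \<B> \<A> \<iota> z v)
       + (\<Sum>a\<in>{1, 2, 3}. s a z *\<^sub>R J a (\<iota> z) (tangent_map \<B> \<A> \<iota> z v))" if "z \<in> W" for z v
    using F that unfolding frame_at_def by blast
  have p: "?p \<in> U" using W by blast
  have Jh: "smooth_endo \<B> UNIV Jhat" "\<And>v. Jhat x (Jhat x v) = - v"
    using Jhat by (auto simp: almost_complex_structure_def)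
  note tml = tangent_map_linear[OF A B sub, of x, folded tm_def]
  show J1: "J 1 ?p (tm x v) = tm x (Jhat x v)" for v
    using rel[OF W(2), of v] s0 by (simp add: tm_def)
  note q = quaternion_relations[OF J p]
  note lin = admissible_basisD(4-6)[OF J p]
  let ?E = "\<lambda>u w. \<Sum>a\<in>{1, 2, 3}. mderiv \<B> (s a) x u *\<^sub>R J a ?p w"
  let ?C = "\<lambda>v w. \<beta> v *\<^sub>R J 2 ?p w + \<delta> v *\<^sub>R J 3 ?p w"
  have nij: "tm x (nijenhuis \<B> Jhat X Y x) =
      nijenhuis \<A> (J 1) (coord_vf \<A> ?p (tm x (X x))) (coord_vf \<A> ?p (tm x (Y x))) ?p
      + ?E (Jhat x (X x)) (tm x (Y x)) - ?E (Jhat x (Y x)) (tm x (X x))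
      - J 1 ?p (?E (X x) (tm x (Y x))) + J 1 ?p (?E (Y x) (tm x (X x)))"
    unfolding tm_def
    by (rule nijenhuis_immersion[OF A B sub Jh admissible_basisD(2)[OF J] admissible_basisD(1)[OF J]
          q(1) W ds s0 rel X Y])
  have amb: "nijenhuis \<A> (J 1) (coord_vf \<A> ?p v) (coord_vf \<A> ?p w) ?p =
     ?C (J 1 ?p v) w - ?C (J 1 ?p w) v - J 1 ?p (?C v w) + J 1 ?p (?C w v)" for v w
    using nijenhuis_torsion_free[OF A qsH J p tf, of ?C "coord_vf \<A> ?p v" "coord_vf \<A> ?p w"]
      cov coord_vf_smooth_at[OF A] by (simp only: coord_vf_self[OF A])
  show "tm x (nijenhuis \<B> Jhat X Y x) = J 2 ?p (tm x (
      (b (Jhat x (X x)) + c (X x)) *\<^sub>R Y x - (c (Jhat x (X x)) - b (X x)) *\<^sub>R Jhat x (Y x)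
      - (b (Jhat x (Y x)) + c (Y x)) *\<^sub>R X x + (c (Jhat x (Y x)) - b (Y x)) *\<^sub>R Jhat x (X x)))"
    unfolding nij amb J1 b_def c_def
    by (simp add: s1 linear_add[OF lin(1)] linear_scale[OF lin(1)] linear_diff[OF lin(1)]
        linear_add[OF tml] linear_scale[OF tml] linear_diff[OF tml]
        linear_add[OF lin(2)] linear_scale[OF lin(2)] linear_diff[OF lin(2)] q
        J1[symmetric] algebra_simps del: One_nat_def)
qed

end

theorem proposition2p15:
  fixes \<A> :: "('m::{t2_space, second_countable_topology}, 'e::euclidean_space) atlas"
    and \<B> :: "('n::{t2_space, second_countable_topology}, 'f::euclidean_space) atlas"
    and Q :: "'m \<Rightarrow> ('e \<Rightarrow> 'e) set"
    and \<omega> :: "'m \<Rightarrow> 'e \<Rightarrow> 'e \<Rightarrow> real"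
    and \<iota> :: "'n \<Rightarrow> 'm"
    and Jhat :: "'n \<Rightarrow> 'f \<Rightarrow> 'f"
    and Dvol D :: "('m, 'e) conn"
    and J :: "nat \<Rightarrow> 'm \<Rightarrow> 'e \<Rightarrow> 'e"
    and \<gamma> :: "nat \<Rightarrow> 'm \<Rightarrow> 'e \<Rightarrow> real"
    and U :: "'m set" and W :: "'n set"
    and n k :: nat
  assumes M: "smooth_atlas \<A>" "DIM('e) = 4 * n" "n > 1"
    and qsH: "almost_qsH \<A> Q \<omega>"
    and Dvol: "unimodular_oproiu \<A> Q \<omega> Dvol"
    and D: "qsH_connection \<A> \<omega> Dvol D"
    and N: "smooth_atlas \<B>" "DIM('f) = 2 * k"
    and sub: "almost_complex_submanifold \<B> Jhat \<A> Q \<iota>"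
    and adapted: "adapted_basis \<B> Jhat \<A> Q \<iota> W U J"
    and forms: "connection_forms \<A> D U J \<gamma>"
    and torsion_free_or_X345: "torsion_free \<A> D \<or> torsion_free \<A> Dvol"
  shows "\<forall>X Y. smooth_vf \<B> UNIV X \<longrightarrow> smooth_vf \<B> UNIV Y \<longrightarrow>
           section_TQ \<B> \<A> Q \<iota> UNIV (nijenhuis \<B> Jhat X Y) \<and>
           section_TQ \<B> \<A> Q \<iota> W
             (V_psi Jhat (\<lambda>x v. psi_form J \<gamma> (\<iota> x) (tangent_map \<B> \<A> \<iota> x v)) X Y)"
proof (intro allI impI)
  fix X Y assume XY: "smooth_vf \<B> UNIV X" "smooth_vf \<B> UNIV Y"
  let ?tm = "tangent_map \<B> \<A> \<iota>"
  obtain S where S: "section_along \<B> \<A> Q \<iota> S" "\<And>z v. S z (?tm z v) = ?tm z (Jhat z v)"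
    and subm: "submanifold \<B> \<A> \<iota>" and Jh: "almost_complex_structure \<B> Jhat"
    using sub unfolding almost_complex_submanifold_def by blast
  have Jhat: "smooth_endo \<B> UNIV Jhat" "\<And>x v. Jhat x (Jhat x v) = - v"
    using Jh by (auto simp: almost_complex_structure_def)
  have Q: "almost_quaternionic \<A> Q" using qsH by (simp add: almost_qsH_def)
  note tf = torsion_free_or_X345
  have XYat: "smooth_vf_at \<B> x X" "smooth_vf_at \<B> x Y" for x
    using XY smooth_vf_atI[OF N(1) _ open_UNIV UNIV_I] by blast+
  note lin = tangent_map_linear[OF M(1) N(1) subm]
  have T: "subspace (range (?tm x))" for x
    by (rule linear_subspace_image[OF lin subspace_UNIV])
  have "?tm x (nijenhuis \<B> Jhat X Y x) \<in> TQ \<B> \<A> Q \<iota> x" for x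
  proof -
    \<comment> \<open>A fresh basis at each \<open>x\<close>, shadowing the adapted one, so the
      argument also covers points outside the given \<open>W\<close>.\<close>
    obtain U J W s where F: "frame_at \<B> Jhat \<A> Q \<iota> x U J W s"
      by (rule frame_at_exists[OF M(1) N(1) subm Jh Q S])
    then have J: "admissible_basis \<A> Q U J" and p: "\<iota> x \<in> U" by (auto simp: frame_at_def)
    have "\<exists>y z. \<forall>Y. smooth_vf_at \<A> (\<iota> x) Y \<longrightarrow>
        cov_endo D (J 1) (\<iota> x) v Y = y *\<^sub>R J 2 (\<iota> x) (Y (\<iota> x)) + z *\<^sub>R J 3 (\<iota> x) (Y (\<iota> x))" for v
      using cov_endo_Dvol[OF M(1) qsH Dvol D J p, of v] cov_endo_D[OF M(1) qsH Dvol D J p]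
      by metis
    then obtain \<beta> \<delta> where cov: "\<And>v Y. smooth_vf_at \<A> (\<iota> x) Y \<Longrightarrow>
        cov_endo D (J 1) (\<iota> x) v Y = \<beta> v *\<^sub>R J 2 (\<iota> x) (Y (\<iota> x)) + \<delta> v *\<^sub>R J 3 (\<iota> x) (Y (\<iota> x))"
      by metis
    \<comment> \<open>Here \<open>w\<close> depends on the chosen basis; it is enough that it is
      tangent to N.\<close>
    obtain w where w: "?tm x (nijenhuis \<B> Jhat X Y x) = J 2 (\<iota> x) (?tm x w)"
      and J1: "\<And>v. J 1 (\<iota> x) (?tm x v) = ?tm x (Jhat x v)"
      using nijenhuis_eq_J2[OF M(1) N(1) subm Jh qsH Dvol D tf F cov XYat] by blast
    show ?thesis
      unfolding w by (rule TQ_I(2)[OF J p T]) (use J1 in \<open>auto simp flip: w\<close>)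
  qed
  moreover have "smooth_vf \<B> UNIV (nijenhuis \<B> Jhat X Y)"
    by (rule nijenhuis_smooth[OF N(1) Jhat(1) open_UNIV subset_UNIV XY])
  ultimately have 1: "section_TQ \<B> \<A> Q \<iota> UNIV (nijenhuis \<B> Jhat X Y)"
    by (simp add: section_TQ_def)

  let ?\<psi> = "\<lambda>x v. psi_form J \<gamma> (\<iota> x) (?tm x v)"
  have J: "admissible_basis \<A> Q U J" and W: "open W" "\<iota> ` W \<subseteq> U"
    and J1: "\<And>x v. x \<in> W \<Longrightarrow> J 1 (\<iota> x) (?tm x v) = ?tm x (Jhat x v)"
    using adapted by (auto simp: adapted_basis_def)
  have \<gamma>: "smooth_1form \<A> U (\<gamma> 2)" "smooth_1form \<A> U (\<gamma> 3)"
    using forms by (auto simp: connection_forms_def)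
  have \<psi>: "?\<psi> x v = \<gamma> 3 (\<iota> x) (?tm x (Jhat x v)) - \<gamma> 2 (\<iota> x) (?tm x v)" if "x \<in> W" for x v
    by (simp only: psi_form_def J1[OF that])
  \<comment> \<open>Brings \<open>\<psi> (Jhat v)\<close> to the form
    \<open>- \<gamma> 3 v - \<gamma> 2 (Jhat v)\<close> that \<open>nijenhuis_eq_J2\<close>
    yields.\<close>
  have \<gamma>_Jhat: "\<gamma> 3 (\<iota> x) (?tm x (Jhat x (Jhat x v))) = - \<gamma> 3 (\<iota> x) (?tm x v)" if "x \<in> W" for x v
  proof -
    have "linear (\<gamma> 3 (\<iota> x))"
      using \<gamma>(2) W(2) that by (auto simp: smooth_1form_def)
    then show ?thesis
      by (simp add: Jhat(2) linear_neg[OF lin] linear_neg)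
  qed
  have "?tm x (V_psi Jhat ?\<psi> X Y x) \<in> TQ \<B> \<A> Q \<iota> x" if x: "x \<in> W" for x
  proof -
    have p: "\<iota> x \<in> U" using W(2) x by blast
    \<comment> \<open>An adapted basis induces \<open>Jhat\<close> at all points of
      \<open>W\<close>, so the error coefficients are zero and \<psi> appears without
      correction.\<close>
    have F: "frame_at \<B> Jhat \<A> Q \<iota> x U J W (\<lambda>a z. 0)"
      using J W x J1 by (simp add: frame_at_def mderiv_const comp_def)
    have cov: "cov_endo D (J 1) (\<iota> x) v Y =
        \<gamma> 3 (\<iota> x) v *\<^sub>R J 2 (\<iota> x) (Y (\<iota> x)) + (- \<gamma> 2 (\<iota> x) v) *\<^sub>R J 3 (\<iota> x) (Y (\<iota> x))"
      if "smooth_vf_at \<A> (\<iota> x) Y" for v Y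
      using forms p that by (simp add: connection_forms_def del: One_nat_def)
    have eq: "?tm x (nijenhuis \<B> Jhat X Y x) = J 2 (\<iota> x) (?tm x (V_psi Jhat ?\<psi> X Y x))"
      using nijenhuis_eq_J2(1)[OF M(1) N(1) subm Jh qsH Dvol D tf F cov XYat]
      unfolding V_psi_def \<psi>[OF x] \<gamma>_Jhat[OF x] by (simp add: mderiv_const minus_diff_commute)
    show ?thesis
      by (rule TQ_I(1)[OF J p T]) (use J1[OF x] in \<open>auto simp flip: eq\<close>)
  qed
  moreover have "smooth_vf \<B> W (V_psi Jhat ?\<psi> X Y)"
  proof -
    have XYW: "smooth_vf \<B> W X" "smooth_vf \<B> W Y"
      using XY smooth_vf_subset[OF N(1) _ subset_UNIV W(1)] by blast+
    note JXY = XYW[THEN smooth_endo_vf[OF N(1) Jhat(1) W(1) subset_UNIV]]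
    \<comment> \<open>\<open>V_psi\<close> is a signed sum of four terms of this shape, with
      \<open>Z\<close> and \<open>Z'\<close> among \<open>X\<close>, \<open>Y\<close> and their
      images under \<open>Jhat\<close>.\<close>
    have \<psi>_smooth: "smooth_vf \<B> W (\<lambda>x. ?\<psi> x (Z x) *\<^sub>R Z' x)"
      if Z: "smooth_vf \<B> W Z" "smooth_vf \<B> W Z'" for Z Z'
    proof -
      note g = smooth_1form_along[OF M(1) N(1) subm \<gamma>(1) admissible_basisD(1)[OF J] W Z(1)]
        smooth_1form_along[OF M(1) N(1) subm \<gamma>(2) admissible_basisD(1)[OF J] W
          smooth_endo_vf[OF N(1) Jhat(1) W(1) subset_UNIV Z(1)]]
      have "smooth_vf \<B> W (\<lambda>x. \<gamma> 3 (\<iota> x) (?tm x (Jhat x (Z x))) *\<^sub>R Z' x - \<gamma> 2 (\<iota> x) (?tm x (Z x)) *\<^sub>R Z' x)"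
        by (rule smooth_vf_diff[OF N(1) W(1) smooth_vf_scale[OF N(1) W(1) g(2) Z(2)]
              smooth_vf_scale[OF N(1) W(1) g(1) Z(2)]])
      then show ?thesis
        by (rule smooth_vf_cong[OF N(1) _ W(1)]) (simp add: \<psi> scaleR_diff_left)
    qed
    have "smooth_vf \<B> W (\<lambda>x. ?\<psi> x (X x) *\<^sub>R Y x - ?\<psi> x (Jhat x (X x)) *\<^sub>R Jhat x (Y x)
        - ?\<psi> x (Y x) *\<^sub>R X x + ?\<psi> x (Jhat x (Y x)) *\<^sub>R Jhat x (X x))"
      by (intro smooth_vf_add[OF N(1) W(1)] smooth_vf_diff[OF N(1) W(1)] \<psi>_smooth XYW JXY)
    then show ?thesis by (simp add: V_psi_def[abs_def])
  qed
  ultimately have "section_TQ \<B> \<A> Q \<iota> W (V_psi Jhat ?\<psi> X Y)"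
    by (simp add: section_TQ_def)
  with 1 show "section_TQ \<B> \<A> Q \<iota> UNIV (nijenhuis \<B> Jhat X Y) \<and>
      section_TQ \<B> \<A> Q \<iota> W (V_psi Jhat ?\<psi> X Y)" ..
qed

end
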